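(* Let $f$ be a non-negative (continuous) operator monotone function on $[0,\infty)$ with $f(1)=1$, and let $\sigma_f$ be the corresponding operator mean. Assume that $f(0)=0$ and $f(x^r)\ge f(x)^r$ for all $x>0$ and all $r\in(0,1)$. Then for every $A,B\in\mathbb{M}_n^+$, the limit $$\lim_{p\to\infty}(A^p\,\sigma_f\,B)^{1/p}$$ exists.
   Context: $\mathbb{M}_n$ is the algebra of $n\times n$ complex matrices and $\mathbb{M}_n^+$ the set of positive semidefinite matrices in $\mathbb{M}_n$. A real function $f$ on $[0,\infty)$ is operator monotone if $X\ge Y\ge0$ (in the positive semidefinite order) implies $f(X)\ge f(Y)$ for positive semidefinite matrices of every size. The operator mean (in the sense of Kubo-Ando) associated with $f$ is defined by $A\sigma_fB:=A^{1/2}f(A^{-1/2}BA^{-1/2})A^{1/2}$ for $A,B\in\mathbb{M}_n^+$ with $A$ positive definite, and extended to general $A,B\in\mathbb{M}_n^+$ by $A\sigma_fB:=\lim_{\varepsilon\searrow0}(A+\varepsilon I)\sigma_f(B+\varepsilon I)$. Powers $X^p$ with $p>0$ of positive semidefinite matrices are defined by functional calculus. The limit is over real $p\to\infty$. *)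

theory Defs
  imports "Jordan_Normal_Form.Schur_Decomposition"
begin

definition hermitian_mat :: "complex mat \<Rightarrow> bool" where
  "hermitian_mat A \<longleftrightarrow> square_mat A \<and> mat_adjoint A = A"

definition unitary_mat :: "complex mat \<Rightarrow> bool" where
  "unitary_mat U \<longleftrightarrow> square_mat U \<and>
     U * mat_adjoint U = 1\<^sub>m (dim_row U) \<and> mat_adjoint U * U = 1\<^sub>m (dim_row U)"

definition psd_mat :: "nat \<Rightarrow> complex mat \<Rightarrow> bool" where
  "psd_mat n A \<longleftrightarrow> A \<in> carrier_mat n n \<and> hermitian_mat A \<and>
     (\<forall>v \<in> carrier_vec n. 0 \<le> Re ((A *\<^sub>v v) \<bullet>c v))"

definition pd_mat :: "nat \<Rightarrow> complex mat \<Rightarrow> bool" where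
  "pd_mat n A \<longleftrightarrow> A \<in> carrier_mat n n \<and> hermitian_mat A \<and>
     (\<forall>v \<in> carrier_vec n. v \<noteq> 0\<^sub>v n \<longrightarrow> 0 < Re ((A *\<^sub>v v) \<bullet>c v))"

text \<open>
  Continuous functional calculus of a Hermitian matrix \<open>X = U diag(d) U*\<close>. The result depends
  only on the values of \<open>f\<close> on the spectrum of \<open>X\<close> and not on the chosen diagonalization
  (lemma \<open>mat_fun_unitary_diag\<close> below); for matrices that are not Hermitian it is unspecified.
\<close>
definition mat_fun :: "(real \<Rightarrow> real) \<Rightarrow> complex mat \<Rightarrow> complex mat" where
  "mat_fun f X = (THE Y. \<exists>U (d :: nat \<Rightarrow> real). U \<in> carrier_mat (dim_row X) (dim_row X) \<and> unitary_mat U \<and>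
     X = U * mat_diag (dim_row X) (\<lambda>i. complex_of_real (d i)) * mat_adjoint U \<and>
     Y = U * mat_diag (dim_row X) (\<lambda>i. complex_of_real (f (d i))) * mat_adjoint U)"

lemma mat_adjoint_carrier: "U \<in> carrier_mat n m \<Longrightarrow> mat_adjoint U \<in> carrier_mat m n"
  by (auto simp: mat_adjoint_def)

lemma unitary_diag_unique:
  fixes d e :: "nat \<Rightarrow> real" and f :: "real \<Rightarrow> real"
  assumes U: "U \<in> carrier_mat n n" "unitary_mat U" and V: "V \<in> carrier_mat n n" "unitary_mat V"
    and eq: "U * mat_diag n (\<lambda>i. complex_of_real (d i)) * mat_adjoint U
           = V * mat_diag n (\<lambda>i. complex_of_real (e i)) * mat_adjoint V"
  shows "U * mat_diag n (\<lambda>i. complex_of_real (f (d i))) * mat_adjoint U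
       = V * mat_diag n (\<lambda>i. complex_of_real (f (e i))) * mat_adjoint V"
proof -
  let ?D = "\<lambda>g :: nat \<Rightarrow> real. mat_diag n (\<lambda>i. complex_of_real (g i))"
  let ?U' = "mat_adjoint U" and ?V' = "mat_adjoint V"
  define W where "W = ?V' * U"
  have c: "?U' \<in> carrier_mat n n" "?V' \<in> carrier_mat n n" "\<And>g. ?D g \<in> carrier_mat n n"
    using U V by (auto intro: mat_adjoint_carrier)
  have as: "X * Y * Z = X * (Y * Z)"
    if "X \<in> carrier_mat n n" "Y \<in> carrier_mat n n" "Z \<in> carrier_mat n n" for X Y Z :: "complex mat"
    using that by (rule assoc_mult_mat)
  have cl: "X * Y \<in> carrier_mat n n"
    if "X \<in> carrier_mat n n" "Y \<in> carrier_mat n n" for X Y :: "complex mat"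
    using that by (rule mult_carrier_mat)
  have W: "W \<in> carrier_mat n n" using U c by (simp add: W_def)
  have uu: "?U' * U = 1\<^sub>m n" "U * ?U' = 1\<^sub>m n" "?V' * V = 1\<^sub>m n" "V * ?V' = 1\<^sub>m n"
    using U V by (auto simp: unitary_mat_def)
  have l: "?V' * (U * ?D g * ?U') * U = W * ?D g" for g
  proof -
    have "?V' * (U * ?D g * ?U') * U = ?V' * U * ?D g * (?U' * U)"
      using U(1) V(1) c by (simp add: as cl)
    then show ?thesis using W c(3)[of g] by (simp add: uu W_def right_mult_one_mat[of _ n n])
  qed
  have r: "?V' * (V * ?D g * ?V') * U = ?D g * W" for g
  proof -
    have "?V' * (V * ?D g * ?V') * U = (?V' * V) * (?D g * (?V' * U))"
      using U(1) V(1) c by (simp add: as cl)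
    then show ?thesis using W c(3)[of g] by (simp add: uu W_def left_mult_one_mat[of _ n n])
  qed
  have WD: "W * ?D d = ?D e * W" using l[of d] r[of e] eq by simp
  have ent: "W $$ (i,j) * complex_of_real (d j) = complex_of_real (e i) * W $$ (i,j)"
    if "i < n" "j < n" for i j
    using arg_cong[OF WD, of "\<lambda>M. M $$ (i,j)"] that
    by (simp add: mat_diag_mult_left[OF W] mat_diag_mult_right[OF W])
  have WF: "W * ?D (\<lambda>i. f (d i)) = ?D (\<lambda>i. f (e i)) * W"
  proof (rule eq_matI)
    fix i j
    assume "i < dim_row (?D (\<lambda>i. f (e i)) * W)" "j < dim_col (?D (\<lambda>i. f (e i)) * W)"
    then have ij: "i < n" "j < n" using W by (auto simp: mat_diag_def)
    from ent[OF this]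
    have "W $$ (i,j) * complex_of_real (f (d j)) = complex_of_real (f (e i)) * W $$ (i,j)"
      by (cases "W $$ (i,j) = 0") auto
    with ij show "(W * ?D (\<lambda>i. f (d i))) $$ (i,j) = (?D (\<lambda>i. f (e i)) * W) $$ (i,j)"
      by (simp add: mat_diag_mult_left[OF W] mat_diag_mult_right[OF W])
  qed (use W in \<open>auto simp: mat_diag_def\<close>)
  have undo_conj: "V * (?V' * M * U) * ?U' = M" if "M \<in> carrier_mat n n" for M
  proof -
    have "V * (?V' * M * U) * ?U' = (V * ?V') * M * (U * ?U')"
      using U(1) V(1) c that by (simp add: as cl)
    then show ?thesis using that by (simp add: uu)
  qed
  have "U * ?D (\<lambda>i. f (d i)) * ?U' = V * (W * ?D (\<lambda>i. f (d i))) * ?U'"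
    using undo_conj[of "U * ?D (\<lambda>i. f (d i)) * ?U'"] l[of "\<lambda>i. f (d i)"] U(1) c by (simp add: cl)
  also have "\<dots> = V * ?D (\<lambda>i. f (e i)) * ?V'"
    using undo_conj[of "V * ?D (\<lambda>i. f (e i)) * ?V'"] r[of "\<lambda>i. f (e i)"] V(1) c WF by (simp add: cl)
  finally show ?thesis .
qed

lemma mat_fun_unitary_diag:
  fixes d :: "nat \<Rightarrow> real"
  assumes U: "U \<in> carrier_mat n n" "unitary_mat U"
  shows "mat_fun f (U * mat_diag n (\<lambda>i. complex_of_real (d i)) * mat_adjoint U)
       = U * mat_diag n (\<lambda>i. complex_of_real (f (d i))) * mat_adjoint U"
proof -
  let ?X = "U * mat_diag n (\<lambda>i. complex_of_real (d i)) * mat_adjoint U"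
  have [simp]: "dim_row ?X = n" using U by simp
  show ?thesis
    unfolding mat_fun_def \<open>dim_row ?X = n\<close>
  proof (rule the_equality, goal_cases)
    case 1
    show ?case using U by (intro exI[of _ U] exI[of _ d]) simp
  next
    case (2 Y)
    then obtain V e where "V \<in> carrier_mat n n" "unitary_mat V"
      and "?X = V * mat_diag n (\<lambda>i. complex_of_real (e i)) * mat_adjoint V"
      and Y: "Y = V * mat_diag n (\<lambda>i. complex_of_real (f (e i))) * mat_adjoint V"
      by (elim exE conjE)
    then show ?case using unitary_diag_unique[OF U, of V d e f] by simp
  qed
qed

definition mat_powr :: "complex mat \<Rightarrow> real \<Rightarrow> complex mat" where
  "mat_powr X p = mat_fun (\<lambda>x. x powr p) X"

definition operator_monotone :: "(real \<Rightarrow> real) \<Rightarrow> bool" where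
  "operator_monotone f \<longleftrightarrow>
     (\<forall>n X Y. psd_mat n X \<and> psd_mat n Y \<and> psd_mat n (X - Y) \<longrightarrow> psd_mat n (mat_fun f X - mat_fun f Y))"

definition mat_tendsto :: "nat \<Rightarrow> ('b \<Rightarrow> complex mat) \<Rightarrow> complex mat \<Rightarrow> 'b filter \<Rightarrow> bool" where
  "mat_tendsto n F L G \<longleftrightarrow> L \<in> carrier_mat n n \<and>
     (\<forall>i<n. \<forall>j<n. ((\<lambda>x. F x $$ (i, j)) \<longlongrightarrow> L $$ (i, j)) G)"

definition op_mean_pd :: "(real \<Rightarrow> real) \<Rightarrow> complex mat \<Rightarrow> complex mat \<Rightarrow> complex mat" where
  "op_mean_pd f A B =
     mat_powr A (1/2) * mat_fun f (mat_powr A (-1/2) * B * mat_powr A (-1/2)) * mat_powr A (1/2)"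

definition op_mean :: "nat \<Rightarrow> (real \<Rightarrow> real) \<Rightarrow> complex mat \<Rightarrow> complex mat \<Rightarrow> complex mat" where
  "op_mean n f A B =
     (if pd_mat n A then op_mean_pd f A B
      else (THE L. mat_tendsto n
              (\<lambda>\<epsilon>::real. op_mean_pd f (A + complex_of_real \<epsilon> \<cdot>\<^sub>m 1\<^sub>m n) (B + complex_of_real \<epsilon> \<cdot>\<^sub>m 1\<^sub>m n))
              L (at_right 0)))"

end

theory Submission
  imports Defs "Jordan_Normal_Form.Spectral_Radius" "HOL-Analysis.Elementary_Metric_Spaces"
begin

text \<open>
  Write \<open>A \<sigma> B\<close> for the operator mean. The matrix \<open>B\<close> is squeezed by its range projection \<open>P\<close>: there are
  \<open>c, C \<in> (0,1]\<close> with \<open>c P \<le> B\<close> and \<open>C B \<le> P\<close>. Means are monotone and satisfy \<open>c (A \<sigma> B) \<le> A \<sigma> (c B)\<close> for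
  \<open>0 \<le> c \<le> 1\<close> (lemma \<open>op_mean_scale\<close>), so \<open>A\<^sup>p \<sigma> B\<close> lies between the multiples \<open>c\<close> and \<open>1/C\<close> of \<open>A\<^sup>p \<sigma> P\<close>.
  Taking \<open>p\<close>-th roots preserves the order for \<open>p \<ge> 1\<close> by the Loewner--Heinz inequality and sends both constants to 1
  as \<open>p \<rightarrow> \<infinity>\<close>. Hence the claim for \<open>B\<close> follows from the claim for the projection \<open>P\<close>.

  For a projection the roots \<open>(A\<^sup>p \<sigma> P)\<^sup>1\<^sup>/\<^sup>p\<close> decrease in the Loewner order. Indeed, if \<open>A\<close> is positive definite
  and \<open>k(x) = f(x)/x\<close>, then \<open>A \<sigma> P = k(P A\<^sup>-\<^sup>1 P)\<close> (lemma \<open>op_mean_pd_projection\<close>), and this expression is antitone in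
  the compression \<open>P A\<^sup>-\<^sup>1 P\<close> because the mean is monotone in its first argument. Hansen's inequality for the operator
  monotone function \<open>x\<^sup>r\<close> gives \<open>P A\<^sup>-\<^sup>r P \<le> (P A\<^sup>-\<^sup>1 P)\<^sup>r\<close>, and the hypothesis \<open>f(x)\<^sup>r \<le> f(x\<^sup>r)\<close> divided by \<open>x\<^sup>r\<close> is
  \<open>k(x)\<^sup>r \<le> k(x\<^sup>r)\<close>. Together they yield \<open>(A \<sigma> P)\<^sup>r \<le> A\<^sup>r \<sigma> P\<close> (lemma \<open>op_mean_pd_projection_powr_le\<close>).
  With \<open>A\<^sup>q\<close> in place of \<open>A\<close> and \<open>r = p/q\<close>, a \<open>p\<close>-th root turns this into
  \<open>(A\<^sup>q \<sigma> P)\<^sup>1\<^sup>/\<^sup>q \<le> (A\<^sup>p \<sigma> P)\<^sup>1\<^sup>/\<^sup>p\<close> for \<open>1 < p < q\<close>. A decreasing family of positive semidefinite matrices converges: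
  its quadratic forms do, and polarization recovers the entries.

  For singular \<open>A\<close> the mean is itself a limit along \<open>A + \<epsilon>\<close> and \<open>B + \<epsilon>\<close>. The power inequality passes to it
  (lemma \<open>op_mean_projection_powr_le\<close>) because \<open>A \<sigma> P \<le> (A + \<epsilon>) \<sigma> P\<close> and \<open>(A + \<epsilon>)\<^sup>r \<le> A\<^sup>r + \<epsilon>\<^sup>r\<close>: both
  sides are estimated by monotonicity, and only the upper bound has to converge.

  The analytic input is Hansen's inequality \<open>C\<^sup>\<dagger> g(X) C \<le> g(C\<^sup>\<dagger> X C)\<close> for contractions \<open>C\<close> and nonnegative operator
  monotone \<open>g\<close> (theorem \<open>hansen\<close>), which follows from a unitary dilation of \<open>C\<close>. Besides the compression
  inequality for powers it yields monotonicity of the mean in the first argument and the scaling inequality.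
\<close>

section \<open>The adjoint, quadratic forms and the Loewner order\<close>

abbreviation adj :: "complex mat \<Rightarrow> complex mat" ("_\<^sup>\<dagger>" [1000] 1000) where
  "A\<^sup>\<dagger> \<equiv> mat_adjoint A"

lemma adj_dim [simp]: "dim_row A\<^sup>\<dagger> = dim_col A" "dim_col A\<^sup>\<dagger> = dim_row A"
  by (auto simp: mat_adjoint_def)

lemma adj_index [simp]:
  "i < dim_col A \<Longrightarrow> j < dim_row A \<Longrightarrow> A\<^sup>\<dagger> $$ (i, j) = cnj (A $$ (j, i))"
  by (auto simp: mat_adjoint_def mat_of_rows_index)

lemma adj_carrier [simp, intro]: "A \<in> carrier_mat n m \<Longrightarrow> A\<^sup>\<dagger> \<in> carrier_mat m n"
  by (auto intro: mat_adjoint_carrier)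

lemma adj_adj [simp]: "(A\<^sup>\<dagger>)\<^sup>\<dagger> = A"
  by (rule eq_matI) auto

lemma adj_add: "A \<in> carrier_mat n m \<Longrightarrow> B \<in> carrier_mat n m \<Longrightarrow> (A + B)\<^sup>\<dagger> = A\<^sup>\<dagger> + B\<^sup>\<dagger>"
  by (rule eq_matI) auto

lemma adj_minus: "A \<in> carrier_mat n m \<Longrightarrow> B \<in> carrier_mat n m \<Longrightarrow> (A - B)\<^sup>\<dagger> = A\<^sup>\<dagger> - B\<^sup>\<dagger>"
  by (rule eq_matI) auto

lemma adj_smult: "(c \<cdot>\<^sub>m A)\<^sup>\<dagger> = cnj c \<cdot>\<^sub>m A\<^sup>\<dagger>"
  by (rule eq_matI) auto

lemma adj_one [simp]: "(1\<^sub>m n)\<^sup>\<dagger> = 1\<^sub>m n"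
  by (rule eq_matI) auto

lemma adj_zero [simp]: "(0\<^sub>m n m)\<^sup>\<dagger> = 0\<^sub>m m n"
  by (rule eq_matI) auto

lemma adj_mult:
  assumes "A \<in> carrier_mat n m" "B \<in> carrier_mat m k"
  shows "(A * B)\<^sup>\<dagger> = B\<^sup>\<dagger> * A\<^sup>\<dagger>"
  using assms by (intro eq_matI) (auto simp: scalar_prod_def ac_simps intro!: sum.cong)

lemma adj_mat_diag [simp]:
  "(mat_diag n (\<lambda>i. complex_of_real (d i)))\<^sup>\<dagger> = mat_diag n (\<lambda>i. complex_of_real (d i))"
  by (rule eq_matI) (auto simp: mat_diag_def)

lemma adj_four_block:
  assumes "A \<in> carrier_mat n1 m1" "B \<in> carrier_mat n1 m2" "C \<in> carrier_mat n2 m1" "D \<in> carrier_mat n2 m2"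
  shows "(four_block_mat A B C D)\<^sup>\<dagger> = four_block_mat A\<^sup>\<dagger> C\<^sup>\<dagger> B\<^sup>\<dagger> D\<^sup>\<dagger>"
  using assms by (intro eq_matI) auto

lemma sprod_eq_sum:
  "v \<in> carrier_vec n \<Longrightarrow> w \<in> carrier_vec n \<Longrightarrow> v \<bullet>c w = (\<Sum>i<n. v $ i * cnj (w $ i))"
  by (simp add: scalar_prod_def atLeast0LessThan)

text \<open>
  With the convention that \<open>\<bullet>c\<close> is conjugate linear in its second argument, this is the defining property of the adjoint.
\<close>

lemma cscalar_prod_adj:
  assumes "A \<in> carrier_mat n m" "v \<in> carrier_vec m" "w \<in> carrier_vec n"
  shows "(A *\<^sub>v v) \<bullet>c w = v \<bullet>c (A\<^sup>\<dagger> *\<^sub>v w)"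
proof -
  have 1: "(A *\<^sub>v v) $ i = (\<Sum>j<m. A $$ (i,j) * v $ j)" if "i < n" for i
    using assms that by (simp add: scalar_prod_def atLeast0LessThan)
  have 2: "conjugate ((A\<^sup>\<dagger> *\<^sub>v w) $ j) = (\<Sum>i<n. A $$ (i,j) * cnj (w $ i))" if "j < m" for j
    using assms that by (simp add: scalar_prod_def atLeast0LessThan)
  have "(A *\<^sub>v v) \<bullet>c w = (\<Sum>i<n. (A *\<^sub>v v) $ i * cnj (w $ i))"
    using assms(3) by (simp add: scalar_prod_def atLeast0LessThan)
  also have "\<dots> = (\<Sum>i<n. \<Sum>j<m. v $ j * (A $$ (i,j) * cnj (w $ i)))"
  proof (rule sum.cong[OF refl])
    fix i assume "i \<in> {..<n}"
    then show "(A *\<^sub>v v) $ i * cnj (w $ i) = (\<Sum>j<m. v $ j * (A $$ (i,j) * cnj (w $ i)))"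
      by (simp only: lessThan_iff 1 sum_distrib_right) (simp only: mult_ac)
  qed
  also have "\<dots> = (\<Sum>j<m. \<Sum>i<n. v $ j * (A $$ (i,j) * cnj (w $ i)))"
    by (rule sum.swap)
  also have "\<dots> = (\<Sum>j<m. v $ j * conjugate ((A\<^sup>\<dagger> *\<^sub>v w) $ j))"
    by (rule sum.cong) (simp_all only: lessThan_iff 2 sum_distrib_left)
  also have "\<dots> = v \<bullet>c (A\<^sup>\<dagger> *\<^sub>v w)"
    using assms by (simp add: scalar_prod_def atLeast0LessThan)
  finally show ?thesis .
qed

definition qf :: "complex mat \<Rightarrow> complex vec \<Rightarrow> real" where
  "qf A v = Re ((A *\<^sub>v v) \<bullet>c v)"

text \<open>
  Bundling the size with self-adjointness lets the closure rules below carry the carrier conditions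
  along, so that products of square matrices can be reassociated without side proofs.
\<close>

definition herm :: "nat \<Rightarrow> complex mat \<Rightarrow> bool" where
  "herm n A \<longleftrightarrow> A \<in> carrier_mat n n \<and> A\<^sup>\<dagger> = A"

text \<open>
  For Hermitian \<open>A\<close> and \<open>B\<close> this says that \<open>B - A\<close> is positive semidefinite (lemma \<open>psd_minus_iff\<close>); in
  terms of quadratic forms, transitivity, congruence and passage to limits are statements about real numbers.
\<close>

definition loewner_le :: "nat \<Rightarrow> complex mat \<Rightarrow> complex mat \<Rightarrow> bool" where
  "loewner_le n A B \<longleftrightarrow> herm n A \<and> herm n B \<and> (\<forall>v \<in> carrier_vec n. qf A v \<le> qf B v)"

lemma herm_carrier: "herm n A \<Longrightarrow> A \<in> carrier_mat n n"
  by (simp add: herm_def)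

lemma hermD: "herm n A \<Longrightarrow> A\<^sup>\<dagger> = A"
  by (simp add: herm_def)

lemma qf_add: "A \<in> carrier_mat n n \<Longrightarrow> B \<in> carrier_mat n n \<Longrightarrow> v \<in> carrier_vec n \<Longrightarrow>
    qf (A + B) v = qf A v + qf B v"
  by (simp add: qf_def add_mult_distrib_mat_vec[of _ n n] add_scalar_prod_distrib[of _ n])

lemma qf_minus: "A \<in> carrier_mat n n \<Longrightarrow> B \<in> carrier_mat n n \<Longrightarrow> v \<in> carrier_vec n \<Longrightarrow>
    qf (A - B) v = qf A v - qf B v"
  by (simp add: qf_def minus_mult_distrib_mat_vec[of _ n n] minus_scalar_prod_distrib[of _ n])

lemma smult_mat_vec: "A \<in> carrier_mat n m \<Longrightarrow> v \<in> carrier_vec m \<Longrightarrow>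
   (c \<cdot>\<^sub>m A) *\<^sub>v v = (c :: complex) \<cdot>\<^sub>v (A *\<^sub>v v)"
  by (intro eq_vecI) (auto simp: scalar_prod_def sum_distrib_left ac_simps)

lemma qf_smult: "A \<in> carrier_mat n n \<Longrightarrow> v \<in> carrier_vec n \<Longrightarrow>
    qf (complex_of_real c \<cdot>\<^sub>m A) v = c * qf A v"
  by (simp add: qf_def smult_mat_vec[of _ n n])

lemma qf_one: "v \<in> carrier_vec n \<Longrightarrow> qf (1\<^sub>m n) v = Re (v \<bullet>c v)"
  by (simp add: qf_def)

lemma qf_zero [simp]: "v \<in> carrier_vec n \<Longrightarrow> qf (0\<^sub>m n n) v = 0"
  by (auto simp: qf_def scalar_prod_def)

lemma qf_zero_vec [simp]: "A \<in> carrier_mat n n \<Longrightarrow> qf A (0\<^sub>v n) = 0"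
  by (auto simp add: qf_def)

lemma Re_sprod_self: "v \<in> carrier_vec n \<Longrightarrow> Re (v \<bullet>c v) = (\<Sum>i<n. (cmod (v $ i))\<^sup>2)"
  by (auto simp: scalar_prod_def atLeast0LessThan complex_mult_cnj cmod_power2 intro!: sum.cong)

lemma Re_sprod_self_nonneg [simp]: "0 \<le> Re (v \<bullet>c (v :: complex vec))"
  by (subst Re_sprod_self[of v "dim_vec v"]) (auto intro: sum_nonneg)

lemma Re_sprod_self_pos: "v \<in> carrier_vec n \<Longrightarrow> v \<noteq> 0\<^sub>v n \<Longrightarrow> 0 < Re (v \<bullet>c (v :: complex vec))"
  using conjugate_square_greater_0_vec[of v n] by (auto simp: less_complex_def)

lemma qf_congruence:
  assumes "T \<in> carrier_mat n m" "A \<in> carrier_mat n n" "v \<in> carrier_vec m"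
  shows "qf (T\<^sup>\<dagger> * A * T) v = qf A (T *\<^sub>v v)"
proof -
  have "(T\<^sup>\<dagger> * A * T) *\<^sub>v v = T\<^sup>\<dagger> *\<^sub>v (A *\<^sub>v (T *\<^sub>v v))"
    using assms by (simp add: assoc_mult_mat_vec[of _ m n _ m] assoc_mult_mat_vec[of _ m n _ n]
          assoc_mult_mat[of _ m n _ n _ m])
  then show ?thesis
    using assms cscalar_prod_adj[of "T\<^sup>\<dagger>" m n "A *\<^sub>v (T *\<^sub>v v)" v] by (simp add: qf_def)
qed

lemma qf_gram:
  assumes "T \<in> carrier_mat n m" "v \<in> carrier_vec m"
  shows "qf (T\<^sup>\<dagger> * T) v = Re ((T *\<^sub>v v) \<bullet>c (T *\<^sub>v v))"
  using qf_congruence[of T n m "1\<^sub>m n" v] assms by (simp add: qf_one)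

lemma mult_vec_carrier:
  "A \<in> carrier_mat n m \<Longrightarrow> v \<in> carrier_vec m \<Longrightarrow> A *\<^sub>v v \<in> carrier_vec n"
  by auto

lemma herm_one [simp]: "herm n (1\<^sub>m n)" and herm_zero [simp]: "herm n (0\<^sub>m n n)"
  by (auto simp: herm_def)

lemma herm_add [simp]: "herm n A \<Longrightarrow> herm n B \<Longrightarrow> herm n (A + B)"
  by (auto simp: herm_def adj_add)

lemma herm_minus [simp]: "herm n A \<Longrightarrow> herm n B \<Longrightarrow> herm n (A - B)"
  by (auto simp: herm_def adj_minus)

lemma herm_smult [simp]: "herm n A \<Longrightarrow> herm n (complex_of_real c \<cdot>\<^sub>m A)"
  by (auto simp: herm_def adj_smult)

lemma herm_congruence: "T \<in> carrier_mat n m \<Longrightarrow> herm n A \<Longrightarrow> herm m (T\<^sup>\<dagger> * A * T)"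
  by (auto simp: herm_def adj_mult[of _ m n _ m] adj_mult[of _ m n _ n] adj_mult[of _ n n _ m] assoc_mult_mat[of _ m n _ n _ m])

lemma herm_gram: "T \<in> carrier_mat n m \<Longrightarrow> herm m (T\<^sup>\<dagger> * T)"
  by (auto simp: herm_def adj_mult[of _ m n _ m])

lemma psd_mat_iff: "psd_mat n A \<longleftrightarrow> herm n A \<and> (\<forall>v\<in>carrier_vec n. 0 \<le> qf A v)"
  by (auto simp: psd_mat_def herm_def hermitian_mat_def qf_def)

lemma pd_mat_iff: "pd_mat n A \<longleftrightarrow> herm n A \<and> (\<forall>v\<in>carrier_vec n. v \<noteq> 0\<^sub>v n \<longrightarrow> 0 < qf A v)"
  by (auto simp: pd_mat_def herm_def hermitian_mat_def qf_def)

lemma psd_herm: "psd_mat n A \<Longrightarrow> herm n A"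
  by (simp add: psd_mat_iff)

lemma pd_herm: "pd_mat n A \<Longrightarrow> herm n A"
  by (simp add: pd_mat_iff)

lemma pd_psd: "pd_mat n A \<Longrightarrow> psd_mat n A"
  unfolding pd_mat_iff psd_mat_iff by (metis herm_carrier less_eq_real_def order_refl qf_zero_vec)

lemma psd_minus_iff: "herm n A \<Longrightarrow> herm n B \<Longrightarrow> psd_mat n (B - A) \<longleftrightarrow> loewner_le n A B"
  by (auto simp: psd_mat_iff loewner_le_def qf_minus[of _ n] herm_carrier)

lemma loewner_le_refl: "herm n A \<Longrightarrow> loewner_le n A A"
  by (simp add: loewner_le_def)

lemma loewner_le_trans [trans]: "loewner_le n A B \<Longrightarrow> loewner_le n B C \<Longrightarrow> loewner_le n A C"
  by (meson loewner_le_def order_trans)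

lemma loewner_leD: "loewner_le n A B \<Longrightarrow> v \<in> carrier_vec n \<Longrightarrow> qf A v \<le> qf B v"
  by (simp add: loewner_le_def)

lemma loewner_le_herm: "loewner_le n A B \<Longrightarrow> herm n A" "loewner_le n A B \<Longrightarrow> herm n B"
  by (auto simp: loewner_le_def)

lemma loewner_le_congruence:
  assumes "loewner_le n A B" "T \<in> carrier_mat n m"
  shows "loewner_le m (T\<^sup>\<dagger> * A * T) (T\<^sup>\<dagger> * B * T)"
  unfolding loewner_le_def
proof (intro conjI ballI)
  have AB: "herm n A" "herm n B" "\<And>v. v \<in> carrier_vec n \<Longrightarrow> qf A v \<le> qf B v"
    using assms(1) by (auto simp only: loewner_le_def)
  show "herm m (T\<^sup>\<dagger> * A * T)" "herm m (T\<^sup>\<dagger> * B * T)"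
    using AB assms(2) by (auto intro: herm_congruence)
  show "qf (T\<^sup>\<dagger> * A * T) v \<le> qf (T\<^sup>\<dagger> * B * T) v" if "v \<in> carrier_vec m" for v
    using AB(3)[OF mult_vec_carrier[OF assms(2) that]]
    by (simp only: qf_congruence[OF assms(2) herm_carrier[OF AB(1)] that]
          qf_congruence[OF assms(2) herm_carrier[OF AB(2)] that])
qed

lemma psd_le: "psd_mat n A \<Longrightarrow> loewner_le n A B \<Longrightarrow> psd_mat n B"
  unfolding psd_mat_iff loewner_le_def by (meson order_trans)

lemma pd_le: "pd_mat n A \<Longrightarrow> loewner_le n A B \<Longrightarrow> pd_mat n B"
  unfolding pd_mat_iff loewner_le_def by (meson less_le_trans)

lemma psd_congruence: "psd_mat n A \<Longrightarrow> T \<in> carrier_mat n m \<Longrightarrow> psd_mat m (T\<^sup>\<dagger> * A * T)"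
  unfolding psd_mat_iff
  by (metis herm_carrier herm_congruence mult_vec_carrier qf_congruence)

lemma psd_gram: "T \<in> carrier_mat n m \<Longrightarrow> psd_mat m (T\<^sup>\<dagger> * T)"
  unfolding psd_mat_iff
proof (intro conjI ballI)
  assume T: "T \<in> carrier_mat n m"
  show "herm m (T\<^sup>\<dagger> * T)" using T by (rule herm_gram)
  show "0 \<le> qf (T\<^sup>\<dagger> * T) v" if "v \<in> carrier_vec m" for v
    using qf_gram[OF T that] Re_sprod_self_nonneg by (simp only:)
qed

lemma psd_add: "psd_mat n A \<Longrightarrow> psd_mat n B \<Longrightarrow> psd_mat n (A + B)"
  by (auto simp: psd_mat_iff qf_add[of _ n] herm_carrier)

lemma loewner_le_add: "loewner_le n A B \<Longrightarrow> loewner_le n C D \<Longrightarrow> loewner_le n (A + C) (B + D)"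
  by (auto simp: loewner_le_def qf_add[of _ n] herm_carrier add_mono)

lemma psd_smult: "psd_mat n A \<Longrightarrow> 0 \<le> c \<Longrightarrow> psd_mat n (complex_of_real c \<cdot>\<^sub>m A)"
  by (auto simp: psd_mat_iff qf_smult[of _ n] herm_carrier)

lemma loewner_le_smult: "loewner_le n A B \<Longrightarrow> 0 \<le> c \<Longrightarrow>
   loewner_le n (complex_of_real c \<cdot>\<^sub>m A) (complex_of_real c \<cdot>\<^sub>m B)"
  by (auto simp: loewner_le_def qf_smult[of _ n] herm_carrier mult_left_mono)

lemma pd_one: "pd_mat n (1\<^sub>m n)"
  by (auto simp: pd_mat_iff qf_one Re_sprod_self_pos)

text \<open>
  A weak form of the Cauchy--Schwarz inequality; in the applications the two squared norms have the same
  upper bound, so nothing is lost.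
\<close>

lemma Re_sprod_le_half:
  assumes "v \<in> carrier_vec n" "w \<in> carrier_vec n"
  shows "Re (v \<bullet>c w) \<le> (Re (v \<bullet>c v) + Re (w \<bullet>c w)) / 2"
proof -
  have aux: "a \<le> s / 2" if "a \<le> c" "2 * c \<le> s" for a c s :: real
    using that by linarith
  have "Re (v $ i * cnj (w $ i)) \<le> ((cmod (v $ i))\<^sup>2 + (cmod (w $ i))\<^sup>2) / 2" for i
    using complex_Re_le_cmod[of "v $ i * cnj (w $ i)"] sum_squares_bound[of "cmod (v $ i)" "cmod (w $ i)"]
    unfolding norm_mult complex_mod_cnj mult.assoc by (rule aux)
  then have "(\<Sum>i<n. Re (v $ i * cnj (w $ i))) \<le> (\<Sum>i<n. ((cmod (v $ i))\<^sup>2 + (cmod (w $ i))\<^sup>2) / 2)"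
    by (rule sum_mono)
  then show ?thesis
    by (simp only: sprod_eq_sum[OF assms] Re_sum Re_sprod_self[OF assms(1)] Re_sprod_self[OF assms(2)]
       sum.distrib sum_divide_distrib[symmetric])
qed

text \<open>
  Since \<open>\<parallel>T\<^sup>\<dagger> v\<parallel>\<^sup>2 = \<langle>T T\<^sup>\<dagger> v, v\<rangle> \<le> (\<parallel>T T\<^sup>\<dagger> v\<parallel>\<^sup>2 + \<parallel>v\<parallel>\<^sup>2) / 2\<close> and \<open>T\<close> does not increase the norm of \<open>T\<^sup>\<dagger> v\<close>,
  the term \<open>\<parallel>T\<^sup>\<dagger> v\<parallel>\<^sup>2\<close> can be absorbed on the left.
\<close>

lemma contraction_adj:
  assumes T: "T \<in> carrier_mat n m" and le: "loewner_le m (T\<^sup>\<dagger> * T) (1\<^sub>m m)"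
  shows "loewner_le n (T * T\<^sup>\<dagger>) (1\<^sub>m n)"
proof -
  have "qf (T * T\<^sup>\<dagger>) v \<le> qf (1\<^sub>m n) v" if v: "v \<in> carrier_vec n" for v
  proof -
    let ?w = "T\<^sup>\<dagger> *\<^sub>v v"
    have w: "?w \<in> carrier_vec m" using adj_carrier[OF T] v by (rule mult_vec_carrier)
    have 1: "qf (T * T\<^sup>\<dagger>) v = Re (?w \<bullet>c ?w)"
      using qf_gram[OF adj_carrier[OF T] v] by (simp only: adj_adj)
    have "Re (?w \<bullet>c ?w) = Re ((T *\<^sub>v ?w) \<bullet>c v)"
      using cscalar_prod_adj[OF T w v] by (simp only:)
    also have "\<dots> \<le> (Re ((T *\<^sub>v ?w) \<bullet>c (T *\<^sub>v ?w)) + Re (v \<bullet>c v)) / 2"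
      by (rule Re_sprod_le_half[OF mult_vec_carrier[OF T w] v])
    also have "Re ((T *\<^sub>v ?w) \<bullet>c (T *\<^sub>v ?w)) \<le> Re (?w \<bullet>c ?w)"
      using loewner_leD[OF le w] qf_gram[OF T w] w by (simp add: qf_one)
    finally show ?thesis using v by (simp add: 1 qf_one)
  qed
  then show ?thesis using herm_gram[of "T\<^sup>\<dagger>" m n] T by (auto simp: loewner_le_def)
qed

section \<open>Unitary diagonalization of Hermitian matrices\<close>

lemma unitary_iff: "U \<in> carrier_mat n n \<Longrightarrow> unitary_mat U \<longleftrightarrow> U * U\<^sup>\<dagger> = 1\<^sub>m n \<and> U\<^sup>\<dagger> * U = 1\<^sub>m n"
  by (auto simp: unitary_mat_def)

lemma unitaryI:
  assumes U: "U \<in> carrier_mat n n" and "U\<^sup>\<dagger> * U = 1\<^sub>m n"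
  shows "unitary_mat U"
  using mat_mult_left_right_inverse[OF adj_carrier[OF U] U] assms by (simp add: unitary_iff)

lemma unitary_mult:
  assumes U: "U \<in> carrier_mat n n" "unitary_mat U" and V: "V \<in> carrier_mat n n" "unitary_mat V"
  shows "unitary_mat (U * V)"
proof (rule unitaryI)
  show "U * V \<in> carrier_mat n n" using U V by auto
  have "(U * V)\<^sup>\<dagger> * (U * V) = V\<^sup>\<dagger> * (U\<^sup>\<dagger> * (U * V))"
    using U V by (simp add: adj_mult[of _ n n] assoc_mult_mat[of _ n n _ n _ n])
  also have "U\<^sup>\<dagger> * (U * V) = U\<^sup>\<dagger> * U * V"
    using U V by (intro assoc_mult_mat[of _ n n _ n _ n, symmetric]) auto
  also have "\<dots> = V" using U V by (simp add: unitary_iff)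
  also have "V\<^sup>\<dagger> * V = 1\<^sub>m n" using V by (simp add: unitary_iff)
  finally show "(U * V)\<^sup>\<dagger> * (U * V) = 1\<^sub>m n" .
qed

lemma mult_assoc_sq: "X \<in> carrier_mat n n \<Longrightarrow> Y \<in> carrier_mat n n \<Longrightarrow> Z \<in> carrier_mat n n \<Longrightarrow>
    X * Y * Z = X * (Y * Z :: complex mat)"
  by (rule assoc_mult_mat)

lemma mult_sq [simp]: "X \<in> carrier_mat n n \<Longrightarrow> Y \<in> carrier_mat n n \<Longrightarrow> X * (Y :: complex mat) \<in> carrier_mat n n"
  by (rule mult_carrier_mat)

text \<open>
  Products are kept associated to the right, so an inverse pair meets only in the form \<open>X * (Y * Z)\<close>.
\<close>

lemma mult_cancel_left:
  assumes "X * Y = 1\<^sub>m n" "X \<in> carrier_mat n m" "Y \<in> carrier_mat m n" "Z \<in> carrier_mat n k"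
  shows "X * (Y * Z) = (Z :: complex mat)"
  using assoc_mult_mat[OF assms(2-4)] assms by simp

lemma unitary_conj_cancel:
  assumes U: "U \<in> carrier_mat n n" "unitary_mat U" and A: "A \<in> carrier_mat n n"
  shows "U * (U\<^sup>\<dagger> * A * U) * U\<^sup>\<dagger> = A"
proof -
  have UU: "U * U\<^sup>\<dagger> = 1\<^sub>m n" using U by (simp add: unitary_iff)
  have c: "U\<^sup>\<dagger> \<in> carrier_mat n n" using U by simp
  have "U * (U\<^sup>\<dagger> * A * U) * U\<^sup>\<dagger> = U * (U\<^sup>\<dagger> * (A * (U * U\<^sup>\<dagger>)))"
    using U(1) A c by (simp add: mult_assoc_sq[of _ n] del: assoc_mult_mat)
  also have "\<dots> = A" using mult_cancel_left[OF UU U(1) c A] A by (simp add: UU)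
  finally show ?thesis .
qed

text \<open>
  Gram--Schmidt orthogonalization of a basis that starts with \<open>v\<close>, followed by normalization of the columns.
\<close>

lemma unitary_first_col:
  assumes v: "v \<in> carrier_vec n" "v \<noteq> 0\<^sub>v n"
  obtains U c where "U \<in> carrier_mat n n" "unitary_mat U" "col U 0 = c \<cdot>\<^sub>v v"
proof -
  interpret cof_vec_space n "TYPE(complex)" .
  define b where "b = basis_completion v"
  define ws where "ws = gram_schmidt n b"
  from basis_completion[OF v, folded b_def]
  have b: "distinct b" "\<not> lin_dep (set b)" "set b \<subseteq> carrier_vec n" "hd b = v" "length b = n" by auto
  have n: "n \<noteq> 0" using v by (metis eq_vecI carrier_vecD less_nat_zero_code zero_carrier_vec)
  with b obtain vs where bv: "b = v # vs" by (cases b) auto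
  from gram_schmidt_result[OF b(3,1,2) refl, folded ws_def]
  have ws: "set ws \<subseteq> carrier_vec n" "corthogonal ws" "length ws = n" by (auto simp: b)
  have hdws: "hd ws = v" using gram_schmidt_hd[OF v(1), of vs, folded bv] by (simp add: ws_def)
  have wsc: "ws ! i \<in> carrier_vec n" if "i < n" for i using ws that by auto
  define s where "s i = Re (ws ! i \<bullet>c ws ! i)" for i
  have orth: "ws ! i \<bullet>c ws ! j = 0 \<longleftrightarrow> i \<noteq> j" if "i < n" "j < n" for i j
    using ws that by (auto simp: corthogonal_def)
  have s: "ws ! i \<bullet>c ws ! i = complex_of_real (s i)" "0 < s i" if "i < n" for i
  proof -
    have "0 \<le> ws ! i \<bullet>c ws ! i" by (rule conjugate_square_ge_0_vec)
    then have "Im (ws ! i \<bullet>c ws ! i) = 0" and *: "0 \<le> s i" by (auto simp: less_eq_complex_def s_def)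
    then show 1: "ws ! i \<bullet>c ws ! i = complex_of_real (s i)" by (simp add: s_def complex_eq_iff)
    with orth[OF that that] * show "0 < s i" by auto
  qed
  define U where "U = mat n n (\<lambda>(i, j). ws ! j $ i / complex_of_real (sqrt (s j)))"
  have U: "U \<in> carrier_mat n n" by (simp add: U_def)
  have "U\<^sup>\<dagger> * U = 1\<^sub>m n"
  proof (rule eq_matI)
    fix i j assume "i < dim_row (1\<^sub>m n :: complex mat)" "j < dim_col (1\<^sub>m n :: complex mat)"
    then have ij: "i < n" "j < n" by auto
    have "(U\<^sup>\<dagger> * U) $$ (i, j) = (\<Sum>k<n. cnj (U $$ (k, i)) * U $$ (k, j))"
      using ij U by (simp add: scalar_prod_def atLeast0LessThan)
    also have "\<dots> = (\<Sum>k<n. (ws ! j $ k * cnj (ws ! i $ k)) / complex_of_real (sqrt (s i) * sqrt (s j)))"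
      using ij by (intro sum.cong) (auto simp: U_def)
    also have "\<dots> = (ws ! j \<bullet>c ws ! i) / complex_of_real (sqrt (s i) * sqrt (s j))"
      by (simp add: sprod_eq_sum[OF wsc[OF ij(2)] wsc[OF ij(1)]] flip: sum_divide_distrib)
    also have "\<dots> = 1\<^sub>m n $$ (i, j)"
    proof (cases "i = j")
      case True
      with s[OF ij(1)] ij show ?thesis by (simp flip: of_real_mult)
    next
      case False
      with orth[OF ij(2,1)] ij show ?thesis by auto
    qed
    finally show "(U\<^sup>\<dagger> * U) $$ (i, j) = 1\<^sub>m n $$ (i, j)" .
  qed (use U in auto)
  with U have "unitary_mat U" by (rule unitaryI)
  moreover have "col U 0 = (1 / complex_of_real (sqrt (s 0))) \<cdot>\<^sub>v v"
  proof -
    have "ws ! 0 = v" using hdws n ws(3) hd_conv_nth[of ws] by auto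
    then show ?thesis using n v(1) by (intro eq_vecI) (auto simp: U_def)
  qed
  ultimately show ?thesis using U that by blast
qed

definition conj_diag :: "nat \<Rightarrow> complex mat \<Rightarrow> (nat \<Rightarrow> real) \<Rightarrow> complex mat" where
  "conj_diag n U d = U * mat_diag n (\<lambda>i. complex_of_real (d i)) * U\<^sup>\<dagger>"

text \<open>
  Conjugating by a unitary matrix whose first column is an eigenvector clears the rest of the first column;
  since the conjugated matrix is again Hermitian, the first row is cleared as well, and the remaining block has
  smaller size.
\<close>

theorem hermitian_spectral:
  assumes "herm n A"
  shows "\<exists>U d. U \<in> carrier_mat n n \<and> unitary_mat U \<and> A = conj_diag n U d"
  using assms
proof (induction n arbitrary: A)
  case 0
  then have "A = conj_diag 0 (1\<^sub>m 0) (\<lambda>_. 0)"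
    by (intro eq_matI) (auto simp: herm_def conj_diag_def)
  then show ?case by (intro exI[of _ "1\<^sub>m 0"] exI[of _ "\<lambda>_. 0"]) (auto simp: unitary_iff[of _ 0])
next
  case (Suc m)
  let ?n = "Suc m"
  have A: "A \<in> carrier_mat ?n ?n" "A\<^sup>\<dagger> = A" using Suc.prems by (auto simp: herm_def)
  from spectrum_non_empty[OF A(1)] obtain e where "eigenvalue A e"
    by (auto simp: spectrum_def)
  then obtain v where v: "v \<in> carrier_vec ?n" "v \<noteq> 0\<^sub>v ?n" "A *\<^sub>v v = e \<cdot>\<^sub>v v"
    using A by (auto simp: eigenvalue_def eigenvector_def)
  obtain U c where U: "U \<in> carrier_mat ?n ?n" "unitary_mat U" "col U 0 = c \<cdot>\<^sub>v v"
    using unitary_first_col[OF v(1,2)] .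
  have UU: "U * U\<^sup>\<dagger> = 1\<^sub>m ?n" "U\<^sup>\<dagger> * U = 1\<^sub>m ?n" using U by (auto simp: unitary_iff)
  define A' where "A' = U\<^sup>\<dagger> * A * U"
  have hA': "herm ?n A'" unfolding A'_def using U(1) Suc.prems by (rule herm_congruence)
  have A': "A' \<in> carrier_mat ?n ?n" using hA' by (rule herm_carrier)
  have A'_sym: "A' $$ (j, i) = cnj (A' $$ (i, j))" if "i < ?n" "j < ?n" for i j
    using adj_index[of j A' i] that A' hermD[OF hA'] by simp
  have col0: "A' $$ (i, 0) = (if i = 0 then e else 0)" if i: "i < ?n" for i
  proof -
    have "A' = U\<^sup>\<dagger> * (A * U)"
      unfolding A'_def using A U by (intro assoc_mult_mat) auto
    then have "A' $$ (i, 0) = row U\<^sup>\<dagger> i \<bullet> col (A * U) 0"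
      using i A U by simp
    also have "col (A * U) 0 = A *\<^sub>v col U 0" using A U by (intro col_mult2) auto
    also have "\<dots> = e \<cdot>\<^sub>v col U 0"
      using v A(1) by (simp add: U(3) mult_mat_vec[of _ ?n ?n] smult_smult_assoc mult.commute)
    also have "row U\<^sup>\<dagger> i \<bullet> (e \<cdot>\<^sub>v col U 0) = e * (U\<^sup>\<dagger> * U) $$ (i, 0)"
      using i U v(1) by simp
    finally show ?thesis using i by (simp add: UU)
  qed
  have e: "e = complex_of_real (Re e)"
    using A'_sym[of 0 0] col0[of 0] by (auto simp: complex_eq_iff)
  have row0: "A' $$ (0, j) = (if j = 0 then e else 0)" if "j < ?n" for j
    using A'_sym[of j 0] col0[OF that] e that by (auto simp: complex_eq_iff)
  define A3 where "A3 = mat m m (\<lambda>(i, j). A' $$ (Suc i, Suc j))"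
  have "A3 \<in> carrier_mat m m" by (simp add: A3_def)
  moreover have "A3\<^sup>\<dagger> = A3"
    by (rule eq_matI) (auto simp: A3_def A'_sym[symmetric])
  ultimately have "herm m A3" by (simp add: herm_def)
  from Suc.IH[OF this] obtain V d where V: "V \<in> carrier_mat m m" "unitary_mat V" "A3 = conj_diag m V d"
    by blast
  have VV: "V * V\<^sup>\<dagger> = 1\<^sub>m m" "V\<^sup>\<dagger> * V = 1\<^sub>m m" using V by (auto simp: unitary_iff)
  define W where "W = four_block_mat (1\<^sub>m 1) (0\<^sub>m 1 m) (0\<^sub>m m 1) V"
  define d' where "d' i = (case i of 0 \<Rightarrow> Re e | Suc i \<Rightarrow> d i)" for i
  let ?D = "mat_diag m (\<lambda>i. complex_of_real (d i))"
  have W: "W \<in> carrier_mat ?n ?n" using V by (auto simp: W_def)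
  have Wadj: "W\<^sup>\<dagger> = four_block_mat (1\<^sub>m 1) (0\<^sub>m 1 m) (0\<^sub>m m 1) V\<^sup>\<dagger>"
    using adj_four_block[of "1\<^sub>m 1" 1 1 "0\<^sub>m 1 m" m "0\<^sub>m m 1" m V] V by (simp add: W_def)
  have "W\<^sup>\<dagger> * W = four_block_mat (1\<^sub>m 1) (0\<^sub>m 1 m) (0\<^sub>m m 1) (1\<^sub>m m)"
    unfolding Wadj unfolding W_def using V VV
    by (subst mult_four_block_mat[of _ 1 1 _ m _ m _ _ 1 _ m]) (auto simp: adj_carrier)
  then have "unitary_mat W" using W by (intro unitaryI[of W ?n]) auto
  have D': "mat_diag ?n (\<lambda>i. complex_of_real (d' i)) = four_block_mat (e \<cdot>\<^sub>m 1\<^sub>m 1) (0\<^sub>m 1 m) (0\<^sub>m m 1) ?D"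
  proof (rule eq_matI)
    fix i j assume "i < dim_row (four_block_mat (e \<cdot>\<^sub>m 1\<^sub>m 1) (0\<^sub>m 1 m) (0\<^sub>m m 1) ?D)"
      "j < dim_col (four_block_mat (e \<cdot>\<^sub>m 1\<^sub>m 1) (0\<^sub>m 1 m) (0\<^sub>m m 1) ?D)"
    then show "mat_diag ?n (\<lambda>i. complex_of_real (d' i)) $$ (i, j) =
      four_block_mat (e \<cdot>\<^sub>m 1\<^sub>m 1) (0\<^sub>m 1 m) (0\<^sub>m m 1) ?D $$ (i, j)"
      using e by (cases i; cases j) (auto simp: mat_diag_def d'_def)
  qed (auto simp: mat_diag_def)
  have c: "1\<^sub>m 1 \<in> carrier_mat 1 1" "e \<cdot>\<^sub>m 1\<^sub>m 1 \<in> carrier_mat 1 1" "0\<^sub>m 1 m \<in> carrier_mat 1 m"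
    "0\<^sub>m m 1 \<in> carrier_mat m 1" "V\<^sup>\<dagger> \<in> carrier_mat m m" "?D \<in> carrier_mat m m" "V * ?D \<in> carrier_mat m m"
    using V by auto
  have "W * mat_diag ?n (\<lambda>i. complex_of_real (d' i)) = four_block_mat (e \<cdot>\<^sub>m 1\<^sub>m 1) (0\<^sub>m 1 m) (0\<^sub>m m 1) (V * ?D)"
    unfolding D' unfolding W_def mult_four_block_mat[OF c(1,3,4) V(1) c(2,3,4,6)]
    using V c by (intro cong_four_block_mat) (auto simp: left_mult_zero_mat[OF c(6)])
  then have "conj_diag ?n W d' = four_block_mat (e \<cdot>\<^sub>m 1\<^sub>m 1) (0\<^sub>m 1 m) (0\<^sub>m m 1) (V * ?D) *
      four_block_mat (1\<^sub>m 1) (0\<^sub>m 1 m) (0\<^sub>m m 1) V\<^sup>\<dagger>"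
    by (simp add: conj_diag_def Wadj)
  also have "\<dots> = four_block_mat (e \<cdot>\<^sub>m 1\<^sub>m 1) (0\<^sub>m 1 m) (0\<^sub>m m 1) A3"
    unfolding mult_four_block_mat[OF c(2,3,4,7) c(1,3,4,5)] V(3) conj_diag_def
    using V(1) c by (intro cong_four_block_mat) auto
  also have "\<dots> = A'"
  proof (rule eq_matI)
    fix i j assume "i < dim_row A'" "j < dim_col A'"
    then have "i < ?n" "j < ?n" using A' by auto
    then show "four_block_mat (e \<cdot>\<^sub>m 1\<^sub>m 1) (0\<^sub>m 1 m) (0\<^sub>m m 1) A3 $$ (i, j) = A' $$ (i, j)"
      by (cases i; cases j) (simp_all add: A3_def col0 row0)
  qed (use A' in \<open>simp_all add: A3_def\<close>)
  finally have A'_eq: "conj_diag ?n W d' = A'" .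
  have A_eq: "A = U * A' * U\<^sup>\<dagger>"
    unfolding A'_def using unitary_conj_cancel[OF U(1,2) A(1)] by simp
  have "A = conj_diag ?n (U * W) d'"
    unfolding A_eq A'_eq[symmetric] conj_diag_def using U(1) W
    by (simp add: adj_mult[of _ ?n ?n _ ?n] mult_assoc_sq[of _ ?n] del: assoc_mult_mat)
  then show ?case
    using unitary_mult[OF U(1,2) W \<open>unitary_mat W\<close>] U W by (intro exI[of _ "U * W"] exI[of _ d']) auto
qed

section \<open>Functional calculus\<close>

lemma mat_diag_real_add: "mat_diag n (\<lambda>i. complex_of_real (f i)) + mat_diag n (\<lambda>i. complex_of_real (g i)) =
    mat_diag n (\<lambda>i. complex_of_real (f i + g i))"
  by (rule eq_matI) (auto simp: mat_diag_def)

lemma conj_diag_carrier [simp]: "U \<in> carrier_mat n n \<Longrightarrow> conj_diag n U d \<in> carrier_mat n n"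
  by (simp add: conj_diag_def)

lemma conj_diag_herm:
  assumes U: "U \<in> carrier_mat n n"
  shows "herm n (conj_diag n U d)"
proof -
  have "herm n (mat_diag n (\<lambda>i. complex_of_real (d i)))" by (simp add: herm_def)
  from herm_congruence[OF adj_carrier[OF U] this] show ?thesis by (simp add: conj_diag_def)
qed

lemma mat_fun_conj_diag:
  "U \<in> carrier_mat n n \<Longrightarrow> unitary_mat U \<Longrightarrow> mat_fun f (conj_diag n U d) = conj_diag n U (\<lambda>i. f (d i))"
  unfolding conj_diag_def by (rule mat_fun_unitary_diag)

lemma conj_diag_mult:
  assumes U: "U \<in> carrier_mat n n" "unitary_mat U"
  shows "conj_diag n U d * conj_diag n U e = conj_diag n U (\<lambda>i. d i * e i)"
proof -
  let ?D = "\<lambda>d :: nat \<Rightarrow> real. mat_diag n (\<lambda>i. complex_of_real (d i))"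
  have c: "U\<^sup>\<dagger> \<in> carrier_mat n n" "?D d \<in> carrier_mat n n" "?D e \<in> carrier_mat n n" using U by auto
  have UU: "U\<^sup>\<dagger> * U = 1\<^sub>m n" using U by (simp add: unitary_iff)
  have "conj_diag n U d * conj_diag n U e = U * (?D d * (U\<^sup>\<dagger> * (U * (?D e * U\<^sup>\<dagger>))))"
    unfolding conj_diag_def using U(1) c by (simp add: mult_assoc_sq[of _ n] del: assoc_mult_mat)
  also have "U\<^sup>\<dagger> * (U * (?D e * U\<^sup>\<dagger>)) = ?D e * U\<^sup>\<dagger>"
    by (rule mult_cancel_left[OF UU c(1) U(1) mult_sq[OF c(3,1)]])
  also have "U * (?D d * (?D e * U\<^sup>\<dagger>)) = U * (?D d * ?D e) * U\<^sup>\<dagger>"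
    using U(1) c by (simp add: mult_assoc_sq[of _ n] del: assoc_mult_mat mat_diag_diag)
  finally show ?thesis by (simp add: conj_diag_def)
qed

lemma conj_diag_add:
  assumes U: "U \<in> carrier_mat n n"
  shows "conj_diag n U d + conj_diag n U e = conj_diag n U (\<lambda>i. d i + e i)"
  unfolding conj_diag_def mat_diag_real_add[symmetric] using U
  by (simp add: mult_add_distrib_mat[of _ n n _ n] add_mult_distrib_mat[of _ n n _ _ n] del: assoc_mult_mat)

lemma conj_diag_const:
  assumes U: "U \<in> carrier_mat n n" "unitary_mat U"
  shows "conj_diag n U (\<lambda>_. c) = complex_of_real c \<cdot>\<^sub>m 1\<^sub>m n"
proof -
  have "mat_diag n (\<lambda>_. complex_of_real c) = complex_of_real c \<cdot>\<^sub>m 1\<^sub>m n"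
    by (rule eq_matI) (auto simp: mat_diag_def)
  then show ?thesis using U
    by (simp add: conj_diag_def unitary_iff mult_smult_distrib[of _ n n _ n] mult_smult_assoc_mat[of _ n n _ n])
qed

lemma conj_diag_smult:
  assumes U: "U \<in> carrier_mat n n" "unitary_mat U"
  shows "complex_of_real c \<cdot>\<^sub>m conj_diag n U d = conj_diag n U (\<lambda>i. c * d i)"
  using conj_diag_mult[OF U, of "\<lambda>_. c" d] conj_diag_const[OF U, of c] U
  by (simp add: mult_smult_assoc_mat[of _ n n _ n] left_mult_one_mat[of _ n n])

lemma conj_diag_cong: "(\<And>i. i < n \<Longrightarrow> d i = e i) \<Longrightarrow> conj_diag n U d = conj_diag n U e"
proof -
  assume *: "\<And>i. i < n \<Longrightarrow> d i = e i"
  have "mat_diag n (\<lambda>i. complex_of_real (d i)) = mat_diag n (\<lambda>i. complex_of_real (e i))"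
    by (rule eq_matI) (auto simp: mat_diag_def *)
  then show ?thesis by (simp only: conj_diag_def)
qed

text \<open>
  The quadratic form of a function of a Hermitian matrix is a combination of the function's values with
  nonnegative weights that do not depend on the function. Order and limits of scalar functions therefore transfer
  to the functional calculus.
\<close>

lemma qf_conj_diag:
  assumes U: "U \<in> carrier_mat n n" and v: "v \<in> carrier_vec n"
  shows "qf (conj_diag n U d) v = (\<Sum>i<n. d i * (cmod ((U\<^sup>\<dagger> *\<^sub>v v) $ i))\<^sup>2)"
proof -
  let ?D = "mat_diag n (\<lambda>i. complex_of_real (d i))"
  define w where "w = U\<^sup>\<dagger> *\<^sub>v v"
  have w: "w \<in> carrier_vec n" unfolding w_def using U v by (intro mult_vec_carrier[of _ n n]) auto
  have ind: "(?D *\<^sub>v w) $ i = complex_of_real (d i) * w $ i" if "i < n" for i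
  proof -
    have "(?D *\<^sub>v w) $ i = (\<Sum>j\<in>{0..<n}. ?D $$ (i, j) * w $ j)"
      using that w by (simp add: scalar_prod_def mat_diag_def)
    also have "\<dots> = (\<Sum>j\<in>{0..<n}. if j = i then complex_of_real (d i) * w $ i else 0)"
      using that by (intro sum.cong) (auto simp: mat_diag_def)
    finally show ?thesis using that by simp
  qed
  have "qf (conj_diag n U d) v = qf ?D w"
    using qf_congruence[OF adj_carrier[OF U] mat_diag_dim v] by (simp add: conj_diag_def w_def)
  also have "\<dots> = (\<Sum>i<n. Re ((?D *\<^sub>v w) $ i * cnj (w $ i)))"
    unfolding qf_def sprod_eq_sum[OF mult_vec_carrier[OF mat_diag_dim w] w] by (simp only: Re_sum)
  also have "\<dots> = (\<Sum>i<n. d i * (cmod (w $ i))\<^sup>2)"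
    by (intro sum.cong refl) (simp only: lessThan_iff ind mult.assoc complex_norm_square[symmetric]
         of_real_mult[symmetric] Re_complex_of_real)
  finally show ?thesis by (simp add: w_def)
qed

lemma qf_conj_diag_col:
  assumes U: "U \<in> carrier_mat n n" "unitary_mat U" and i: "i < n"
  shows "qf (conj_diag n U d) (col U i) = d i"
proof -
  have "U\<^sup>\<dagger> *\<^sub>v col U i = col (U\<^sup>\<dagger> * U) i" using U i by (intro col_mult2[symmetric]) auto
  also have "\<dots> = unit_vec n i" using U i by (simp add: unitary_iff)
  finally have *: "U\<^sup>\<dagger> *\<^sub>v col U i = unit_vec n i" .
  have "qf (conj_diag n U d) (col U i) = (\<Sum>j<n. d j * (cmod (unit_vec n i $ j))\<^sup>2)"
    using U i by (simp add: qf_conj_diag *)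
  also have "\<dots> = (\<Sum>j<n. if j = i then d i else 0)"
    by (rule sum.cong) (auto simp: unit_vec_def)
  finally show ?thesis using i by simp
qed

lemma unitary_col_nonzero:
  assumes U: "U \<in> carrier_mat n n" "unitary_mat U" and i: "i < n"
  shows "col U i \<noteq> 0\<^sub>v n"
proof
  assume "col U i = 0\<^sub>v n"
  then have "qf (conj_diag n U (\<lambda>_. 1)) (col U i) = 0" using U by simp
  then show False using qf_conj_diag_col[OF U i, of "\<lambda>_. 1"] by simp
qed

text \<open>
  One diagonalization serves all functions simultaneously.
\<close>

lemma hermE:
  assumes "herm n A"
  obtains U d where "U \<in> carrier_mat n n" "unitary_mat U" "A = conj_diag n U d"
    "\<And>f. mat_fun f A = conj_diag n U (\<lambda>i. f (d i))"
  using hermitian_spectral[OF assms] mat_fun_conj_diag by metis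

lemma psdE:
  assumes A: "psd_mat n A"
  obtains U d where "U \<in> carrier_mat n n" "unitary_mat U" "A = conj_diag n U d"
    "\<And>f. mat_fun f A = conj_diag n U (\<lambda>i. f (d i))" "\<And>i. i < n \<Longrightarrow> 0 \<le> d i"
proof -
  obtain U d where U: "U \<in> carrier_mat n n" "unitary_mat U" "A = conj_diag n U d"
    "\<And>f. mat_fun f A = conj_diag n U (\<lambda>i. f (d i))" by (rule hermE[OF psd_herm[OF A]], rule that)
  have pos: "0 \<le> d i" if "i < n" for i
    using A col_carrier_vec[OF that U(1)] qf_conj_diag_col[OF U(1,2) that, of d] unfolding psd_mat_iff U(3) by metis
  show ?thesis by (rule that[OF U pos])
qed

lemma pdE:
  assumes A: "pd_mat n A"
  obtains U d where "U \<in> carrier_mat n n" "unitary_mat U" "A = conj_diag n U d"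
    "\<And>f. mat_fun f A = conj_diag n U (\<lambda>i. f (d i))" "\<And>i. i < n \<Longrightarrow> 0 < d i"
proof -
  obtain U d where U: "U \<in> carrier_mat n n" "unitary_mat U" "A = conj_diag n U d"
    "\<And>f. mat_fun f A = conj_diag n U (\<lambda>i. f (d i))" by (rule hermE[OF pd_herm[OF A]], rule that)
  have pos: "0 < d i" if "i < n" for i
    using A col_carrier_vec[OF that U(1)] qf_conj_diag_col[OF U(1,2) that, of d]
      unitary_col_nonzero[OF U(1,2) that] unfolding pd_mat_iff U(3) by metis
  show ?thesis by (rule that[OF U pos])
qed

lemma conj_diag_le:
  assumes U: "U \<in> carrier_mat n n" and "\<And>i. i < n \<Longrightarrow> d i \<le> e i"
  shows "loewner_le n (conj_diag n U d) (conj_diag n U e)"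
  unfolding loewner_le_def using assms
  by (auto simp: conj_diag_herm qf_conj_diag intro!: sum_mono mult_right_mono)

lemma conj_diag_psd:
  assumes U: "U \<in> carrier_mat n n" and "\<And>i. i < n \<Longrightarrow> 0 \<le> d i"
  shows "psd_mat n (conj_diag n U d)"
  unfolding psd_mat_iff using assms
  by (auto simp: conj_diag_herm qf_conj_diag intro!: sum_nonneg)

text \<open>
  The smallest eigenvalue \<open>c > 0\<close> gives the lower bound \<open>c\<close> times the identity.
\<close>

lemma conj_diag_pd:
  assumes U: "U \<in> carrier_mat n n" "unitary_mat U" and d: "\<And>i. i < n \<Longrightarrow> 0 < d i"
  shows "pd_mat n (conj_diag n U d)"
proof (cases "n = 0")
  case True
  then show ?thesis using U by (auto simp: pd_mat_iff conj_diag_herm)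
next
  case False
  define c where "c = Min (d ` {..<n})"
  have c: "0 < c" unfolding c_def using False d by (subst Min_gr_iff) auto
  have "pd_mat n (complex_of_real c \<cdot>\<^sub>m 1\<^sub>m n)"
    using c by (auto simp: pd_mat_iff herm_smult qf_smult[of _ n] qf_one Re_sprod_self_pos)
  moreover have "loewner_le n (conj_diag n U (\<lambda>_. c)) (conj_diag n U d)"
    by (rule conj_diag_le[OF U(1)]) (auto simp: c_def)
  ultimately show ?thesis using conj_diag_const[OF U, of c] pd_le by metis
qed

lemma mat_fun_herm: "herm n A \<Longrightarrow> herm n (mat_fun f A)"
  by (erule hermE) (auto simp: conj_diag_herm)

lemma mat_fun_carrier: "herm n A \<Longrightarrow> mat_fun f A \<in> carrier_mat n n"
  by (rule herm_carrier[OF mat_fun_herm])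

lemma mat_fun_mult: "herm n A \<Longrightarrow> mat_fun f A * mat_fun g A = mat_fun (\<lambda>x. f x * g x) A"
  by (erule hermE) (simp add: conj_diag_mult)

lemma mat_fun_add: "herm n A \<Longrightarrow> mat_fun f A + mat_fun g A = mat_fun (\<lambda>x. f x + g x) A"
  by (erule hermE) (simp add: conj_diag_add)

lemma mat_fun_comp:
  assumes "herm n A" shows "mat_fun f (mat_fun g A) = mat_fun (\<lambda>x. f (g x)) A"
proof -
  obtain U d where U: "U \<in> carrier_mat n n" "unitary_mat U" "A = conj_diag n U d"
    "\<And>f. mat_fun f A = conj_diag n U (\<lambda>i. f (d i))" by (rule hermE[OF assms], rule that)
  show ?thesis unfolding U(4) by (rule mat_fun_conj_diag[OF U(1,2)])
qed

lemma mat_fun_id: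
  assumes "herm n A" shows "mat_fun (\<lambda>x. x) A = A"
proof -
  obtain U d where U: "A = conj_diag n U d"
    "\<And>f. mat_fun f A = conj_diag n U (\<lambda>i. f (d i))" by (rule hermE[OF assms], rule that)
  show ?thesis unfolding U(2) by (simp only: U(1))
qed

lemma mat_fun_const: "herm n A \<Longrightarrow> mat_fun (\<lambda>_. c) A = complex_of_real c \<cdot>\<^sub>m 1\<^sub>m n"
  by (erule hermE) (simp add: conj_diag_const)

lemma mat_fun_smult: "herm n A \<Longrightarrow> complex_of_real c \<cdot>\<^sub>m mat_fun f A = mat_fun (\<lambda>x. c * f x) A"
  by (erule hermE) (simp add: conj_diag_smult)

lemma mat_fun_of_smult:
  assumes "herm n A" shows "mat_fun f (complex_of_real c \<cdot>\<^sub>m A) = mat_fun (\<lambda>x. f (c * x)) A"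
  using mat_fun_comp[OF assms, of f "\<lambda>x. c * x"] mat_fun_smult[OF assms, of c "\<lambda>x. x"]
  by (simp add: mat_fun_id[OF assms])

lemma mat_fun_cong_psd:
  assumes "psd_mat n A" "\<And>x. 0 \<le> x \<Longrightarrow> f x = g x" shows "mat_fun f A = mat_fun g A"
proof -
  obtain U d where U: "\<And>f. mat_fun f A = conj_diag n U (\<lambda>i. f (d i))" "\<And>i. i < n \<Longrightarrow> 0 \<le> d i"
    by (rule psdE[OF assms(1)], rule that)
  show ?thesis unfolding U(1) by (rule conj_diag_cong) (simp add: assms U(2))
qed

lemma mat_fun_cong_pd:
  assumes "pd_mat n A" "\<And>x. 0 < x \<Longrightarrow> f x = g x" shows "mat_fun f A = mat_fun g A"
proof -
  obtain U d where U: "\<And>f. mat_fun f A = conj_diag n U (\<lambda>i. f (d i))" "\<And>i. i < n \<Longrightarrow> 0 < d i"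
    by (rule pdE[OF assms(1)], rule that)
  show ?thesis unfolding U(1) by (rule conj_diag_cong) (simp add: assms U(2))
qed

lemma mat_fun_psd:
  assumes "psd_mat n A" "\<And>x. 0 \<le> x \<Longrightarrow> 0 \<le> f x" shows "psd_mat n (mat_fun f A)"
proof -
  obtain U d where U: "U \<in> carrier_mat n n" "\<And>f. mat_fun f A = conj_diag n U (\<lambda>i. f (d i))"
    "\<And>i. i < n \<Longrightarrow> 0 \<le> d i" by (rule psdE[OF assms(1)], rule that)
  show ?thesis unfolding U(2) by (rule conj_diag_psd[OF U(1)]) (simp add: assms U(3))
qed

lemma mat_fun_pd:
  assumes "pd_mat n A" "\<And>x. 0 < x \<Longrightarrow> 0 < f x" shows "pd_mat n (mat_fun f A)"
proof -
  obtain U d where U: "U \<in> carrier_mat n n" "unitary_mat U" "\<And>f. mat_fun f A = conj_diag n U (\<lambda>i. f (d i))"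
    "\<And>i. i < n \<Longrightarrow> 0 < d i" by (rule pdE[OF assms(1)], rule that)
  show ?thesis unfolding U(3) by (rule conj_diag_pd[OF U(1,2)]) (simp add: assms U(4))
qed

lemma mat_fun_le:
  assumes "psd_mat n A" "\<And>x. 0 \<le> x \<Longrightarrow> f x \<le> g x" shows "loewner_le n (mat_fun f A) (mat_fun g A)"
proof -
  obtain U d where U: "U \<in> carrier_mat n n" "\<And>f. mat_fun f A = conj_diag n U (\<lambda>i. f (d i))"
    "\<And>i. i < n \<Longrightarrow> 0 \<le> d i" by (rule psdE[OF assms(1)], rule that)
  show ?thesis unfolding U(2) by (rule conj_diag_le[OF U(1)]) (simp add: assms U(3))
qed

lemma mat_fun_tendsto:
  assumes A: "psd_mat n A" and v: "v \<in> carrier_vec n"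
    and "\<And>x. 0 \<le> x \<Longrightarrow> ((\<lambda>e. F e x) \<longlongrightarrow> g x) L"
  shows "((\<lambda>e. qf (mat_fun (F e) A) v) \<longlongrightarrow> qf (mat_fun g A) v) L"
proof -
  obtain U d where U: "U \<in> carrier_mat n n" "\<And>f. mat_fun f A = conj_diag n U (\<lambda>i. f (d i))"
    "\<And>i. i < n \<Longrightarrow> 0 \<le> d i" by (rule psdE[OF assms(1)], rule that)
  show ?thesis unfolding U(2) qf_conj_diag[OF U(1) v]
    by (intro tendsto_sum tendsto_mult_right assms(3) U(3)) auto
qed

text \<open>
  In eigenbases of \<open>M\<close> and \<open>N\<close> the relation reads \<open>d\<^sub>i W\<^sub>i\<^sub>j = W\<^sub>i\<^sub>j e\<^sub>j\<close>. So \<open>d\<^sub>i = e\<^sub>j\<close> wherever \<open>W\<^sub>i\<^sub>j\<close> does not vanish,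
  and \<open>d\<^sub>i\<close>, \<open>e\<^sub>j\<close> may be replaced by \<open>f(d\<^sub>i)\<close>, \<open>f(e\<^sub>j)\<close>.
\<close>

lemma mat_fun_intertwine:
  assumes M: "herm n M" and N: "herm m N" and T: "T \<in> carrier_mat n m" and eq: "M * T = T * N"
  shows "mat_fun f M * T = T * mat_fun f N"
proof -
  obtain U d where U: "U \<in> carrier_mat n n" "unitary_mat U" "M = conj_diag n U d"
    "\<And>f. mat_fun f M = conj_diag n U (\<lambda>i. f (d i))" by (rule hermE[OF M], rule that)
  obtain V e where V: "V \<in> carrier_mat m m" "unitary_mat V" "N = conj_diag m V e"
    "\<And>f. mat_fun f N = conj_diag m V (\<lambda>i. f (e i))" by (rule hermE[OF N], rule that)
  let ?D = "\<lambda>n d. mat_diag n (\<lambda>i. complex_of_real (d i))"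
  have UU: "U\<^sup>\<dagger> * U = 1\<^sub>m n" "U * U\<^sup>\<dagger> = 1\<^sub>m n" using U by (auto simp: unitary_iff)
  have VV: "V\<^sup>\<dagger> * V = 1\<^sub>m m" "V * V\<^sup>\<dagger> = 1\<^sub>m m" using V by (auto simp: unitary_iff)
  have c: "U\<^sup>\<dagger> \<in> carrier_mat n n" "V\<^sup>\<dagger> \<in> carrier_mat m m" using U V by auto
  define W where "W = U\<^sup>\<dagger> * T * V"
  have W: "W \<in> carrier_mat n m" unfolding W_def using c T V by (intro mult_carrier_mat) auto
  note as = assoc_mult_mat[of _ n n _ n _ n] assoc_mult_mat[of _ n n _ n _ m] assoc_mult_mat[of _ n n _ m _ m]
     assoc_mult_mat[of _ n m _ m _ m] assoc_mult_mat[of _ m m _ m _ m]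
  have cl: "\<And>X Y. X \<in> carrier_mat n n \<Longrightarrow> Y \<in> carrier_mat n m \<Longrightarrow> X * Y \<in> carrier_mat n m"
     "\<And>X Y. X \<in> carrier_mat n m \<Longrightarrow> Y \<in> carrier_mat m m \<Longrightarrow> X * Y \<in> carrier_mat n m"
    by (auto intro: mult_carrier_mat)
  have l: "U\<^sup>\<dagger> * (conj_diag n U g * T) * V = ?D n g * W" for g
  proof -
    have "U\<^sup>\<dagger> * (conj_diag n U g * T) * V = U\<^sup>\<dagger> * (U * (?D n g * W))"
      unfolding conj_diag_def W_def using U(1) V(1) T c
      by (simp add: as cl del: assoc_mult_mat)
    also have "\<dots> = ?D n g * W" by (rule mult_cancel_left[OF UU(1) c(1) U(1) cl(1)[OF _ W]]) simp
    finally show ?thesis .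
  qed
  have r: "U\<^sup>\<dagger> * (T * conj_diag m V g) * V = W * ?D m g" for g
  proof -
    have "U\<^sup>\<dagger> * (T * conj_diag m V g) * V = W * (?D m g * (V\<^sup>\<dagger> * V))"
      unfolding conj_diag_def W_def using U(1) V(1) T c
      by (simp add: as cl del: assoc_mult_mat)
    also have "\<dots> = W * ?D m g" by (simp add: VV right_mult_one_mat[of _ m m])
    finally show ?thesis .
  qed
  have DW: "?D n d * W = W * ?D m e" using l[of d] r[of e] eq U(3) V(3) by simp
  have ent: "complex_of_real (d i) * W $$ (i,j) = W $$ (i,j) * complex_of_real (e j)" if "i < n" "j < m" for i j
    using arg_cong[OF DW, of "\<lambda>M. M $$ (i,j)"] that
    by (simp add: mat_diag_mult_left[OF W] mat_diag_mult_right[OF W])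
  have DfW: "?D n (\<lambda>i. f (d i)) * W = W * ?D m (\<lambda>i. f (e i))"
    unfolding mat_diag_mult_left[OF W] mat_diag_mult_right[OF W]
  proof (rule cong_mat[OF refl refl])
    fix i j assume "i < n" "j < m"
    from ent[OF this] show "(case (i, j) of (i, j) \<Rightarrow> complex_of_real (f (d i)) * W $$ (i, j)) =
       (case (i, j) of (i, j) \<Rightarrow> W $$ (i, j) * complex_of_real (f (e j)))"
      by (cases "W $$ (i,j) = 0") auto
  qed
  have undo: "U * (U\<^sup>\<dagger> * X * V) * V\<^sup>\<dagger> = X" if X: "X \<in> carrier_mat n m" for X
  proof -
    have "U * (U\<^sup>\<dagger> * X * V) * V\<^sup>\<dagger> = U * (U\<^sup>\<dagger> * (X * (V * V\<^sup>\<dagger>)))"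
      using U(1) V(1) X c by (simp add: as cl del: assoc_mult_mat)
    also have "\<dots> = X" using mult_cancel_left[OF UU(2) U(1) c(1) X] X by (simp add: VV right_mult_one_mat[of _ n m])
    finally show ?thesis .
  qed
  have "mat_fun f M * T = U * (?D n (\<lambda>i. f (d i)) * W) * V\<^sup>\<dagger>"
    using undo[OF cl(1)[OF conj_diag_carrier[OF U(1)] T], of "\<lambda>i. f (d i)"] l[of "\<lambda>i. f (d i)"]
    by (simp only: U(4))
  also have "\<dots> = T * mat_fun f N"
    unfolding DfW using undo[OF cl(2)[OF T conj_diag_carrier[OF V(1)]], of "\<lambda>i. f (e i)"] r[of "\<lambda>i. f (e i)"]
    by (simp only: V(4))
  finally show ?thesis .
qed

lemma mat_fun_unitary_conj:
  assumes X: "herm n X" and U: "U \<in> carrier_mat n n" "unitary_mat U"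
  shows "mat_fun f (U\<^sup>\<dagger> * X * U) = U\<^sup>\<dagger> * mat_fun f X * U"
proof -
  have UU: "U\<^sup>\<dagger> * U = 1\<^sub>m n" "U * U\<^sup>\<dagger> = 1\<^sub>m n" using U by (auto simp: unitary_iff)
  have c: "U\<^sup>\<dagger> \<in> carrier_mat n n" using U by auto
  have h: "herm n (U\<^sup>\<dagger> * X * U)" using herm_congruence[OF U(1) X] .
  have "X * U = U * (U\<^sup>\<dagger> * X * U)"
    using mult_cancel_left[OF UU(2) U(1) c mult_sq[OF herm_carrier[OF X] U(1)]] U c herm_carrier[OF X]
    by (simp add: mult_assoc_sq[of _ n] del: assoc_mult_mat)
  from mat_fun_intertwine[OF X h U(1) this, of f]
  have "U\<^sup>\<dagger> * (mat_fun f X * U) = U\<^sup>\<dagger> * (U * mat_fun f (U\<^sup>\<dagger> * X * U))" by simp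
  then show ?thesis
    using mult_cancel_left[OF UU(1) c U(1) mat_fun_carrier[OF h]] U c mat_fun_carrier[OF X]
    by (simp add: mult_assoc_sq[of _ n] del: assoc_mult_mat)
qed

section \<open>Powers and the Loewner--Heinz inequality\<close>

lemma mat_powr_herm: "herm n X \<Longrightarrow> herm n (mat_powr X p)"
  by (simp add: mat_powr_def mat_fun_herm)

lemma mat_powr_carrier: "herm n X \<Longrightarrow> mat_powr X p \<in> carrier_mat n n"
  by (rule herm_carrier[OF mat_powr_herm])

lemma mat_powr_psd: "psd_mat n X \<Longrightarrow> psd_mat n (mat_powr X p)"
  unfolding mat_powr_def by (rule mat_fun_psd) auto

lemma mat_powr_pd: "pd_mat n X \<Longrightarrow> pd_mat n (mat_powr X p)"
  unfolding mat_powr_def by (rule mat_fun_pd) auto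

lemma mat_powr_mult: "herm n X \<Longrightarrow> mat_powr X p * mat_powr X q = mat_powr X (p + q)"
  by (simp add: mat_powr_def mat_fun_mult powr_add)

lemma mat_powr_powr: "herm n X \<Longrightarrow> mat_powr (mat_powr X p) q = mat_powr X (p * q)"
  by (simp add: mat_powr_def mat_fun_comp powr_powr)

lemma mat_powr_one:
  assumes "psd_mat n X" shows "mat_powr X 1 = X"
proof -
  have "mat_powr X 1 = mat_fun (\<lambda>x. x) X" unfolding mat_powr_def by (rule mat_fun_cong_psd[OF assms]) simp
  then show ?thesis by (simp add: mat_fun_id[OF psd_herm[OF assms]])
qed

lemma mat_powr_zero:
  assumes "pd_mat n X" shows "mat_powr X 0 = 1\<^sub>m n"
proof -
  have "mat_powr X 0 = mat_fun (\<lambda>x. 1) X" unfolding mat_powr_def by (rule mat_fun_cong_pd[OF assms]) simp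
  then show ?thesis using mat_fun_const[OF pd_herm[OF assms], of 1] by (auto intro!: eq_matI)
qed

lemma mat_powr_pd_iff:
  assumes A: "psd_mat n A" and p: "0 < p"
  shows "pd_mat n (mat_powr A p) \<longleftrightarrow> pd_mat n A"
proof
  assume "pd_mat n (mat_powr A p)"
  then have "pd_mat n (mat_powr (mat_powr A p) (1 / p))" by (rule mat_powr_pd)
  then show "pd_mat n A" using p by (simp add: mat_powr_powr[OF psd_herm[OF A]] mat_powr_one[OF A])
qed (rule mat_powr_pd)

lemma mat_powr_scale:
  assumes X: "psd_mat n X" and c: "0 \<le> c"
  shows "mat_powr (complex_of_real c \<cdot>\<^sub>m X) p = complex_of_real (c powr p) \<cdot>\<^sub>m mat_powr X p"
proof -
  have "mat_powr (complex_of_real c \<cdot>\<^sub>m X) p = mat_fun (\<lambda>x. c powr p * x powr p) X"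
    unfolding mat_powr_def mat_fun_of_smult[OF psd_herm[OF X]] using c by (intro mat_fun_cong_psd[OF X]) (simp add: powr_mult)
  then show ?thesis by (simp only: mat_powr_def mat_fun_smult[OF psd_herm[OF X]])
qed

lemma mat_powr_inverse:
  assumes "pd_mat n X" shows "mat_powr X p * mat_powr X (- p) = 1\<^sub>m n" "mat_powr X (- p) * mat_powr X p = 1\<^sub>m n"
  using mat_powr_mult[OF pd_herm[OF assms]] mat_powr_zero[OF assms] by simp_all

lemma loewner_le_sandwich:
  assumes "loewner_le n A B" and T: "herm n T"
  shows "loewner_le n (T * A * T) (T * B * T)"
  using loewner_le_congruence[OF assms(1) herm_carrier[OF T]] by (simp add: hermD[OF T])

lemma psd_sandwich:
  assumes "psd_mat n A" and T: "herm n T"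
  shows "psd_mat n (T * A * T)"
  using psd_congruence[OF assms(1) herm_carrier[OF T]] by (simp add: hermD[OF T])

lemma mat_powr_sandwich_cancel:
  assumes X: "pd_mat n X" and A: "A \<in> carrier_mat n n"
  shows "mat_powr X p * (mat_powr X (- p) * A * mat_powr X (- p)) * mat_powr X p = A"
proof -
  have c: "mat_powr X q \<in> carrier_mat n n" for q using mat_powr_carrier[OF pd_herm[OF X]] .
  have "mat_powr X p * (mat_powr X (- p) * A * mat_powr X (- p)) * mat_powr X p =
      mat_powr X p * (mat_powr X (- p) * (A * (mat_powr X (- p) * mat_powr X p)))"
    using A c by (simp add: mult_assoc_sq[of _ n] del: assoc_mult_mat)
  also have "\<dots> = A"
    using mult_cancel_left[OF mat_powr_inverse(1)[OF X] c c A] A by (simp add: mat_powr_inverse[OF X])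
  finally show ?thesis .
qed

lemma conj_diag_col:
  assumes U: "U \<in> carrier_mat n n" "unitary_mat U" and i: "i < n"
  shows "conj_diag n U d *\<^sub>v col U i = complex_of_real (d i) \<cdot>\<^sub>v col U i"
proof -
  let ?D = "mat_diag n (\<lambda>i. complex_of_real (d i))"
  have "conj_diag n U d * U = U * ?D"
    using U by (simp add: conj_diag_def mult_assoc_sq[of _ n] unitary_iff right_mult_one_mat[of _ n n] del: assoc_mult_mat)
  then have "conj_diag n U d *\<^sub>v col U i = col (U * ?D) i"
    using col_mult2[OF conj_diag_carrier[OF U(1)] U(1) i, of d] by simp
  also have "\<dots> = complex_of_real (d i) \<cdot>\<^sub>v col U i"
    using U i by (intro eq_vecI) (auto simp: mat_diag_mult_right[OF U(1)])
  finally show ?thesis .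
qed

text \<open>
  An eigenvector \<open>v\<close> of \<open>R\<close> for the eigenvalue \<open>\<lambda>\<close> yields the eigenvector \<open>w = S v\<close> of \<open>N\<close>, whence
  \<open>\<lambda> \<parallel>w\<parallel>\<^sup>2 = \<langle>N w, w\<rangle> \<le> \<parallel>w\<parallel>\<^sup>2\<close>.
\<close>

lemma similar_le_one:
  assumes R: "herm n R" and S: "S \<in> carrier_mat n n" "S' \<in> carrier_mat n n" "S' * S = 1\<^sub>m n"
    and N: "N \<in> carrier_mat n n" "N * S = S * R"
    and le: "\<And>w. w \<in> carrier_vec n \<Longrightarrow> Re ((N *\<^sub>v w) \<bullet>c w) \<le> Re (w \<bullet>c w)"
  shows "loewner_le n R (1\<^sub>m n)"
proof -
  obtain U d where U: "U \<in> carrier_mat n n" "unitary_mat U" "R = conj_diag n U d"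
    using hermitian_spectral[OF R] by blast
  have "d i \<le> 1" if i: "i < n" for i
  proof -
    let ?v = "col U i" and ?w = "S *\<^sub>v col U i"
    have v: "?v \<in> carrier_vec n" "?v \<noteq> 0\<^sub>v n" using U i unitary_col_nonzero[OF U(1,2) i] by auto
    have w: "?w \<in> carrier_vec n" using S(1) v(1) by (rule mult_vec_carrier)
    have "S' *\<^sub>v ?w = (S' * S) *\<^sub>v ?v" using S v by (intro assoc_mult_mat_vec[symmetric]) auto
    then have "S' *\<^sub>v ?w = ?v" using v by (simp add: S(3))
    moreover have "S' *\<^sub>v 0\<^sub>v n = 0\<^sub>v n" using S(2) by (intro eq_vecI) auto
    ultimately have w0: "?w \<noteq> 0\<^sub>v n" using v(2) by metis
    have "N *\<^sub>v ?w = (N * S) *\<^sub>v ?v" using S N v by (intro assoc_mult_mat_vec[symmetric]) auto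
    also have "\<dots> = S *\<^sub>v (R *\<^sub>v ?v)" unfolding N(2)
      by (rule assoc_mult_mat_vec[OF S(1) herm_carrier[OF R] v(1)])
    also have "\<dots> = complex_of_real (d i) \<cdot>\<^sub>v ?w"
      unfolding U(3) conj_diag_col[OF U(1,2) i] by (rule mult_mat_vec[OF S(1) v(1)])
    finally have "d i * Re (?w \<bullet>c ?w) \<le> 1 * Re (?w \<bullet>c ?w)"
      using le[OF w] w by simp
    then show ?thesis using Re_sprod_self_pos[OF w w0] by (simp only: mult_le_cancel_right_pos)
  qed
  then have "loewner_le n R (conj_diag n U (\<lambda>_. 1))"
    unfolding U(3) by (intro conj_diag_le[OF U(1)])
  also have "conj_diag n U (\<lambda>_. 1) = 1\<^sub>m n"
    using conj_diag_const[OF U(1,2), of 1] by (auto intro!: eq_matI)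
  finally show ?thesis .
qed

text \<open>
  Pedersen's argument. Put \<open>u = (s + t)/2\<close>. The hypotheses say that \<open>Y\<^sup>s\<^sup>/\<^sup>2 X\<^sup>-\<^sup>s\<^sup>/\<^sup>2\<close> and \<open>Y\<^sup>t\<^sup>/\<^sup>2 X\<^sup>-\<^sup>t\<^sup>/\<^sup>2\<close> are
  contractions, hence so is \<open>X\<^sup>-\<^sup>s\<^sup>/\<^sup>2 Y\<^sup>u X\<^sup>-\<^sup>t\<^sup>/\<^sup>2\<close>, which is similar to the Hermitian matrix \<open>X\<^sup>-\<^sup>u\<^sup>/\<^sup>2 Y\<^sup>u X\<^sup>-\<^sup>u\<^sup>/\<^sup>2\<close>.
\<close>

lemma loewner_heinz_midpoint:
  assumes X: "pd_mat n X" and Y: "psd_mat n Y"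
    and s: "loewner_le n (mat_powr Y s) (mat_powr X s)" and t: "loewner_le n (mat_powr Y t) (mat_powr X t)"
  shows "loewner_le n (mat_powr Y ((s + t) / 2)) (mat_powr X ((s + t) / 2))"
proof -
  define u where "u = (s + t) / 2"
  let ?X = "mat_powr X" and ?Y = "mat_powr Y"
  have hX: "herm n X" and hY: "herm n Y" using X Y by (auto simp: pd_herm psd_herm)
  have c: "?X p \<in> carrier_mat n n" "?Y p \<in> carrier_mat n n" for p using hX hY by (auto simp: mat_powr_carrier)
  note hX' = mat_powr_herm[OF hX] and hY' = mat_powr_herm[OF hY]
  have contr: "Re ((K *\<^sub>v w) \<bullet>c (K *\<^sub>v w)) \<le> Re (w \<bullet>c w)"
    if K: "K = ?Y (r/2) * ?X (- (r/2))" and r: "loewner_le n (?Y r) (?X r)" and w: "w \<in> carrier_vec n" for K r w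
  proof -
    have Kc: "K \<in> carrier_mat n n" using c by (simp add: K)
    have "K\<^sup>\<dagger> * K = ?X (- (r/2)) * ?Y r * ?X (- (r/2))"
    proof -
      have "K\<^sup>\<dagger> = ?X (- (r/2)) * ?Y (r/2)"
        by (simp add: K adj_mult[OF c(2) c(1)] hermD[OF hX'] hermD[OF hY'])
      then have "K\<^sup>\<dagger> * K = ?X (- (r/2)) * (?Y (r/2) * ?Y (r/2)) * ?X (- (r/2))"
        using c by (simp add: K mult_assoc_sq[of _ n] del: assoc_mult_mat)
      then show ?thesis by (simp add: mat_powr_mult[OF hY])
    qed
    moreover have "?X (- (r/2)) * ?X r * ?X (- (r/2)) = 1\<^sub>m n"
      by (simp add: mat_powr_mult[OF hX] mat_powr_zero[OF X])
    ultimately have "loewner_le n (K\<^sup>\<dagger> * K) (1\<^sub>m n)"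
      using loewner_le_sandwich[OF r hX', of "- (r/2)"] by simp
    then show ?thesis using loewner_leD[of n "K\<^sup>\<dagger> * K" "1\<^sub>m n" w] w by (simp add: qf_gram[OF Kc w] qf_one[OF w])
  qed
  define K1 K2 where "K1 = ?Y (t/2) * ?X (- (t/2))" and "K2 = ?Y (s/2) * ?X (- (s/2))"
  have K: "K1 \<in> carrier_mat n n" "K2 \<in> carrier_mat n n" using c by (simp_all add: K1_def K2_def)
  define R where "R = ?X (- (u/2)) * ?Y u * ?X (- (u/2))"
  have Rpsd: "psd_mat n R" unfolding R_def by (rule psd_sandwich[OF mat_powr_psd[OF Y] hX'])
  have "loewner_le n R (1\<^sub>m n)"
  proof (rule similar_le_one[of n R "?X ((t - s) / 4)" "?X (- ((t - s) / 4))" "K2\<^sup>\<dagger> * K1"])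
    show "herm n R" using Rpsd by (rule psd_herm)
    have K2a: "K2\<^sup>\<dagger> = ?X (- (s/2)) * ?Y (s/2)"
      by (simp add: K2_def adj_mult[OF c(2) c(1)] hermD[OF hX'] hermD[OF hY'])
    \<comment> \<open>\<open>X\<^sup>(\<^sup>t\<^sup>-\<^sup>s\<^sup>)\<^sup>/\<^sup>4\<close> redistributes the outer powers \<open>-s/2\<close> and \<open>-t/2\<close> evenly.\<close>
    have "K2\<^sup>\<dagger> * K1 * ?X ((t - s) / 4) = ?X (- (s/2)) * (?Y (s/2) * ?Y (t/2)) * (?X (- (t/2)) * ?X ((t - s) / 4))"
      unfolding K2a K1_def using c by (simp add: mult_assoc_sq[of _ n] del: assoc_mult_mat)
    also have "\<dots> = ?X (- (s/2)) * ?Y u * ?X (- (u/2))"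
    proof -
      have "s/2 + t/2 = u" "- (t/2) + (t - s) / 4 = - (u/2)" by (simp_all add: u_def field_simps)
      then show ?thesis by (simp only: mat_powr_mult[OF hX] mat_powr_mult[OF hY])
    qed
    also have "?X (- (s/2)) = ?X ((t - s) / 4) * ?X (- (u/2))"
    proof -
      have "(t - s) / 4 + - (u/2) = - (s/2)" by (simp add: u_def field_simps)
      then show ?thesis by (simp only: mat_powr_mult[OF hX])
    qed
    also have "?X ((t - s) / 4) * ?X (- (u/2)) * ?Y u * ?X (- (u/2)) = ?X ((t - s) / 4) * R"
      unfolding R_def using c by (simp add: mult_assoc_sq[of _ n] del: assoc_mult_mat)
    finally show "K2\<^sup>\<dagger> * K1 * ?X ((t - s) / 4) = ?X ((t - s) / 4) * R" .
    show "Re ((K2\<^sup>\<dagger> * K1 *\<^sub>v w) \<bullet>c w) \<le> Re (w \<bullet>c w)" if w: "w \<in> carrier_vec n" for w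
    proof -
      have Kw: "K1 *\<^sub>v w \<in> carrier_vec n" "K2 *\<^sub>v w \<in> carrier_vec n"
        using K w by (auto intro: mult_vec_carrier)
      have "(K2\<^sup>\<dagger> * K1 *\<^sub>v w) \<bullet>c w = (K2\<^sup>\<dagger> *\<^sub>v (K1 *\<^sub>v w)) \<bullet>c w"
        by (simp add: assoc_mult_mat_vec[OF adj_carrier[OF K(2)] K(1) w])
      also have "\<dots> = (K1 *\<^sub>v w) \<bullet>c (K2 *\<^sub>v w)"
        using cscalar_prod_adj[OF adj_carrier[OF K(2)] Kw(1) w] by (simp only: adj_adj)
      finally have *: "(K2\<^sup>\<dagger> * K1 *\<^sub>v w) \<bullet>c w = (K1 *\<^sub>v w) \<bullet>c (K2 *\<^sub>v w)" .
      have aux: "a \<le> d" if "a \<le> (b + c) / 2" "b \<le> d" "c \<le> d" for a b c d :: real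
        using that by argo
      show ?thesis unfolding *
        by (rule aux[OF Re_sprod_le_half[OF Kw] contr[OF K1_def t w] contr[OF K2_def s w]])
    qed
  qed (use c K in \<open>simp_all add: mat_powr_inverse[OF X]\<close>)
  from loewner_le_sandwich[OF this hX', of "u/2"]
  have "loewner_le n (?Y u) (?X (u/2) * 1\<^sub>m n * ?X (u/2))"
    using mat_powr_sandwich_cancel[OF X c(2), of "u/2" u] by (simp add: R_def)
  also have "?X (u/2) * 1\<^sub>m n * ?X (u/2) = ?X u"
    using c(1)[of "u/2"] mat_powr_mult[OF hX, of "u/2" "u/2"] by (simp add: right_mult_one_mat[of _ n n])
  finally show ?thesis by (simp add: u_def)
qed

text \<open>
  A point outside the closed set would lie in a gap whose end points belong to the set, but then so does the
  midpoint of the gap.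
\<close>

lemma closed_midpoint_unit_interval:
  fixes S :: "real set"
  assumes "closed S" "0 \<in> S" "1 \<in> S" and mid: "\<And>s t. s \<in> S \<Longrightarrow> t \<in> S \<Longrightarrow> (s + t) / 2 \<in> S"
    and r: "0 \<le> r" "r \<le> 1"
  shows "r \<in> S"
proof (rule ccontr)
  assume rS: "r \<notin> S"
  define a b where "a = Sup (S \<inter> {..r})" and "b = Inf (S \<inter> {r..})"
  have "a \<in> S \<inter> {..r}" unfolding a_def using assms
    by (intro closed_contains_Sup) (auto intro: bdd_aboveI[of _ r])
  moreover have "b \<in> S \<inter> {r..}" unfolding b_def using assms
    by (intro closed_contains_Inf) (auto intro: bdd_belowI[of _ r])
  ultimately have ab: "a \<in> S" "b \<in> S" "a < r" "r < b" using rS by (auto simp: less_le)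
  have m: "(a + b) / 2 \<in> S" using mid ab by blast
  show False
  proof (cases "(a + b) / 2 \<le> r")
    case True
    then have "(a + b) / 2 \<le> a" unfolding a_def[symmetric] using m
      by (subst a_def, intro cSup_upper) (auto intro: bdd_aboveI[of _ r])
    then show False using ab by simp
  next
    case False
    then have "b \<le> (a + b) / 2" using m
      by (subst b_def, intro cInf_lower) (auto intro: bdd_belowI[of _ r])
    then show False using ab by simp
  qed
qed

lemma continuous_on_qf_mat_powr:
  assumes X: "psd_mat n X" and v: "v \<in> carrier_vec n"
  shows "continuous_on UNIV (\<lambda>r. qf (mat_powr X r) v)"
  unfolding continuous_on_def mat_powr_def
proof
  fix r :: real
  have "((\<lambda>e. x powr e) \<longlongrightarrow> x powr r) (at r)" for x :: real
    by (cases "x = 0") (auto intro!: tendsto_intros)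
  then show "((\<lambda>r. qf (mat_fun (\<lambda>x. x powr r) X) v) \<longlongrightarrow> qf (mat_fun (\<lambda>x. x powr r) X) v) (at r within UNIV)"
    by (intro mat_fun_tendsto[OF X v]) auto
qed

text \<open>
  The exponents for which the inequality holds form a closed set that contains 0 and 1 and is stable under midpoints.
\<close>

lemma loewner_heinz_pd:
  assumes X: "pd_mat n X" and Y: "psd_mat n Y" and le: "loewner_le n Y X" and r: "0 \<le> r" "r \<le> 1"
  shows "loewner_le n (mat_powr Y r) (mat_powr X r)"
proof -
  have hX: "herm n X" and hY: "herm n Y" using X Y by (auto simp: pd_herm psd_herm)
  let ?S = "{r. loewner_le n (mat_powr Y r) (mat_powr X r)}"
  have "r \<in> ?S"
  proof (rule closed_midpoint_unit_interval[OF _ _ _ _ r])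
    have "?S = (\<Inter>v\<in>carrier_vec n. {r. qf (mat_powr Y r) v \<le> qf (mat_powr X r) v})"
      by (auto simp: loewner_le_def mat_powr_herm[OF hX] mat_powr_herm[OF hY])
    then show "closed ?S"
      by (auto intro!: closed_INT closed_Collect_le continuous_on_qf_mat_powr pd_psd[OF X] Y)
    show "1 \<in> ?S" using le by (simp add: mat_powr_one[OF Y] mat_powr_one[OF pd_psd[OF X]])
    have "loewner_le n (mat_powr Y 0) (mat_fun (\<lambda>_. 1) Y)"
      unfolding mat_powr_def by (rule mat_fun_le[OF Y]) auto
    moreover have "mat_fun (\<lambda>_. 1) Y = 1\<^sub>m n" using mat_fun_const[OF hY, of 1] by (auto intro!: eq_matI)
    ultimately show "0 \<in> ?S" by (simp add: mat_powr_zero[OF X])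
    show "(s + t) / 2 \<in> ?S" if "s \<in> ?S" "t \<in> ?S" for s t
      using loewner_heinz_midpoint[OF X Y] that by simp
  qed
  then show ?thesis by simp
qed

lemma add_smult_one_eq_mat_fun:
  assumes "herm n X" shows "X + complex_of_real e \<cdot>\<^sub>m 1\<^sub>m n = mat_fun (\<lambda>x. x + e) X"
  using mat_fun_add[OF assms, of "\<lambda>x. x" "\<lambda>_. e"] by (simp add: mat_fun_id[OF assms] mat_fun_const[OF assms])

lemma psd_smult_one: "0 \<le> e \<Longrightarrow> psd_mat n (complex_of_real e \<cdot>\<^sub>m 1\<^sub>m n)"
  by (intro psd_smult pd_psd pd_one)

lemma pd_smult_one: "0 < e \<Longrightarrow> pd_mat n (complex_of_real e \<cdot>\<^sub>m 1\<^sub>m n)"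
  using pd_one[of n] by (auto simp: pd_mat_iff qf_smult[of _ n])

lemma loewner_le_add_psd: "herm n A \<Longrightarrow> psd_mat n B \<Longrightarrow> loewner_le n A (A + B)"
  by (auto simp: loewner_le_def psd_mat_iff qf_add[of _ n] herm_carrier)

lemma pd_add_right:
  assumes "psd_mat n A" "pd_mat n B" shows "pd_mat n (A + B)"
proof -
  have "loewner_le n B (B + A)" using assms by (intro loewner_le_add_psd pd_herm)
  moreover have "B + A = A + B" using assms psd_herm pd_herm herm_carrier comm_add_mat by metis
  ultimately show ?thesis using pd_le[OF assms(2)] by simp
qed

lemma loewner_le_limit_right:
  assumes "herm n Y" "herm n X" "\<And>v. v \<in> carrier_vec n \<Longrightarrow> ((\<lambda>e. qf (F e) v) \<longlongrightarrow> qf X v) L"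
    and "L \<noteq> bot" "\<forall>\<^sub>F e in L. loewner_le n Y (F e)"
  shows "loewner_le n Y X"
  unfolding loewner_le_def
proof (intro conjI ballI assms(1,2))
  fix v :: "complex vec" assume v: "v \<in> carrier_vec n"
  have "\<forall>\<^sub>F e in L. qf Y v \<le> qf (F e) v"
    using assms(5) by eventually_elim (rule loewner_leD[OF _ v])
  then show "qf Y v \<le> qf X v" using tendsto_lowerbound[OF assms(3)[OF v]] assms(4) by blast
qed

text \<open>
  The definite case applies to \<open>X + e\<close>, and \<open>(X + e)\<^sup>r \<rightarrow> X\<^sup>r\<close> because these
  matrices are functions of the one matrix \<open>X\<close>.
\<close>

theorem loewner_heinz:
  assumes Y: "psd_mat n Y" and le: "loewner_le n Y X" and r: "0 < r" "r \<le> 1"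
  shows "loewner_le n (mat_powr Y r) (mat_powr X r)"
proof -
  have X: "psd_mat n X" using Y le by (rule psd_le)
  have hX: "herm n X" and hY: "herm n Y" using X Y by (auto simp: psd_herm)
  show ?thesis
  proof (rule loewner_le_limit_right)
    show "herm n (mat_powr Y r)" "herm n (mat_powr X r)" using hX hY by (auto simp: mat_powr_herm)
    show "((\<lambda>e. qf (mat_fun (\<lambda>x. (x + e) powr r) X) v) \<longlongrightarrow> qf (mat_powr X r) v) (at_right 0)"
      if "v \<in> carrier_vec n" for v
      unfolding mat_powr_def
    proof (rule mat_fun_tendsto[OF X that])
      fix x :: real assume "0 \<le> x"
      have "((\<lambda>e. (x + e) powr r) \<longlongrightarrow> (x + 0) powr r) (at_right 0)"
        using r \<open>0 \<le> x\<close> by (intro tendsto_powr' tendsto_intros)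
           (auto intro!: eventually_at_right_less[THEN eventually_mono])
      then show "((\<lambda>e. (x + e) powr r) \<longlongrightarrow> x powr r) (at_right 0)" by simp
    qed
    show "\<forall>\<^sub>F e in at_right 0. loewner_le n (mat_powr Y r) (mat_fun (\<lambda>x. (x + e) powr r) X)"
      using eventually_at_right_less[of "0::real"]
    proof eventually_elim
      case (elim e)
      let ?Xe = "X + complex_of_real e \<cdot>\<^sub>m 1\<^sub>m n"
      have "loewner_le n Y ?Xe"
        using le loewner_le_add_psd[OF hX psd_smult_one] elim loewner_le_trans less_imp_le by meson
      moreover have "pd_mat n ?Xe" using X elim by (intro pd_add_right pd_smult_one)
      ultimately have "loewner_le n (mat_powr Y r) (mat_powr ?Xe r)"
        using loewner_heinz_pd Y r by (simp add: less_imp_le)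
      then show ?case by (simp add: add_smult_one_eq_mat_fun[OF hX] mat_powr_def mat_fun_comp[OF hX])
    qed
  qed simp
qed

lemma operator_monotone_iff:
  "operator_monotone f \<longleftrightarrow> (\<forall>n X Y. psd_mat n Y \<longrightarrow> loewner_le n Y X \<longrightarrow> loewner_le n (mat_fun f Y) (mat_fun f X))"
proof -
  have 1: "psd_mat n X \<and> psd_mat n Y \<and> psd_mat n (X - Y) \<longleftrightarrow> psd_mat n Y \<and> loewner_le n Y X" for n X Y
    using psd_minus_iff psd_herm psd_le loewner_le_herm by meson
  have 2: "psd_mat n (mat_fun f X - mat_fun f Y) \<longleftrightarrow> loewner_le n (mat_fun f Y) (mat_fun f X)"
    if "herm n X" "herm n Y" for n X Y
    using that by (intro psd_minus_iff mat_fun_herm)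
  show ?thesis unfolding operator_monotone_def 1 using 2 loewner_le_herm by metis
qed

lemma operator_monotone_powr: "0 < r \<Longrightarrow> r \<le> 1 \<Longrightarrow> operator_monotone (\<lambda>x. x powr r)"
  unfolding operator_monotone_iff using loewner_heinz by (simp add: mat_powr_def)

section \<open>Hansen's inequality\<close>

definition direct_sum :: "complex mat \<Rightarrow> complex mat \<Rightarrow> complex mat" where
  "direct_sum A B = four_block_mat A (0\<^sub>m (dim_row A) (dim_col B)) (0\<^sub>m (dim_row B) (dim_col A)) B"

lemma direct_sum_carrier [simp]:
  "A \<in> carrier_mat n n \<Longrightarrow> B \<in> carrier_mat m m \<Longrightarrow> direct_sum A B \<in> carrier_mat (n + m) (n + m)"
  by (simp add: direct_sum_def)

lemma direct_sum_mult:
  assumes "A \<in> carrier_mat n n" "B \<in> carrier_mat m m" "C \<in> carrier_mat n n" "D \<in> carrier_mat m m"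
  shows "direct_sum A B * direct_sum C D = direct_sum (A * C) (B * D)"
proof -
  have z: "0\<^sub>m n m \<in> carrier_mat n m" "0\<^sub>m m n \<in> carrier_mat m n" by auto
  have d: "direct_sum A B = four_block_mat A (0\<^sub>m n m) (0\<^sub>m m n) B" "direct_sum C D = four_block_mat C (0\<^sub>m n m) (0\<^sub>m m n) D"
    "direct_sum (A * C) (B * D) = four_block_mat (A * C) (0\<^sub>m n m) (0\<^sub>m m n) (B * D)"
    using assms by (auto simp: direct_sum_def)
  have p: "A * C \<in> carrier_mat n n" "B * D \<in> carrier_mat m m" using assms by auto
  show ?thesis
    unfolding d mult_four_block_mat[OF assms(1) z assms(2) assms(3) z assms(4)]
    using assms p by (intro cong_four_block_mat)
      (simp_all add: right_mult_zero_mat[of _ n n] right_mult_zero_mat[of _ m m] left_mult_zero_mat[of _ n n] left_mult_zero_mat[of _ m m]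
        right_mult_zero_mat[of _ n m] right_mult_zero_mat[of _ m n] left_mult_zero_mat[of _ n m] left_mult_zero_mat[of _ m n])
qed

lemma direct_sum_adj:
  "A \<in> carrier_mat n n \<Longrightarrow> B \<in> carrier_mat m m \<Longrightarrow> (direct_sum A B)\<^sup>\<dagger> = direct_sum A\<^sup>\<dagger> B\<^sup>\<dagger>"
  by (simp add: direct_sum_def adj_four_block[of _ n n _ m _ m])

lemma direct_sum_one: "direct_sum (1\<^sub>m n) (1\<^sub>m m) = 1\<^sub>m (n + m)"
  by (simp add: direct_sum_def)

lemma direct_sum_mat_diag:
  "direct_sum (mat_diag n d) (mat_diag m e) = mat_diag (n + m) (\<lambda>i. if i < n then d i else e (i - n))"
  by (rule eq_matI) (auto simp: direct_sum_def mat_diag_def)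

lemma conj_diag_direct_sum:
  assumes U: "U \<in> carrier_mat n n" and V: "V \<in> carrier_mat m m"
  shows "direct_sum (conj_diag n U d) (conj_diag m V e) =
    conj_diag (n + m) (direct_sum U V) (\<lambda>i. if i < n then d i else e (i - n))"
proof -
  have "mat_diag (n + m) (\<lambda>i. complex_of_real (if i < n then d i else e (i - n))) =
     direct_sum (mat_diag n (\<lambda>i. complex_of_real (d i))) (mat_diag m (\<lambda>i. complex_of_real (e i)))"
    unfolding direct_sum_mat_diag by (rule arg_cong[of _ _ "mat_diag (n + m)"]) auto
  then show ?thesis
    using U V by (simp add: conj_diag_def direct_sum_mult[of _ n _ m] direct_sum_adj[of _ n _ m])
qed

lemma direct_sum_unitary:
  assumes U: "U \<in> carrier_mat n n" "unitary_mat U" and V: "V \<in> carrier_mat m m" "unitary_mat V"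
  shows "unitary_mat (direct_sum U V)"
  by (rule unitaryI[OF direct_sum_carrier[OF U(1) V(1)]])
     (use U V in \<open>simp add: direct_sum_adj[of _ n _ m] direct_sum_mult[of _ n _ m] unitary_iff direct_sum_one\<close>)

lemma mat_fun_direct_sum:
  assumes A: "herm n A" and B: "herm m B"
  shows "mat_fun f (direct_sum A B) = direct_sum (mat_fun f A) (mat_fun f B)"
proof -
  obtain U d where U: "U \<in> carrier_mat n n" "unitary_mat U" "A = conj_diag n U d"
    "\<And>f. mat_fun f A = conj_diag n U (\<lambda>i. f (d i))" by (rule hermE[OF A], rule that)
  obtain V e where V: "V \<in> carrier_mat m m" "unitary_mat V" "B = conj_diag m V e"
    "\<And>f. mat_fun f B = conj_diag m V (\<lambda>i. f (e i))" by (rule hermE[OF B], rule that)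
  have "(\<lambda>i. f (if i < n then d i else e (i - n))) = (\<lambda>i. if i < n then f (d i) else f (e (i - n)))" by auto
  then show ?thesis
    unfolding U(4) V(4) unfolding U(3) V(3) conj_diag_direct_sum[OF U(1) V(1)]
    using mat_fun_conj_diag[OF direct_sum_carrier[OF U(1) V(1)] direct_sum_unitary[OF U(1,2) V(1,2)]]
    by (simp only: conj_diag_direct_sum[OF U(1) V(1)])
qed

text \<open>
  Evaluating at vectors supported in the first block extracts the upper left corner, so the Loewner order of
  block matrices is inherited by that corner.
\<close>

lemma qf_corner:
  assumes c: "A \<in> carrier_mat n n" "B \<in> carrier_mat n m" "C \<in> carrier_mat m n" "D \<in> carrier_mat m m"
    and v: "v \<in> carrier_vec n"
  shows "qf (four_block_mat A B C D) (v @\<^sub>v 0\<^sub>v m) = qf A v"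
proof -
  have cv: "conjugate (v @\<^sub>v 0\<^sub>v m) = conjugate v @\<^sub>v (0\<^sub>v m :: complex vec)"
    using v by (intro eq_vecI) auto
  have z: "B *\<^sub>v 0\<^sub>v m = 0\<^sub>v n" "D *\<^sub>v 0\<^sub>v m = 0\<^sub>v m" using c by (auto intro!: eq_vecI)
  have Av: "A *\<^sub>v v \<in> carrier_vec n" "C *\<^sub>v v \<in> carrier_vec m"
    using c(1,3) v by (auto intro: mult_vec_carrier)
  have "four_block_mat A B C D *\<^sub>v (v @\<^sub>v 0\<^sub>v m) = (A *\<^sub>v v) @\<^sub>v (C *\<^sub>v v)"
    using four_block_mat_mult_vec[OF c v zero_carrier_vec[of m]] Av by (simp add: z)
  then have "(four_block_mat A B C D *\<^sub>v (v @\<^sub>v 0\<^sub>v m)) \<bullet>c (v @\<^sub>v 0\<^sub>v m) = (A *\<^sub>v v) \<bullet>c v + (C *\<^sub>v v) \<bullet> 0\<^sub>v m"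
    unfolding cv using scalar_prod_append[OF Av(1) Av(2) carrier_vec_conjugate[OF v] zero_carrier_vec] by simp
  then show ?thesis using Av by (simp add: qf_def)
qed

lemma one_minus_sqrt:
  assumes C: "C \<in> carrier_mat n n" and le: "loewner_le n (C\<^sup>\<dagger> * C) (1\<^sub>m n)"
  defines "E \<equiv> mat_powr (1\<^sub>m n - C\<^sup>\<dagger> * C) (1/2)"
  shows "herm n E" "E * E = 1\<^sub>m n - C\<^sup>\<dagger> * C"
proof -
  have "psd_mat n (1\<^sub>m n - C\<^sup>\<dagger> * C)" using le psd_minus_iff[OF loewner_le_herm[OF le]] by simp
  then show "herm n E" "E * E = 1\<^sub>m n - C\<^sup>\<dagger> * C"
    by (simp_all add: E_def mat_powr_herm[OF psd_herm] mat_powr_mult[OF psd_herm] mat_powr_one)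
qed

text \<open>
  With \<open>E = (1 - C\<^sup>\<dagger>C)\<^sup>1\<^sup>/\<^sup>2\<close> and \<open>D = (1 - CC\<^sup>\<dagger>)\<^sup>1\<^sup>/\<^sup>2\<close> the block matrix \<open>U\<close> with rows \<open>(C, D)\<close> and \<open>(E, -C\<^sup>\<dagger>)\<close> is unitary,
  and the upper left corner of \<open>U\<^sup>\<dagger> (X \<oplus> 0) U\<close> is \<open>C\<^sup>\<dagger> X C\<close>. The off-diagonal blocks are absorbed at an arbitrarily
  small cost: \<open>U\<^sup>\<dagger> (X \<oplus> 0) U \<le> (1 + e\<^sup>2) C\<^sup>\<dagger> X C \<oplus> (1 + 1/e\<^sup>2) D X D\<close>. Applying \<open>g\<close> to this inequality, which
  commutes with unitary conjugation and with direct sums, and comparing upper left corners gives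
  \<open>C\<^sup>\<dagger> g(X) C + E g(0) E \<le> g((1 + e\<^sup>2) C\<^sup>\<dagger> X C)\<close>. Finally \<open>e\<close> tends to 0.
\<close>

theorem hansen:
  assumes mono: "operator_monotone g" and cont: "continuous_on {0..} g" and pos: "\<And>x. 0 \<le> x \<Longrightarrow> 0 \<le> g x"
    and X: "psd_mat n X" and C: "C \<in> carrier_mat n n" and contr: "loewner_le n (C\<^sup>\<dagger> * C) (1\<^sub>m n)"
  shows "loewner_le n (C\<^sup>\<dagger> * mat_fun g X * C) (mat_fun g (C\<^sup>\<dagger> * X * C))"
proof -
  have hX: "herm n X" using X by (rule psd_herm)
  have Xc: "X \<in> carrier_mat n n" using hX by (rule herm_carrier)
  have Ca: "C\<^sup>\<dagger> \<in> carrier_mat n n" using C by simp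
  have contr': "loewner_le n ((C\<^sup>\<dagger>)\<^sup>\<dagger> * C\<^sup>\<dagger>) (1\<^sub>m n)" using contraction_adj[OF C contr] by simp
  define E where "E = mat_powr (1\<^sub>m n - C\<^sup>\<dagger> * C) (1/2)"
  define D where "D = mat_powr (1\<^sub>m n - (C\<^sup>\<dagger>)\<^sup>\<dagger> * C\<^sup>\<dagger>) (1/2)"
  have E: "herm n E" "E * E = 1\<^sub>m n - C\<^sup>\<dagger> * C" using one_minus_sqrt[OF C contr] by (simp_all add: E_def)
  have D: "herm n D" "D * D = 1\<^sub>m n - C * C\<^sup>\<dagger>" using one_minus_sqrt[OF Ca contr'] by (simp_all add: D_def)
  have Ec: "E \<in> carrier_mat n n" and Dc: "D \<in> carrier_mat n n" using E D by (auto simp: herm_carrier)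
  \<comment> \<open>This relation and its adjoint make the off-diagonal blocks of \<open>U\<^sup>\<dagger> U\<close> vanish.\<close>
  have DC: "D * C = C * E"
  proof -
    have "(1\<^sub>m n - (C\<^sup>\<dagger>)\<^sup>\<dagger> * C\<^sup>\<dagger>) * C = C * (1\<^sub>m n - C\<^sup>\<dagger> * C)"
      using C Ca by (simp add: minus_mult_distrib_mat[of _ n n _ _ n] mult_minus_distrib_mat[of _ n n _ n] mult_assoc_sq[of _ n] del: assoc_mult_mat)
    moreover have "herm n (1\<^sub>m n - (C\<^sup>\<dagger>)\<^sup>\<dagger> * C\<^sup>\<dagger>)" "herm n (1\<^sub>m n - C\<^sup>\<dagger> * C)"
      using contr contr' by (auto dest: loewner_le_herm)
    ultimately show ?thesis unfolding D_def E_def mat_powr_def using C by (intro mat_fun_intertwine)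
  qed
  have CD: "C\<^sup>\<dagger> * D = E * C\<^sup>\<dagger>"
    using arg_cong[OF DC, of mat_adjoint] adj_mult[OF Dc C] adj_mult[OF C Ec] hermD[OF D(1)] hermD[OF E(1)] by simp
  define U where "U = four_block_mat C D E (- C\<^sup>\<dagger>)"
  have Cm: "- C\<^sup>\<dagger> \<in> carrier_mat n n" "- C \<in> carrier_mat n n" using C by auto
  have U: "U \<in> carrier_mat (n + n) (n + n)" unfolding U_def using C Cm by simp
  have Ua: "U\<^sup>\<dagger> = four_block_mat C\<^sup>\<dagger> E D (- C)"
  proof -
    have "(- C\<^sup>\<dagger>)\<^sup>\<dagger> = - C" by (rule eq_matI) auto
    then show ?thesis unfolding U_def using adj_four_block[OF C Dc Ec Cm(1)] hermD[OF D(1)] hermD[OF E(1)] by simp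
  qed
  have unit: "unitary_mat U"
  proof (rule unitaryI[OF U])
    have *: "C\<^sup>\<dagger> * C + (1\<^sub>m n - C\<^sup>\<dagger> * C) = 1\<^sub>m n" "(1\<^sub>m n - C * C\<^sup>\<dagger>) + C * C\<^sup>\<dagger> = 1\<^sub>m n"
      "C\<^sup>\<dagger> * D - E * C\<^sup>\<dagger> = 0\<^sub>m n n" "D * C - C * E = 0\<^sub>m n n"
      using C Ca Dc Ec by (auto simp: CD DC intro!: eq_matI simp del: index_mult_mat(1))
    have "U\<^sup>\<dagger> * U = four_block_mat (1\<^sub>m n) (0\<^sub>m n n) (0\<^sub>m n n) (1\<^sub>m n)"
      unfolding Ua unfolding U_def mult_four_block_mat[OF Ca Ec Dc Cm(2) C Dc Ec Cm(1)]
    proof (rule cong_four_block_mat)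
      show "C\<^sup>\<dagger> * C + E * E = 1\<^sub>m n" by (simp add: E(2) *(1))
      have "C\<^sup>\<dagger> * D + E * - C\<^sup>\<dagger> = C\<^sup>\<dagger> * D - E * C\<^sup>\<dagger>"
      proof -
        have "E * - C\<^sup>\<dagger> = - (E * C\<^sup>\<dagger>)" using Ec C by simp
        then show ?thesis using add_uminus_minus_mat[OF mult_sq[OF Ca Dc] mult_sq[OF Ec Ca]] by (simp only:)
      qed
      then show "C\<^sup>\<dagger> * D + E * - C\<^sup>\<dagger> = 0\<^sub>m n n" by (simp add: *(3))
      have "D * C + - C * E = D * C - C * E" using C Ec Dc by (simp add: add_uminus_minus_mat[of _ n n])
      then show "D * C + - C * E = 0\<^sub>m n n" by (simp add: *(4))
      have "- C * - C\<^sup>\<dagger> = C * C\<^sup>\<dagger>" using C by simp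
      then show "D * D + - C * - C\<^sup>\<dagger> = 1\<^sub>m n" by (simp add: D(2) *(2))
    qed
    then show "U\<^sup>\<dagger> * U = 1\<^sub>m (n + n)" by simp
  qed
  have z: "0\<^sub>m n n \<in> carrier_mat n n" by simp
  have conj: "U\<^sup>\<dagger> * direct_sum P Q * U = four_block_mat (C\<^sup>\<dagger> * P * C + E * Q * E) (C\<^sup>\<dagger> * P * D + E * Q * - C\<^sup>\<dagger>)
      (D * P * C + - C * Q * E) (D * P * D + - C * Q * - C\<^sup>\<dagger>)"
    if P: "P \<in> carrier_mat n n" and Q: "Q \<in> carrier_mat n n" for P Q
  proof -
    have d: "direct_sum P Q = four_block_mat P (0\<^sub>m n n) (0\<^sub>m n n) Q" using P Q by (simp add: direct_sum_def)
    have 1: "U\<^sup>\<dagger> * direct_sum P Q = four_block_mat (C\<^sup>\<dagger> * P) (E * Q) (D * P) (- C * Q)"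
      unfolding Ua d mult_four_block_mat[OF Ca Ec Dc Cm(2) P z z Q]
      using Ca C Ec Dc P Q by (intro cong_four_block_mat) simp_all
    have c: "C\<^sup>\<dagger> * P \<in> carrier_mat n n" "E * Q \<in> carrier_mat n n" "D * P \<in> carrier_mat n n" "- C * Q \<in> carrier_mat n n"
      using Ca Cm Ec Dc P Q by (simp_all del: uminus_mult_left_mat)
    show ?thesis unfolding 1 unfolding U_def by (rule mult_four_block_mat[OF c C Dc Ec Cm(1)])
  qed
  define Z where "Z e = direct_sum (complex_of_real (1 + e\<^sup>2) \<cdot>\<^sub>m (C\<^sup>\<dagger> * X * C)) (complex_of_real (1 + (1/e)\<^sup>2) \<cdot>\<^sub>m (D * X * D))" for e :: real
  define W where "W = U\<^sup>\<dagger> * direct_sum X (0\<^sub>m n n) * U"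
  define H where "H = mat_powr X (1/2)"
  have hH: "herm n H" unfolding H_def by (rule mat_powr_herm[OF hX])
  have HH: "H * H = X" by (simp add: H_def mat_powr_mult[OF hX] mat_powr_one[OF X])
  have Hc: "H \<in> carrier_mat n n" by (rule herm_carrier[OF hH])
  have W: "W = four_block_mat (C\<^sup>\<dagger> * X * C) (C\<^sup>\<dagger> * X * D) (D * X * C) (D * X * D)"
    unfolding W_def conj[OF Xc z] using C Ca Cm Ec Dc Xc
    by (intro cong_four_block_mat) (auto intro!: eq_matI simp: right_mult_zero_mat[of _ n n] simp del: index_mult_mat(1))
  have Xsum: "psd_mat (n + n) (direct_sum X (0\<^sub>m n n))"
  proof -
    have "direct_sum X (0\<^sub>m n n) = (direct_sum H (0\<^sub>m n n))\<^sup>\<dagger> * direct_sum H (0\<^sub>m n n)"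
      using Hc by (simp add: direct_sum_adj[of _ n _ n] direct_sum_mult[of _ n _ n] hermD[OF hH] HH)
    then show ?thesis using psd_gram[OF direct_sum_carrier[OF Hc z]] by simp
  qed
  have Wpsd: "psd_mat (n + n) W" unfolding W_def by (rule psd_congruence[OF Xsum U])
  have CXC: "psd_mat n (C\<^sup>\<dagger> * X * C)" by (rule psd_congruence[OF X C])
  have hDXD: "herm n (D * X * D)" using psd_sandwich[OF X D(1)] by (rule psd_herm)
  have WZ: "loewner_le (n + n) W (Z e)" if e: "0 < e" for e
  proof -
    \<comment> \<open>The difference of the two sides is the Gram matrix of the single block row \<open>(e X\<^sup>1\<^sup>/\<^sup>2 C, -(1/e) X\<^sup>1\<^sup>/\<^sup>2 D)\<close>.\<close>
    define M where "M = four_block_mat (complex_of_real e \<cdot>\<^sub>m (H * C)) (complex_of_real (- (1/e)) \<cdot>\<^sub>m (H * D)) (0\<^sub>m n n) (0\<^sub>m n n)"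
    let ?HC = "H * C" and ?HD = "H * D"
    have c: "complex_of_real r \<cdot>\<^sub>m ?HC \<in> carrier_mat n n" "complex_of_real r \<cdot>\<^sub>m ?HD \<in> carrier_mat n n"
      "?HC\<^sup>\<dagger> \<in> carrier_mat n n" "?HD\<^sup>\<dagger> \<in> carrier_mat n n" "?HC \<in> carrier_mat n n" "?HD \<in> carrier_mat n n"
      "complex_of_real r \<cdot>\<^sub>m ?HC\<^sup>\<dagger> \<in> carrier_mat n n" "complex_of_real r \<cdot>\<^sub>m ?HD\<^sup>\<dagger> \<in> carrier_mat n n" for r
      using Hc C Dc mult_sq[OF Hc C] mult_sq[OF Hc Dc] by (auto simp del: assoc_mult_mat)
    have M: "M \<in> carrier_mat (n + n) (n + n)" unfolding M_def using c by simp
    have Ma: "M\<^sup>\<dagger> = four_block_mat (complex_of_real e \<cdot>\<^sub>m ?HC\<^sup>\<dagger>) (0\<^sub>m n n) (complex_of_real (- (1/e)) \<cdot>\<^sub>m ?HD\<^sup>\<dagger>) (0\<^sub>m n n)"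
      unfolding M_def adj_four_block[OF c(1) c(2) z z] by (simp add: adj_smult)
    have p: "?HC\<^sup>\<dagger> * ?HC = C\<^sup>\<dagger> * X * C" "?HC\<^sup>\<dagger> * ?HD = C\<^sup>\<dagger> * X * D" "?HD\<^sup>\<dagger> * ?HC = D * X * C" "?HD\<^sup>\<dagger> * ?HD = D * X * D"
      unfolding HH[symmetric] using Hc C Dc Ca
      by (simp_all add: adj_mult[of _ n n _ n] hermD[OF hH] hermD[OF D(1)] mult_assoc_sq[of _ n] del: assoc_mult_mat)
    have ss: "complex_of_real r \<cdot>\<^sub>m P * (complex_of_real s \<cdot>\<^sub>m Q) = complex_of_real (r * s) \<cdot>\<^sub>m (P * Q)"
      if "P \<in> carrier_mat n n" "Q \<in> carrier_mat n n" for r s P Q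
      using that by (auto intro!: eq_matI simp: mult_smult_distrib[of _ n n _ n] mult_smult_assoc_mat[of _ n n _ n] simp del: index_mult_mat(1))
    have c': "C\<^sup>\<dagger> * X * C \<in> carrier_mat n n" "C\<^sup>\<dagger> * X * D \<in> carrier_mat n n" "D * X * C \<in> carrier_mat n n" "D * X * D \<in> carrier_mat n n"
      using C Ca Dc Xc by (simp_all del: assoc_mult_mat)
    have MM: "M\<^sup>\<dagger> * M = four_block_mat (complex_of_real (e * e) \<cdot>\<^sub>m (C\<^sup>\<dagger> * X * C)) (complex_of_real (-1) \<cdot>\<^sub>m (C\<^sup>\<dagger> * X * D))
        (complex_of_real (-1) \<cdot>\<^sub>m (D * X * C)) (complex_of_real ((1/e) * (1/e)) \<cdot>\<^sub>m (D * X * D))"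
      unfolding Ma unfolding M_def mult_four_block_mat[OF c(7) z c(8) z c(1) c(2) z z]
    proof (rule cong_four_block_mat)
      have e1: "e * - (1/e) = -1" "- (1/e) * e = -1" "- (1/e) * - (1/e) = (1/e) * (1/e)" using e by auto
      have zz: "0\<^sub>m n n * 0\<^sub>m n n = (0\<^sub>m n n :: complex mat)" by simp
      have az: "complex_of_real r \<cdot>\<^sub>m P + 0\<^sub>m n n = complex_of_real r \<cdot>\<^sub>m P" if "P \<in> carrier_mat n n" for r P
        using that by simp
      note s = zz ss[OF c(3) c(5)] ss[OF c(3) c(6)] ss[OF c(4) c(5)] ss[OF c(4) c(6)] p e1 az[OF c'(1)] az[OF c'(2)] az[OF c'(3)] az[OF c'(4)]
      show "complex_of_real e \<cdot>\<^sub>m ?HC\<^sup>\<dagger> * (complex_of_real e \<cdot>\<^sub>m ?HC) + 0\<^sub>m n n * 0\<^sub>m n n = complex_of_real (e * e) \<cdot>\<^sub>m (C\<^sup>\<dagger> * X * C)"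
        "complex_of_real e \<cdot>\<^sub>m ?HC\<^sup>\<dagger> * (complex_of_real (- (1/e)) \<cdot>\<^sub>m ?HD) + 0\<^sub>m n n * 0\<^sub>m n n = complex_of_real (-1) \<cdot>\<^sub>m (C\<^sup>\<dagger> * X * D)"
        "complex_of_real (- (1/e)) \<cdot>\<^sub>m ?HD\<^sup>\<dagger> * (complex_of_real e \<cdot>\<^sub>m ?HC) + 0\<^sub>m n n * 0\<^sub>m n n = complex_of_real (-1) \<cdot>\<^sub>m (D * X * C)"
        "complex_of_real (- (1/e)) \<cdot>\<^sub>m ?HD\<^sup>\<dagger> * (complex_of_real (- (1/e)) \<cdot>\<^sub>m ?HD) + 0\<^sub>m n n * 0\<^sub>m n n = complex_of_real ((1/e) * (1/e)) \<cdot>\<^sub>m (D * X * D)"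
        by (simp_all only: s)
    qed
    have c'': "complex_of_real r \<cdot>\<^sub>m (C\<^sup>\<dagger> * X * C) \<in> carrier_mat n n" "complex_of_real r \<cdot>\<^sub>m (C\<^sup>\<dagger> * X * D) \<in> carrier_mat n n"
       "complex_of_real r \<cdot>\<^sub>m (D * X * C) \<in> carrier_mat n n" "complex_of_real r \<cdot>\<^sub>m (D * X * D) \<in> carrier_mat n n" for r
      using c' by simp_all
    have "W + M\<^sup>\<dagger> * M = Z e"
    proof -
      have dims: "dim_row (C\<^sup>\<dagger> * X * C) = n" "dim_col (C\<^sup>\<dagger> * X * C) = n" "dim_row (D * X * D) = n" "dim_col (D * X * D) = n"
        using c' by auto
      have comb: "P + complex_of_real r \<cdot>\<^sub>m P = complex_of_real (1 + r) \<cdot>\<^sub>m P" "complex_of_real (1 + -1) \<cdot>\<^sub>m P = 0\<^sub>m n n"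
        if "P \<in> carrier_mat n n" for P r using that by (auto intro!: eq_matI simp: algebra_simps)
      have "W + M\<^sup>\<dagger> * M = four_block_mat (complex_of_real (1 + e * e) \<cdot>\<^sub>m (C\<^sup>\<dagger> * X * C)) (0\<^sub>m n n) (0\<^sub>m n n) (complex_of_real (1 + (1/e) * (1/e)) \<cdot>\<^sub>m (D * X * D))"
        unfolding W MM add_four_block_mat[OF c' c''(1) c''(2) c''(3) c''(4)]
        by (simp only: comb[OF c'(1)] comb[OF c'(2)] comb[OF c'(3)] comb[OF c'(4)])
      then show ?thesis unfolding Z_def direct_sum_def by (simp only: power2_eq_square index_smult_mat dims)
    qed
    then show ?thesis using loewner_le_add_psd[OF psd_herm[OF Wpsd] psd_gram[OF M]] by simp
  qed
  have gZ: "mat_fun g (Z e) = direct_sum (mat_fun g (complex_of_real (1 + e\<^sup>2) \<cdot>\<^sub>m (C\<^sup>\<dagger> * X * C)))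
     (mat_fun g (complex_of_real (1 + (1/e)\<^sup>2) \<cdot>\<^sub>m (D * X * D)))" for e
    unfolding Z_def by (rule mat_fun_direct_sum[OF herm_smult[OF psd_herm[OF CXC]] herm_smult[OF hDXD]])
  \<comment> \<open>\<open>Q\<close> is \<open>g(0)\<close> times the identity, so \<open>E Q E\<close> is positive and may be dropped from the corner.\<close>
  define Q where "Q = mat_fun g (0\<^sub>m n n)"
  have Q: "psd_mat n Q" unfolding Q_def using pos by (intro mat_fun_psd) (auto simp: psd_mat_iff)
  have gX: "mat_fun g X \<in> carrier_mat n n" by (rule mat_fun_carrier[OF hX])
  have Qc: "Q \<in> carrier_mat n n" using Q by (intro herm_carrier psd_herm)
  have gW: "mat_fun g W = U\<^sup>\<dagger> * direct_sum (mat_fun g X) Q * U"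
    unfolding W_def using mat_fun_unitary_conj[OF psd_herm[OF Xsum] U unit] mat_fun_direct_sum[OF hX herm_zero] by (simp add: Q_def)
  have corner: "loewner_le n (C\<^sup>\<dagger> * mat_fun g X * C) (mat_fun g (complex_of_real (1 + e\<^sup>2) \<cdot>\<^sub>m (C\<^sup>\<dagger> * X * C)))" if e: "0 < e" for e
    unfolding loewner_le_def
  proof (intro conjI ballI)
    show "herm n (C\<^sup>\<dagger> * mat_fun g X * C)" by (rule herm_congruence[OF C mat_fun_herm[OF hX]])
    show h1: "herm n (mat_fun g (complex_of_real (1 + e\<^sup>2) \<cdot>\<^sub>m (C\<^sup>\<dagger> * X * C)))"
      by (intro mat_fun_herm herm_smult psd_herm[OF CXC])
    have h2: "herm n (mat_fun g (complex_of_real (1 + (1/e)\<^sup>2) \<cdot>\<^sub>m (D * X * D)))"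
      by (intro mat_fun_herm herm_smult hDXD)
    fix v :: "complex vec" assume v: "v \<in> carrier_vec n"
    have le: "loewner_le (n + n) (mat_fun g W) (mat_fun g (Z e))"
      using mono Wpsd WZ[OF e] by (simp add: operator_monotone_iff)
    have c: "C\<^sup>\<dagger> * mat_fun g X * C \<in> carrier_mat n n" "E * Q * E \<in> carrier_mat n n"
       "C\<^sup>\<dagger> * mat_fun g X * D + E * Q * - C\<^sup>\<dagger> \<in> carrier_mat n n"
      "D * mat_fun g X * C + - C * Q * E \<in> carrier_mat n n" "D * mat_fun g X * D + - C * Q * - C\<^sup>\<dagger> \<in> carrier_mat n n"
      using C Ca Cm Ec Dc gX Qc by (simp_all del: assoc_mult_mat uminus_mult_left_mat uminus_mult_right_mat)
    have v0: "v @\<^sub>v 0\<^sub>v n \<in> carrier_vec (n + n)" using v by simp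
    have "qf (C\<^sup>\<dagger> * mat_fun g X * C) v \<le> qf (C\<^sup>\<dagger> * mat_fun g X * C) v + qf (E * Q * E) v"
      using psd_sandwich[OF Q E(1)] v by (simp add: psd_mat_iff)
    also have "\<dots> = qf (C\<^sup>\<dagger> * mat_fun g X * C + E * Q * E) v"
      by (rule qf_add[OF c(1,2) v, symmetric])
    also have "\<dots> = qf (mat_fun g W) (v @\<^sub>v 0\<^sub>v n)"
      unfolding gW conj[OF gX Qc] using qf_corner[OF add_carrier_mat[OF c(2)] c(3,4,5) v] by simp
    also have "\<dots> \<le> qf (mat_fun g (Z e)) (v @\<^sub>v 0\<^sub>v n)" by (rule loewner_leD[OF le v0])
    also have "\<dots> = qf (mat_fun g (complex_of_real (1 + e\<^sup>2) \<cdot>\<^sub>m (C\<^sup>\<dagger> * X * C))) v"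
      unfolding gZ direct_sum_def using herm_carrier[OF h1] herm_carrier[OF h2] v by (intro qf_corner[of _ n _ n]) auto
    finally show "qf (C\<^sup>\<dagger> * mat_fun g X * C) v \<le> qf (mat_fun g (complex_of_real (1 + e\<^sup>2) \<cdot>\<^sub>m (C\<^sup>\<dagger> * X * C))) v" .
  qed
  show ?thesis
  proof (rule loewner_le_limit_right)
    show "herm n (C\<^sup>\<dagger> * mat_fun g X * C)" by (rule herm_congruence[OF C mat_fun_herm[OF hX]])
    show "herm n (mat_fun g (C\<^sup>\<dagger> * X * C))" by (rule mat_fun_herm[OF psd_herm[OF CXC]])
    show "((\<lambda>e. qf (mat_fun (\<lambda>x. g ((1 + e\<^sup>2) * x)) (C\<^sup>\<dagger> * X * C)) v) \<longlongrightarrow> qf (mat_fun g (C\<^sup>\<dagger> * X * C)) v) (at_right 0)"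
      if v: "v \<in> carrier_vec n" for v
    proof (rule mat_fun_tendsto[OF CXC v])
      fix x :: real assume x: "0 \<le> x"
      have "((\<lambda>e. (1 + e\<^sup>2) * x) \<longlongrightarrow> (1 + 0\<^sup>2) * x) (at_right 0)" by (intro tendsto_intros)
      then have "((\<lambda>e. g ((1 + e\<^sup>2) * x)) \<longlongrightarrow> g ((1 + 0\<^sup>2) * x)) (at_right 0)"
        using x by (intro continuous_on_tendsto_compose[OF cont]) auto
      then show "((\<lambda>e. g ((1 + e\<^sup>2) * x)) \<longlongrightarrow> g x) (at_right 0)" by simp
    qed
    show "\<forall>\<^sub>F e in at_right 0. loewner_le n (C\<^sup>\<dagger> * mat_fun g X * C) (mat_fun (\<lambda>x. g ((1 + e\<^sup>2) * x)) (C\<^sup>\<dagger> * X * C))"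
      using eventually_at_right_less[of "0::real"]
      by eventually_elim (use corner in \<open>simp only: mat_fun_of_smult[OF psd_herm[OF CXC]]\<close>)
  qed simp
qed

section \<open>Operator means with positive definite first argument\<close>

text \<open>
  A function vanishing at 0 factors as \<open>g(x) = x (g(x)/x)\<close>, also at 0 since division by zero gives 0; so \<open>g(N)\<close>
  has \<open>N\<close> as a left factor.
\<close>

lemma mat_fun_range_projection:
  assumes N: "herm n N" and P: "P \<in> carrier_mat n n" "P * N = N" and g0: "g 0 = 0"
  shows "P * mat_fun g N = mat_fun g N"
proof -
  have "mat_fun g N = mat_fun (\<lambda>x. x * (g x / x)) N"
    by (rule arg_cong[of _ _ "\<lambda>h. mat_fun h N"]) (auto simp: g0)
  also have "\<dots> = N * mat_fun (\<lambda>x. g x / x) N"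
    using mat_fun_mult[OF N, of "\<lambda>x. x" "\<lambda>x. g x / x"] by (simp add: mat_fun_id[OF N])
  finally have *: "mat_fun g N = N * mat_fun (\<lambda>x. g x / x) N" .
  show ?thesis unfolding *
    using assoc_mult_mat[OF P(1) herm_carrier[OF N] mat_fun_carrier[OF N], of "\<lambda>x. g x / x"] by (simp only: P(2))
qed

lemma projection_le_one:
  assumes P: "herm n P" "P * P = P"
  shows "loewner_le n (P\<^sup>\<dagger> * P) (1\<^sub>m n)" "psd_mat n P"
proof -
  have Pc: "P \<in> carrier_mat n n" using P(1) by (rule herm_carrier)
  have "(1\<^sub>m n - P)\<^sup>\<dagger> * (1\<^sub>m n - P) = 1\<^sub>m n - P"
  proof -
    have "(1\<^sub>m n - P)\<^sup>\<dagger> = 1\<^sub>m n - P" using hermD[OF herm_minus[OF herm_one P(1)]] .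
    then have "(1\<^sub>m n - P)\<^sup>\<dagger> * (1\<^sub>m n - P) = (1\<^sub>m n - P) * 1\<^sub>m n - (1\<^sub>m n - P) * P"
      using Pc by (simp only: mult_minus_distrib_mat[OF minus_carrier_mat[OF Pc] one_carrier_mat Pc])
    also have "(1\<^sub>m n - P) * P = P - P" using Pc by (simp add: minus_mult_distrib_mat[of _ n n _ _ n] P(2))
    also have "P - P = 0\<^sub>m n n" using Pc by simp
    also have "(1\<^sub>m n - P) * 1\<^sub>m n = 1\<^sub>m n - P" using minus_carrier_mat[OF Pc] by (rule right_mult_one_mat)
    also have "1\<^sub>m n - P - 0\<^sub>m n n = 1\<^sub>m n - P" using Pc by (intro eq_matI) auto
    finally show ?thesis .
  qed
  then have "psd_mat n (1\<^sub>m n - P)" using psd_gram[OF minus_carrier_mat[OF Pc], of "1\<^sub>m n"] by simp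
  then show "loewner_le n (P\<^sup>\<dagger> * P) (1\<^sub>m n)" using psd_minus_iff[OF P(1) herm_one] by (simp add: hermD[OF P(1)] P(2))
  show "psd_mat n P" using psd_gram[OF Pc] by (simp add: hermD[OF P(1)] P(2))
qed

text \<open>
  If \<open>V \<le> W\<close>, then \<open>T = V\<^sup>1\<^sup>/\<^sup>2 W\<^sup>-\<^sup>1\<^sup>/\<^sup>2\<close> is a contraction, hence so is its adjoint, which reads
  \<open>V\<^sup>1\<^sup>/\<^sup>2 W\<^sup>-\<^sup>1 V\<^sup>1\<^sup>/\<^sup>2 \<le> 1\<close>.
\<close>

lemma mat_powr_neg_one_antimono:
  assumes V: "pd_mat n V" and le: "loewner_le n V W"
  shows "loewner_le n (mat_powr W (-1)) (mat_powr V (-1))"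
proof -
  have W: "pd_mat n W" using V le by (rule pd_le)
  have hV: "herm n V" and hW: "herm n W" using V W by (auto simp: pd_herm)
  have c: "mat_powr V p \<in> carrier_mat n n" "mat_powr W p \<in> carrier_mat n n" for p
    using hV hW by (auto simp: mat_powr_carrier)
  define T where "T = mat_powr V (1/2) * mat_powr W (-(1/2))"
  have Tc: "T \<in> carrier_mat n n" using c by (simp add: T_def)
  have Ta: "T\<^sup>\<dagger> = mat_powr W (-(1/2)) * mat_powr V (1/2)"
    by (simp add: T_def adj_mult[OF c(1) c(2)] hermD[OF mat_powr_herm[OF hV]] hermD[OF mat_powr_herm[OF hW]])
  have V1: "mat_powr V 1 = V" "mat_powr W 1 = W" using mat_powr_one[OF pd_psd[OF V]] mat_powr_one[OF pd_psd[OF W]] .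
  have "T\<^sup>\<dagger> * T = mat_powr W (-(1/2)) * (mat_powr V (1/2) * mat_powr V (1/2)) * mat_powr W (-(1/2))"
    unfolding Ta unfolding T_def using c by (simp add: mult_assoc_sq[of _ n] del: assoc_mult_mat)
  then have "T\<^sup>\<dagger> * T = mat_powr W (-(1/2)) * V * mat_powr W (-(1/2))" by (simp add: mat_powr_mult[OF hV] V1)
  moreover have "mat_powr W (-(1/2)) * W * mat_powr W (-(1/2)) = mat_powr W (-(1/2)) * mat_powr W 1 * mat_powr W (-(1/2))"
    by (simp only: V1)
  then have "mat_powr W (-(1/2)) * W * mat_powr W (-(1/2)) = 1\<^sub>m n"
    by (simp add: mat_powr_mult[OF hW] mat_powr_zero[OF W])
  ultimately have "loewner_le n (T\<^sup>\<dagger> * T) (1\<^sub>m n)"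
    using loewner_le_sandwich[OF le mat_powr_herm[OF hW], of "-(1/2)"] by simp
  from loewner_le_sandwich[OF contraction_adj[OF Tc this] mat_powr_herm[OF hV], of "-(1/2)"]
  have *: "loewner_le n (mat_powr V (-(1/2)) * (T * T\<^sup>\<dagger>) * mat_powr V (-(1/2))) (mat_powr V (-(1/2)) * 1\<^sub>m n * mat_powr V (-(1/2)))" .
  have "T * T\<^sup>\<dagger> = mat_powr V (1/2) * (mat_powr W (-(1/2)) * mat_powr W (-(1/2))) * mat_powr V (1/2)"
    unfolding Ta unfolding T_def using c by (simp add: mult_assoc_sq[of _ n] del: assoc_mult_mat)
  then have "T * T\<^sup>\<dagger> = mat_powr V (1/2) * mat_powr W (-1) * mat_powr V (1/2)" by (simp add: mat_powr_mult[OF hW])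
  then have 1: "mat_powr V (-(1/2)) * (T * T\<^sup>\<dagger>) * mat_powr V (-(1/2)) = mat_powr W (-1)"
    using mat_powr_sandwich_cancel[OF V c(2), of "-(1/2)" "-1"] by simp
  have 2: "mat_powr V (-(1/2)) * 1\<^sub>m n * mat_powr V (-(1/2)) = mat_powr V (-1)"
    using c by (simp add: right_mult_one_mat[of _ n n] mat_powr_mult[OF hV])
  show ?thesis using * unfolding 1 2 .
qed

locale mean_function =
  fixes f :: "real \<Rightarrow> real"
  assumes mono: "operator_monotone f" and cont: "continuous_on {0..} f" and nonneg: "\<And>x. 0 \<le> x \<Longrightarrow> 0 \<le> f x"
begin

lemma mean_inner_psd:
  "pd_mat n A \<Longrightarrow> psd_mat n B \<Longrightarrow> psd_mat n (mat_powr A p * B * mat_powr A p)"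
  by (intro psd_sandwich mat_powr_herm pd_herm)

lemma op_mean_pd_psd:
  assumes A: "pd_mat n A" and B: "psd_mat n B"
  shows "psd_mat n (op_mean_pd f A B)"
  unfolding op_mean_pd_def
  by (intro psd_sandwich mat_powr_herm pd_herm A mat_fun_psd mean_inner_psd B nonneg)

lemma op_mean_pd_mono_right:
  assumes A: "pd_mat n A" and B: "psd_mat n B" and le: "loewner_le n B B'"
  shows "loewner_le n (op_mean_pd f A B) (op_mean_pd f A B')"
  unfolding op_mean_pd_def
  using mono mean_inner_psd[OF A B] loewner_le_sandwich[OF le mat_powr_herm[OF pd_herm[OF A]]]
  by (intro loewner_le_sandwich mat_powr_herm pd_herm A) (simp add: operator_monotone_iff)

text \<open>
  Hansen's inequality for the contraction \<open>C = A\<^sup>1\<^sup>/\<^sup>2 A'\<^sup>-\<^sup>1\<^sup>/\<^sup>2\<close> and \<open>X = A\<^sup>-\<^sup>1\<^sup>/\<^sup>2 B A\<^sup>-\<^sup>1\<^sup>/\<^sup>2\<close>: here \<open>C\<^sup>\<dagger> X C\<close> is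
  \<open>A'\<^sup>-\<^sup>1\<^sup>/\<^sup>2 B A'\<^sup>-\<^sup>1\<^sup>/\<^sup>2\<close>, and \<open>C\<^sup>\<dagger> f(X) C\<close> is the mean of \<open>A\<close> and \<open>B\<close> between two factors \<open>A'\<^sup>-\<^sup>1\<^sup>/\<^sup>2\<close>.
\<close>

lemma op_mean_pd_mono_left:
  assumes A: "pd_mat n A" and le: "loewner_le n A A'" and B: "psd_mat n B"
  shows "loewner_le n (op_mean_pd f A B) (op_mean_pd f A' B)"
proof -
  have A': "pd_mat n A'" using A le by (rule pd_le)
  have h: "herm n A" "herm n A'" using A A' by (auto simp: pd_herm)
  have c: "mat_powr A p \<in> carrier_mat n n" "mat_powr A' p \<in> carrier_mat n n" "B \<in> carrier_mat n n" for p
    using h B by (auto simp: mat_powr_carrier herm_carrier psd_herm)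
  let ?H = "-(1/2) :: real"
  define C where "C = mat_powr A (1/2) * mat_powr A' ?H"
  have Cc: "C \<in> carrier_mat n n" using c by (simp add: C_def)
  have Ca: "C\<^sup>\<dagger> = mat_powr A' ?H * mat_powr A (1/2)"
    by (simp add: C_def adj_mult[OF c(1) c(2)] hermD[OF mat_powr_herm[OF h(1)]] hermD[OF mat_powr_herm[OF h(2)]])
  have A1: "mat_powr A 1 = A" "mat_powr A' 1 = A'" using mat_powr_one[OF pd_psd[OF A]] mat_powr_one[OF pd_psd[OF A']] .
  have conj: "C\<^sup>\<dagger> * Z * C = mat_powr A' ?H * (mat_powr A (1/2) * Z * mat_powr A (1/2)) * mat_powr A' ?H"
    if "Z \<in> carrier_mat n n" for Z
    unfolding Ca unfolding C_def using c that by (simp add: mult_assoc_sq[of _ n] del: assoc_mult_mat)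
  have "C\<^sup>\<dagger> * C = mat_powr A' ?H * (mat_powr A (1/2) * mat_powr A (1/2)) * mat_powr A' ?H"
    using conj[OF one_carrier_mat] Cc c by (simp add: right_mult_one_mat[of _ n n])
  then have "C\<^sup>\<dagger> * C = mat_powr A' ?H * A * mat_powr A' ?H" by (simp add: mat_powr_mult[OF h(1)] A1)
  moreover have "mat_powr A' ?H * A' * mat_powr A' ?H = mat_powr A' ?H * mat_powr A' 1 * mat_powr A' ?H"
    by (simp only: A1)
  then have "mat_powr A' ?H * A' * mat_powr A' ?H = 1\<^sub>m n"
    by (simp add: mat_powr_mult[OF h(2)] mat_powr_zero[OF A'])
  ultimately have contr: "loewner_le n (C\<^sup>\<dagger> * C) (1\<^sub>m n)"
    using loewner_le_sandwich[OF le mat_powr_herm[OF h(2)], of ?H] by simp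
  define X where "X = mat_powr A ?H * B * mat_powr A ?H"
  have X: "psd_mat n X" unfolding X_def by (rule mean_inner_psd[OF A B])
  have Xc: "X \<in> carrier_mat n n" "mat_fun f X \<in> carrier_mat n n"
    using X by (auto simp: herm_carrier psd_herm mat_fun_carrier)
  have CXC: "C\<^sup>\<dagger> * X * C = mat_powr A' ?H * B * mat_powr A' ?H"
    unfolding conj[OF Xc(1)] using mat_powr_sandwich_cancel[OF A c(3), of "1/2"] by (simp only: X_def)
  have "loewner_le n (C\<^sup>\<dagger> * mat_fun f X * C) (mat_fun f (C\<^sup>\<dagger> * X * C))"
    by (rule hansen[OF mono cont nonneg X Cc contr])
  then have "loewner_le n (mat_powr A' ?H * op_mean_pd f A B * mat_powr A' ?H) (mat_fun f (mat_powr A' ?H * B * mat_powr A' ?H))"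
    unfolding CXC conj[OF Xc(2)] by (simp add: op_mean_pd_def X_def)
  from loewner_le_sandwich[OF this mat_powr_herm[OF h(2)], of "1/2"]
  show ?thesis
    using mat_powr_sandwich_cancel[OF A' herm_carrier[OF psd_herm[OF op_mean_pd_psd[OF A B]]], of "1/2"]
    by (simp add: op_mean_pd_def)
qed

text \<open>
  Hansen's inequality for the scalar contraction \<open>\<surd>c\<close>.
\<close>

lemma mat_fun_scale:
  assumes X: "psd_mat n X" and c: "0 \<le> c" "c \<le> 1"
  shows "loewner_le n (complex_of_real c \<cdot>\<^sub>m mat_fun f X) (mat_fun f (complex_of_real c \<cdot>\<^sub>m X))"
proof -
  let ?C = "complex_of_real (sqrt c) \<cdot>\<^sub>m 1\<^sub>m n"
  have C: "?C \<in> carrier_mat n n" "?C\<^sup>\<dagger> = ?C" by (auto simp: adj_smult)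
  have sc: "?C * Z * ?C = complex_of_real c \<cdot>\<^sub>m Z" if Z: "Z \<in> carrier_mat n n" for Z
  proof -
    have "?C * Z * ?C = complex_of_real (sqrt c) \<cdot>\<^sub>m (complex_of_real (sqrt c) \<cdot>\<^sub>m Z)"
      using Z by (simp add: mult_smult_assoc_mat[of _ n n _ n] mult_smult_distrib[of _ n n _ n] left_mult_one_mat[of _ n n] right_mult_one_mat[of _ n n])
    also have "\<dots> = complex_of_real c \<cdot>\<^sub>m Z"
      using Z c by (intro eq_matI) (auto simp: mult.assoc[symmetric] simp flip: of_real_mult)
    finally show ?thesis .
  qed
  have "?C\<^sup>\<dagger> * ?C = complex_of_real c \<cdot>\<^sub>m 1\<^sub>m n"
    using sc[OF one_carrier_mat] unfolding C(2) by (simp only: right_mult_one_mat[OF C(1)])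
  moreover have "loewner_le n (complex_of_real c \<cdot>\<^sub>m 1\<^sub>m n) (1\<^sub>m n)"
    using c by (auto simp: loewner_le_def qf_smult[of _ n] qf_one intro!: mult_left_le_one_le)
  ultimately have "loewner_le n (?C\<^sup>\<dagger> * ?C) (1\<^sub>m n)" by simp
  from hansen[OF mono cont nonneg X C(1) this] show ?thesis
    unfolding C(2) sc[OF mat_fun_carrier[OF psd_herm[OF X]]] sc[OF herm_carrier[OF psd_herm[OF X]]] .
qed

lemma op_mean_pd_scale:
  assumes A: "pd_mat n A" and B: "psd_mat n B" and c: "0 \<le> c" "c \<le> 1" and le: "loewner_le n (complex_of_real c \<cdot>\<^sub>m B) B'"
  shows "loewner_le n (complex_of_real c \<cdot>\<^sub>m op_mean_pd f A B) (op_mean_pd f A B')"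
proof -
  have Ac: "mat_powr A p \<in> carrier_mat n n" for p using A by (simp add: mat_powr_carrier pd_herm)
  have Bc: "B \<in> carrier_mat n n" using B by (simp add: herm_carrier psd_herm)
  let ?X = "mat_powr A (-1/2) * B * mat_powr A (-1/2)"
  have Xc: "mat_fun f ?X \<in> carrier_mat n n" using mean_inner_psd[OF A B] by (simp add: psd_herm mat_fun_carrier)
  have sm: "complex_of_real c \<cdot>\<^sub>m (S * Y * S) = S * (complex_of_real c \<cdot>\<^sub>m Y) * S"
    if "S \<in> carrier_mat n n" "Y \<in> carrier_mat n n" for S Y
    using that by (simp add: mult_smult_assoc_mat[of _ n n _ n] mult_smult_distrib[of _ n n _ n] del: assoc_mult_mat)
  have "loewner_le n (complex_of_real c \<cdot>\<^sub>m op_mean_pd f A B) (op_mean_pd f A (complex_of_real c \<cdot>\<^sub>m B))"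
    unfolding op_mean_pd_def sm[OF Ac Xc] sm[OF Ac Bc, symmetric]
    by (intro loewner_le_sandwich mat_fun_scale mean_inner_psd mat_powr_herm pd_herm A B c)
  also have "loewner_le n (op_mean_pd f A (complex_of_real c \<cdot>\<^sub>m B)) (op_mean_pd f A B')"
    by (rule op_mean_pd_mono_right[OF A psd_smult[OF B c(1)] le])
  finally show ?thesis .
qed

end

locale mean_function_0 = mean_function +
  assumes f0: "f 0 = 0"
begin

text \<open>
  With \<open>T = V\<^sup>1\<^sup>/\<^sup>2 P\<close> one has \<open>T T\<^sup>\<dagger> = V\<^sup>1\<^sup>/\<^sup>2 P V\<^sup>1\<^sup>/\<^sup>2\<close> and \<open>T\<^sup>\<dagger> T = P V P\<close>, and intertwining moves a function of
  \<open>T T\<^sup>\<dagger>\<close> to one of \<open>T\<^sup>\<dagger> T\<close>: with \<open>k(x) = f(x)/x\<close>, \<open>f(T T\<^sup>\<dagger>) = k(T T\<^sup>\<dagger>) T T\<^sup>\<dagger> = T k(T\<^sup>\<dagger> T) T\<^sup>\<dagger>\<close>. The mean with a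
  projection thus depends only on a compression of the inverse. Because \<open>f(0) = 0\<close> and division by zero gives 0,
  the factorization \<open>f(x) = x k(x)\<close> holds at 0 and \<open>k(0) = 0\<close>, so \<open>k(P V P)\<close> vanishes off the range of \<open>P\<close>.
\<close>

lemma op_mean_pd_projection:
  assumes V: "pd_mat n V" and P: "herm n P" "P * P = P"
  shows "op_mean_pd f (mat_powr V (-1)) P = mat_fun (\<lambda>x. f x / x) (P * V * P)"
proof -
  let ?k = "\<lambda>x. f x / x"
  have hV: "herm n V" using V by (rule pd_herm)
  have c: "mat_powr V p \<in> carrier_mat n n" "P \<in> carrier_mat n n" "V \<in> carrier_mat n n" for p
    using V P by (auto simp: mat_powr_carrier herm_carrier pd_herm)
  define T where "T = mat_powr V (1/2) * P"
  have Tc: "T \<in> carrier_mat n n" using c by (simp add: T_def)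
  have Ta: "T\<^sup>\<dagger> = P * mat_powr V (1/2)"
    by (simp add: T_def adj_mult[OF c(1) c(2)] hermD[OF P(1)] hermD[OF mat_powr_herm[OF hV]])
  have Tac: "T\<^sup>\<dagger> \<in> carrier_mat n n" using Tc by simp
  have V1: "mat_powr V 1 = V" using mat_powr_one[OF pd_psd[OF V]] .
  let ?M = "T * T\<^sup>\<dagger>" and ?N = "P * V * P"
  have Nc: "?N \<in> carrier_mat n n" using c by (simp del: assoc_mult_mat)
  have N: "T\<^sup>\<dagger> * T = ?N"
  proof -
    have "T\<^sup>\<dagger> * T = P * (mat_powr V (1/2) * mat_powr V (1/2)) * P"
      unfolding Ta unfolding T_def using c by (simp add: mult_assoc_sq[of _ n] del: assoc_mult_mat)
    then show ?thesis by (simp add: mat_powr_mult[OF hV] V1)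
  qed
  have M: "?M = mat_powr V (1/2) * P * mat_powr V (1/2)"
  proof -
    have "?M = mat_powr V (1/2) * (P * P) * mat_powr V (1/2)"
      unfolding Ta unfolding T_def using c by (simp add: mult_assoc_sq[of _ n] del: assoc_mult_mat)
    then show ?thesis by (simp only: P(2))
  qed
  have hN: "herm n ?N" using herm_gram[OF Tc] by (simp only: N)
  have hM: "herm n ?M" using herm_gram[OF Tac] by (simp only: adj_adj)
  have kN: "mat_fun ?k ?N \<in> carrier_mat n n" by (rule mat_fun_carrier[OF hN])
  have "mat_fun ?k ?M * T = T * mat_fun ?k ?N"
    using Tc Tac N by (intro mat_fun_intertwine[OF hM hN Tc]) (simp add: mult_assoc_sq[of _ n] del: assoc_mult_mat)
  then have "mat_fun ?k ?M * T * T\<^sup>\<dagger> = T * mat_fun ?k ?N * T\<^sup>\<dagger>" by simp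
  then have 1: "mat_fun ?k ?M * ?M = T * mat_fun ?k ?N * T\<^sup>\<dagger>"
    using assoc_mult_mat[OF mat_fun_carrier[OF hM] Tc Tac, of ?k] by simp
  have "mat_fun f ?M = mat_fun (\<lambda>x. ?k x * x) ?M"
    by (rule arg_cong[of _ _ "\<lambda>h. mat_fun h ?M"]) (auto simp: f0)
  also have "\<dots> = mat_fun ?k ?M * ?M"
    using mat_fun_mult[OF hM, of ?k "\<lambda>x. x"] by (simp add: mat_fun_id[OF hM])
  finally have fM: "mat_fun f ?M = T * mat_fun ?k ?N * T\<^sup>\<dagger>" by (simp only: 1)
  have pow: "mat_powr (mat_powr V (-1)) (1/2) = mat_powr V (-(1/2))" "mat_powr (mat_powr V (-1)) (-1/2) = mat_powr V (1/2)"
    by (simp_all add: mat_powr_powr[OF hV])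
  have "op_mean_pd f (mat_powr V (-1)) P = mat_powr V (-(1/2)) * (T * mat_fun ?k ?N * T\<^sup>\<dagger>) * mat_powr V (-(1/2))"
    by (simp only: op_mean_pd_def pow M[symmetric] fM)
  also have "\<dots> = mat_powr V (-(1/2)) * (mat_powr V (1/2) * ((P * mat_fun ?k ?N * P) * (mat_powr V (1/2) * mat_powr V (-(1/2)))))"
    unfolding Ta unfolding T_def using c kN by (simp add: mult_assoc_sq[of _ n] del: assoc_mult_mat)
  also have "mat_powr V (1/2) * mat_powr V (-(1/2)) = 1\<^sub>m n" by (rule mat_powr_inverse[OF V])
  also have "(P * mat_fun ?k ?N * P) * 1\<^sub>m n = P * mat_fun ?k ?N * P"
    using c kN by (intro right_mult_one_mat[of _ n n]) (simp del: assoc_mult_mat)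
  also have "mat_powr V (-(1/2)) * (mat_powr V (1/2) * (P * mat_fun ?k ?N * P)) = P * mat_fun ?k ?N * P"
    by (rule mult_cancel_left[OF mat_powr_inverse(2)[OF V] c(1) c(1) mult_sq[OF mult_sq[OF c(2) kN] c(2)]])
  also have PkN: "P * mat_fun ?k ?N = mat_fun ?k ?N"
  proof (rule mat_fun_range_projection[OF hN c(2)])
    have "P * ?N = (P * P) * V * P" using c by (simp add: mult_assoc_sq[of _ n] del: assoc_mult_mat)
    then show "P * ?N = ?N" by (simp only: P(2))
  qed (simp add: f0)
  also have "mat_fun ?k ?N * P = mat_fun ?k ?N"
    using arg_cong[OF PkN, of mat_adjoint]
    by (simp add: adj_mult[OF c(2) kN] hermD[OF P(1)] hermD[OF mat_fun_herm[OF hN]])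
  finally show ?thesis .
qed

text \<open>
  Put \<open>V = X\<^sup>-\<^sup>1\<close>, \<open>Z = P V P\<close> and \<open>k(x) = f(x)/x\<close>. Then the left-hand side is \<open>k(Z)\<^sup>r \<le> k(Z\<^sup>r)\<close>, the right-hand side
  is \<open>k(P V\<^sup>r P)\<close>, and \<open>P V\<^sup>r P \<le> Z\<^sup>r\<close> by Hansen's inequality; it remains to see that \<open>k\<close> is antitone on
  compressions to \<open>P\<close>. This is monotonicity of the mean in its first argument, read through
  \<open>op_mean_pd_projection\<close>.
\<close>

lemma op_mean_pd_projection_powr_le:
  assumes X: "pd_mat n X" and P: "herm n P" "P * P = P" and r: "0 < r" "r \<le> 1"
    and fr: "\<And>x. 0 < x \<Longrightarrow> f x powr r \<le> f (x powr r)"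
  shows "loewner_le n (mat_powr (op_mean_pd f X P) r) (op_mean_pd f (mat_powr X r) P)"
proof -
  let ?k = "\<lambda>x. f x / x"
  have hX: "herm n X" using X by (rule pd_herm)
  have Pc: "P \<in> carrier_mat n n" using P by (simp add: herm_carrier)
  define V where "V = mat_powr X (-1)"
  have V: "pd_mat n V" unfolding V_def by (rule mat_powr_pd[OF X])
  have X1: "mat_powr V (-1) = X" unfolding V_def by (simp add: mat_powr_powr[OF hX] mat_powr_one[OF pd_psd[OF X]])
  have Xr: "mat_powr (mat_powr V r) (-1) = mat_powr X r" unfolding V_def by (simp add: mat_powr_powr[OF hX])
  define Z where "Z = P * V * P"
  have Z: "psd_mat n Z" unfolding Z_def by (rule psd_sandwich[OF pd_psd[OF V] P(1)])
  have hZ: "herm n Z" and hZr: "herm n (mat_powr Z r)" using Z by (auto simp: psd_herm mat_powr_herm)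
  have Vr: "pd_mat n (mat_powr V r)" by (rule mat_powr_pd[OF V])
  have Vc: "V \<in> carrier_mat n n" "mat_powr V r \<in> carrier_mat n n" "mat_powr Z r \<in> carrier_mat n n"
    using V hZ by (auto simp: herm_carrier pd_herm mat_powr_carrier)
  define Z1 where "Z1 = P * mat_powr V r * P"
  have Z1: "herm n Z1" unfolding Z1_def by (intro psd_herm psd_sandwich pd_psd Vr P)
  have Z1c: "Z1 \<in> carrier_mat n n" using Z1 by (rule herm_carrier)
  have "continuous_on {0..} (\<lambda>x::real. x powr r)" using r by (intro continuous_intros continuous_on_powr') auto
  from hansen[OF operator_monotone_powr[OF r] this _ pd_psd[OF V] Pc projection_le_one(1)[OF P]]
  have Z1_le: "loewner_le n Z1 (mat_powr Z r)"
    by (simp add: Z1_def Z_def mat_powr_def hermD[OF P(1)])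
  have D: "psd_mat n (mat_powr Z r - Z1)" using Z1_le psd_minus_iff[OF Z1 hZr] by simp
  \<comment> \<open>\<open>V2\<close> dominates \<open>V\<^sup>r\<close> and is therefore invertible, while its compression to \<open>P\<close> is exactly \<open>Z\<^sup>r\<close>.\<close>
  define V2 where "V2 = mat_powr V r + (mat_powr Z r - Z1)"
  have V2_le: "loewner_le n (mat_powr V r) V2" unfolding V2_def by (intro loewner_le_add_psd pd_herm Vr D)
  have PZ: "P * mat_powr Z r * P = mat_powr Z r"
  proof -
    have "P * Z = (P * P) * V * P" unfolding Z_def using Pc Vc by (simp add: mult_assoc_sq[of _ n] del: assoc_mult_mat)
    then have "P * Z = Z" by (simp only: P(2) Z_def)
    then have l: "P * mat_powr Z r = mat_powr Z r" unfolding mat_powr_def using r by (intro mat_fun_range_projection[OF hZ Pc]) auto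
    have "mat_powr Z r * P = mat_powr Z r"
      using arg_cong[OF l, of mat_adjoint] by (simp add: adj_mult[OF Pc Vc(3)] hermD[OF P(1)] hermD[OF hZr])
    then show ?thesis by (simp only: l)
  qed
  have PZ1: "P * Z1 * P = Z1"
  proof -
    have "P * Z1 * P = (P * P) * mat_powr V r * (P * P)" unfolding Z1_def using Pc Vc by (simp add: mult_assoc_sq[of _ n] del: assoc_mult_mat)
    then show ?thesis by (simp only: P(2) Z1_def)
  qed
  have PV2: "P * V2 * P = mat_powr Z r"
  proof -
    have "P * V2 = P * mat_powr V r + (P * mat_powr Z r - P * Z1)"
      unfolding V2_def using Pc Vc Z1c minus_carrier_mat[OF Z1c, of "mat_powr Z r"]
      by (simp add: mult_add_distrib_mat[of _ n n _ n] mult_minus_distrib_mat[of _ n n _ n])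
    then have "P * V2 * P = P * mat_powr V r * P + (P * mat_powr Z r * P - P * Z1 * P)"
      using Pc Vc Z1c mult_sq[OF Pc Z1c] mult_sq[OF Pc Vc(3)] mult_sq[OF Pc Vc(2)] minus_carrier_mat[OF mult_sq[OF Pc Z1c], of "P * mat_powr Z r"]
      by (simp add: add_mult_distrib_mat[of _ n n _ _ n] minus_mult_distrib_mat[of _ n n _ _ n] del: assoc_mult_mat)
    then have "P * V2 * P = Z1 + (mat_powr Z r - Z1)" by (simp only: PZ PZ1 Z1_def[symmetric])
    also have "\<dots> = mat_powr Z r" using Z1c Vc by (intro eq_matI) auto
    finally show ?thesis .
  qed
  have "op_mean_pd f X P = mat_fun ?k Z"
    using op_mean_pd_projection[OF V P] by (simp only: X1 Z_def)
  then have "mat_powr (op_mean_pd f X P) r = mat_fun (\<lambda>x. ?k x powr r) Z"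
    by (simp add: mat_powr_def mat_fun_comp[OF hZ])
  also have "loewner_le n \<dots> (mat_fun (\<lambda>x. ?k (x powr r)) Z)"
  proof (rule mat_fun_le[OF Z])
    fix x :: real assume "0 \<le> x"
    then show "?k x powr r \<le> ?k (x powr r)"
      using fr[of x] nonneg[of x] r by (cases "x = 0") (auto simp: powr_divide divide_right_mono)
  qed
  also have "mat_fun (\<lambda>x. ?k (x powr r)) Z = mat_fun ?k (mat_powr Z r)"
    by (simp add: mat_powr_def mat_fun_comp[OF hZ])
  also have "\<dots> = op_mean_pd f (mat_powr V2 (-1)) P"
    using op_mean_pd_projection[OF pd_le[OF Vr V2_le] P] by (simp only: PV2)
  also have "loewner_le n \<dots> (op_mean_pd f (mat_powr (mat_powr V r) (-1)) P)"
    by (intro op_mean_pd_mono_left mat_powr_pd mat_powr_neg_one_antimono pd_le[OF Vr V2_le] Vr V2_le projection_le_one(2) P)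
  finally show ?thesis by (simp only: Xr)
qed

end

section \<open>Entrywise limits of Hermitian matrices\<close>

lemma qf_eq_sum:
  assumes A: "A \<in> carrier_mat n n" and v: "v \<in> carrier_vec n"
  shows "qf A v = Re (\<Sum>i<n. (\<Sum>j<n. A $$ (i, j) * v $ j) * cnj (v $ i))"
proof -
  have "(A *\<^sub>v v) $ i = (\<Sum>j<n. A $$ (i, j) * v $ j)" if "i < n" for i
    using A v that by (simp add: scalar_prod_def atLeast0LessThan)
  then show ?thesis
    unfolding qf_def sprod_eq_sum[OF mult_vec_carrier[OF A v] v] by (simp del: times_complex.sel)
qed

text \<open>
  The polarization identity in coordinates; for Hermitian \<open>A\<close> the choices \<open>c = 1\<close> and \<open>c = -\<i>\<close> isolate the real and
  imaginary part of an entry.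
\<close>

lemma qf_unit_vec_add:
  assumes A: "A \<in> carrier_mat n n" and ij: "i < n" "j < n"
  shows "qf A (unit_vec n i + c \<cdot>\<^sub>v unit_vec n j) = Re (A $$ (i, i)) + (cmod c)\<^sup>2 * Re (A $$ (j, j)) + Re (c * A $$ (i, j)) + Re (cnj c * A $$ (j, i))"
proof -
  let ?v = "unit_vec n i + c \<cdot>\<^sub>v unit_vec n j"
  have v: "?v \<in> carrier_vec n" by simp
  have ind: "?v $ k = (if k = i then 1 else 0) + c * (if k = j then 1 else 0)" if "k < n" for k
    using that ij by (simp add: unit_vec_def)
  have *: "(\<Sum>l<n. A $$ (k, l) * ?v $ l) = A $$ (k, i) + c * A $$ (k, j)" for k
  proof -
    have "(\<Sum>l<n. A $$ (k, l) * ?v $ l) = (\<Sum>l<n. (if l = i then A $$ (k, i) else 0) + (if l = j then c * A $$ (k, j) else 0))"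
      by (intro sum.cong refl) (auto simp: ind algebra_simps simp del: index_add_vec index_smult_vec)
    then show ?thesis using ij by (simp add: sum.distrib)
  qed
  have "qf A ?v = Re (\<Sum>k<n. (A $$ (k, i) + c * A $$ (k, j)) * cnj (?v $ k))"
    unfolding qf_eq_sum[OF A v] * ..
  also have "(\<Sum>k<n. (A $$ (k, i) + c * A $$ (k, j)) * cnj (?v $ k)) =
     (\<Sum>k<n. (if k = i then A $$ (i, i) + c * A $$ (i, j) else 0) + (if k = j then cnj c * (A $$ (j, i) + c * A $$ (j, j)) else 0))"
    by (intro sum.cong refl) (auto simp: ind algebra_simps simp del: index_add_vec index_smult_vec)
  also have "\<dots> = A $$ (i, i) + c * A $$ (i, j) + cnj c * (A $$ (j, i) + c * A $$ (j, j))"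
    using ij by (simp add: sum.distrib)
  also have "\<dots> = A $$ (i, i) + c * A $$ (i, j) + cnj c * A $$ (j, i) + complex_of_real ((cmod c)\<^sup>2) * A $$ (j, j)"
    unfolding complex_norm_square by (simp add: algebra_simps)
  finally show ?thesis by simp
qed

text \<open>
  The coefficient 0 writes the diagonal values in the same shape as the mixed ones.
\<close>

lemma entry_eq_qf:
  assumes A: "herm n A" and ij: "i < n" "j < n"
  defines "e \<equiv> unit_vec n"
  shows "A $$ (i, j) = Complex
     ((qf A (e i + 1 \<cdot>\<^sub>v e j) - qf A (e i + 0 \<cdot>\<^sub>v e j) - qf A (e j + 0 \<cdot>\<^sub>v e i)) / 2)
     ((qf A (e i + (-\<i>) \<cdot>\<^sub>v e j) - qf A (e i + 0 \<cdot>\<^sub>v e j) - qf A (e j + 0 \<cdot>\<^sub>v e i)) / 2)"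
proof -
  have Ac: "A \<in> carrier_mat n n" using A by (rule herm_carrier)
  have "A $$ (j, i) = cnj (A $$ (i, j))"
    using adj_index[of j A i] Ac ij hermD[OF A] by simp
  then show ?thesis
    unfolding e_def qf_unit_vec_add[OF Ac ij] qf_unit_vec_add[OF Ac ij(2,1)] by (simp add: complex_eq_iff)
qed

lemma entries_tendsto:
  assumes F: "\<forall>\<^sub>F x in G. herm n (F x)" and l: "\<And>v. v \<in> carrier_vec n \<Longrightarrow> ((\<lambda>x. qf (F x) v) \<longlongrightarrow> l v) G"
    and ij: "i < n" "j < n"
  defines "e \<equiv> unit_vec n"
  shows "((\<lambda>x. F x $$ (i, j)) \<longlongrightarrow> Complex
     ((l (e i + 1 \<cdot>\<^sub>v e j) - l (e i + 0 \<cdot>\<^sub>v e j) - l (e j + 0 \<cdot>\<^sub>v e i)) / 2)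
     ((l (e i + (-\<i>) \<cdot>\<^sub>v e j) - l (e i + 0 \<cdot>\<^sub>v e j) - l (e j + 0 \<cdot>\<^sub>v e i)) / 2)) G"
proof (rule Lim_transform_eventually)
  show "\<forall>\<^sub>F x in G. Complex
     ((qf (F x) (e i + 1 \<cdot>\<^sub>v e j) - qf (F x) (e i + 0 \<cdot>\<^sub>v e j) - qf (F x) (e j + 0 \<cdot>\<^sub>v e i)) / 2)
     ((qf (F x) (e i + (-\<i>) \<cdot>\<^sub>v e j) - qf (F x) (e i + 0 \<cdot>\<^sub>v e j) - qf (F x) (e j + 0 \<cdot>\<^sub>v e i)) / 2) = F x $$ (i, j)"
    using F by eventually_elim (simp only: e_def entry_eq_qf[OF _ ij, symmetric])
  show "((\<lambda>x. Complex
     ((qf (F x) (e i + 1 \<cdot>\<^sub>v e j) - qf (F x) (e i + 0 \<cdot>\<^sub>v e j) - qf (F x) (e j + 0 \<cdot>\<^sub>v e i)) / 2)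
     ((qf (F x) (e i + (-\<i>) \<cdot>\<^sub>v e j) - qf (F x) (e i + 0 \<cdot>\<^sub>v e j) - qf (F x) (e j + 0 \<cdot>\<^sub>v e i)) / 2)) \<longlongrightarrow>
     Complex
     ((l (e i + 1 \<cdot>\<^sub>v e j) - l (e i + 0 \<cdot>\<^sub>v e j) - l (e j + 0 \<cdot>\<^sub>v e i)) / 2)
     ((l (e i + (-\<i>) \<cdot>\<^sub>v e j) - l (e i + 0 \<cdot>\<^sub>v e j) - l (e j + 0 \<cdot>\<^sub>v e i)) / 2)) G"
    by (intro tendsto_Complex tendsto_divide tendsto_diff tendsto_const l) (auto simp: e_def)
qed

lemma mat_tendsto_exists:
  assumes "\<forall>\<^sub>F x in G. herm n (F x)" and l: "\<And>v. v \<in> carrier_vec n \<Longrightarrow> \<exists>l. ((\<lambda>x. qf (F x) v) \<longlongrightarrow> l) G"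
  shows "\<exists>L. mat_tendsto n F L G"
proof -
  from l obtain l where "\<And>v. v \<in> carrier_vec n \<Longrightarrow> ((\<lambda>x. qf (F x) v) \<longlongrightarrow> l v) G" by metis
  from entries_tendsto[OF assms(1) this]
  have "\<exists>a. ((\<lambda>x. F x $$ (i, j)) \<longlongrightarrow> a) G" if "i < n" "j < n" for i j using that by blast
  then obtain a where "\<And>i j. i < n \<Longrightarrow> j < n \<Longrightarrow> ((\<lambda>x. F x $$ (i, j)) \<longlongrightarrow> a i j) G" by metis
  then have "mat_tendsto n F (mat n n (\<lambda>(i, j). a i j)) G" by (simp add: mat_tendsto_def)
  then show ?thesis by blast
qed

lemma mat_tendsto_unique:
  assumes "G \<noteq> bot" "mat_tendsto n F L G" "mat_tendsto n F L' G"
  shows "L = L'"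
proof (rule eq_matI)
  fix i j assume "i < dim_row L'" "j < dim_col L'"
  then have "((\<lambda>x. F x $$ (i, j)) \<longlongrightarrow> L $$ (i, j)) G" "((\<lambda>x. F x $$ (i, j)) \<longlongrightarrow> L' $$ (i, j)) G"
    using assms by (auto simp: mat_tendsto_def)
  then show "L $$ (i, j) = L' $$ (i, j)" by (rule tendsto_unique[OF assms(1)])
qed (use assms in \<open>auto simp: mat_tendsto_def\<close>)

lemma mat_tendsto_qf:
  assumes F: "\<forall>\<^sub>F x in G. F x \<in> carrier_mat n n" and L: "mat_tendsto n F L G" and v: "v \<in> carrier_vec n"
  shows "((\<lambda>x. qf (F x) v) \<longlongrightarrow> qf L v) G"
proof (rule Lim_transform_eventually)
  have Lc: "L \<in> carrier_mat n n" using L by (simp add: mat_tendsto_def)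
  show "((\<lambda>x. Re (\<Sum>i<n. (\<Sum>j<n. F x $$ (i, j) * v $ j) * cnj (v $ i))) \<longlongrightarrow> qf L v) G"
    unfolding qf_eq_sum[OF Lc v] using L
    by (intro tendsto_sum tendsto_Re tendsto_mult_right) (auto simp: mat_tendsto_def)
  show "\<forall>\<^sub>F x in G. Re (\<Sum>i<n. (\<Sum>j<n. F x $$ (i, j) * v $ j) * cnj (v $ i)) = qf (F x) v"
    using F by eventually_elim (simp only: qf_eq_sum v)
qed

lemma mat_tendsto_herm:
  assumes F: "\<forall>\<^sub>F x in G. herm n (F x)" and L: "mat_tendsto n F L G" and G: "G \<noteq> bot"
  shows "herm n L"
proof -
  have Lc: "L \<in> carrier_mat n n" using L by (simp add: mat_tendsto_def)
  have "cnj (L $$ (j, i)) = L $$ (i, j)" if "i < n" "j < n" for i j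
  proof (rule tendsto_unique[OF G])
    show "((\<lambda>x. F x $$ (i, j)) \<longlongrightarrow> L $$ (i, j)) G" using L that by (simp add: mat_tendsto_def)
    have "((\<lambda>x. cnj (F x $$ (j, i))) \<longlongrightarrow> cnj (L $$ (j, i))) G"
      using L that by (intro tendsto_cnj) (simp add: mat_tendsto_def)
    moreover have "\<forall>\<^sub>F x in G. cnj (F x $$ (j, i)) = F x $$ (i, j)"
      using F
    proof eventually_elim
      case (elim x)
      then show ?case using adj_index[of i "F x" j] herm_carrier[OF elim] hermD[OF elim] that by simp
    qed
    ultimately show "((\<lambda>x. F x $$ (i, j)) \<longlongrightarrow> cnj (L $$ (j, i))) G"
      by (rule Lim_transform_eventually)
  qed
  then have "L\<^sup>\<dagger> = L" using Lc by (intro eq_matI) auto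
  with Lc show ?thesis by (simp add: herm_def)
qed

lemma tendsto_at_right_mono_bounded:
  fixes h :: "real \<Rightarrow> real"
  assumes mono: "\<And>x y. 0 < x \<Longrightarrow> x \<le> y \<Longrightarrow> h x \<le> h y" and nonneg: "\<And>x. 0 < x \<Longrightarrow> 0 \<le> h x"
  shows "\<exists>l. (h \<longlongrightarrow> l) (at_right 0)"
proof
  let ?l = "Inf (h ` {0<..})"
  have bdd: "bdd_below (h ` {0<..})" using nonneg by (intro bdd_belowI[of _ 0]) auto
  show "(h \<longlongrightarrow> ?l) (at_right 0)"
  proof (rule order_tendstoI)
    fix a assume "a < ?l"
    have le: "?l \<le> h x" if "0 < x" for x using that bdd by (intro cInf_lower) auto
    show "\<forall>\<^sub>F x in at_right 0. a < h x"
      using eventually_at_right_less[of "0::real"] by eventually_elim (rule less_le_trans[OF \<open>a < ?l\<close> le])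
  next
    fix a assume "?l < a"
    then obtain y where y: "0 < y" "h y < a" using cInf_lessD[of "h ` {0<..}" a] by auto
    have "\<forall>\<^sub>F x in at_right 0. x \<in> {0<..<y}" by (rule eventually_at_right_real[OF y(1)])
    then show "\<forall>\<^sub>F x in at_right 0. h x < a"
    proof eventually_elim
      case (elim x)
      then show ?case using mono[of x y] y by simp
    qed
  qed
qed

lemma tendsto_at_top_antimono_bounded:
  fixes h :: "real \<Rightarrow> real"
  assumes anti: "\<And>x y. b < x \<Longrightarrow> x \<le> y \<Longrightarrow> h y \<le> h x" and nonneg: "\<And>x. b < x \<Longrightarrow> 0 \<le> h x"
  shows "\<exists>l. (h \<longlongrightarrow> l) at_top"
proof
  let ?l = "Inf (h ` {b<..})"
  have bdd: "bdd_below (h ` {b<..})" using nonneg by (intro bdd_belowI[of _ 0]) auto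
  show "(h \<longlongrightarrow> ?l) at_top"
  proof (rule order_tendstoI)
    fix a assume "a < ?l"
    have le: "?l \<le> h x" if "b < x" for x using that bdd by (intro cInf_lower) auto
    show "\<forall>\<^sub>F x in at_top. a < h x"
      using eventually_gt_at_top[of b] by eventually_elim (rule less_le_trans[OF \<open>a < ?l\<close> le])
  next
    fix a assume "?l < a"
    then obtain y where y: "b < y" "h y < a" using cInf_lessD[of "h ` {b<..}" a] by auto
    show "\<forall>\<^sub>F x in at_top. h x < a"
      using eventually_ge_at_top[of y]
    proof eventually_elim
      case (elim x)
      then show ?case using anti[of y x] y by simp
    qed
  qed
qed

section \<open>Operator means of positive semidefinite matrices\<close>

abbreviation shift :: "nat \<Rightarrow> complex mat \<Rightarrow> real \<Rightarrow> complex mat" where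
  "shift n A \<epsilon> \<equiv> A + complex_of_real \<epsilon> \<cdot>\<^sub>m 1\<^sub>m n"

lemma shift_pd: "psd_mat n A \<Longrightarrow> 0 < \<epsilon> \<Longrightarrow> pd_mat n (shift n A \<epsilon>)"
  by (intro pd_add_right pd_smult_one)

lemma shift_psd: "psd_mat n A \<Longrightarrow> 0 < \<epsilon> \<Longrightarrow> psd_mat n (shift n A \<epsilon>)"
  by (rule pd_psd[OF shift_pd])

text \<open>
  Both the matrix and the shift may grow; this makes the regularized means decrease as the shift tends to 0.
\<close>

lemma shift_mono: "loewner_le n A B \<Longrightarrow> \<delta> \<le> \<epsilon> \<Longrightarrow> loewner_le n (shift n A \<delta>) (shift n B \<epsilon>)"
  by (intro loewner_le_add) (auto simp: loewner_le_def qf_smult[of _ n] qf_one mult_right_mono)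

text \<open>
  Split off one factor: \<open>y\<^sup>r = y y\<^sup>r\<^sup>-\<^sup>1\<close>, where the second factor decreases in \<open>y\<close>.
\<close>

lemma powr_add_le:
  fixes x e r :: real
  assumes "0 \<le> x" "0 < e" "0 < r" "r \<le> 1"
  shows "(x + e) powr r \<le> x powr r + e powr r"
proof (cases "x = 0")
  case False
  then have x: "0 < x" using assms by simp
  have split: "y powr r = y * y powr (r - 1)" if "0 < y" for y :: real
    using that powr_mult_base[of y "r - 1"] by simp
  have "(x + e) powr r = x * (x + e) powr (r - 1) + e * (x + e) powr (r - 1)"
    using x assms by (subst split) (auto simp: algebra_simps)
  also have "\<dots> \<le> x * x powr (r - 1) + e * e powr (r - 1)"
    using x assms by (intro add_mono mult_left_mono powr_mono2') auto
  finally show ?thesis using x assms by (simp add: split[symmetric])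
qed (use assms in auto)

context mean_function
begin

abbreviation approx :: "nat \<Rightarrow> complex mat \<Rightarrow> complex mat \<Rightarrow> real \<Rightarrow> complex mat" where
  "approx n A B \<epsilon> \<equiv> op_mean_pd f (shift n A \<epsilon>) (shift n B \<epsilon>)"

lemma approx_psd:
  assumes "psd_mat n A" "psd_mat n B" "0 < \<epsilon>"
  shows "psd_mat n (approx n A B \<epsilon>)"
  using assms by (intro op_mean_pd_psd shift_pd shift_psd)

lemma eventually_approx_herm:
  assumes "psd_mat n A" "psd_mat n B"
  shows "\<forall>\<^sub>F \<epsilon> in at_right 0. herm n (approx n A B \<epsilon>)"
  using eventually_at_right_less[of "0::real"] by eventually_elim (intro psd_herm approx_psd assms)

text \<open>
  The regularized means decrease with \<open>\<epsilon>\<close> by monotonicity in both arguments and are bounded below by 0, so the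
  limit that defines the mean exists.
\<close>

lemma op_mean_singular:
  assumes A: "psd_mat n A" "\<not> pd_mat n A" and B: "psd_mat n B"
  shows "mat_tendsto n (approx n A B) (op_mean n f A B) (at_right 0)"
proof -
  have "\<exists>L. mat_tendsto n (approx n A B) L (at_right 0)"
  proof (rule mat_tendsto_exists[OF eventually_approx_herm[OF A(1) B]])
    fix v :: "complex vec" assume v: "v \<in> carrier_vec n"
    show "\<exists>l. ((\<lambda>\<epsilon>. qf (approx n A B \<epsilon>) v) \<longlongrightarrow> l) (at_right 0)"
    proof (rule tendsto_at_right_mono_bounded)
      fix x y :: real assume xy: "0 < x" "x \<le> y"
      have "loewner_le n (approx n A B x) (op_mean_pd f (shift n A y) (shift n B x))"
        by (intro op_mean_pd_mono_left shift_pd shift_psd shift_mono loewner_le_refl psd_herm A B xy)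
      also have "loewner_le n \<dots> (approx n A B y)"
        using xy by (intro op_mean_pd_mono_right shift_pd shift_psd shift_mono loewner_le_refl psd_herm A B) auto
      finally show "qf (approx n A B x) v \<le> qf (approx n A B y) v" using v by (rule loewner_leD)
    next
      fix x :: real assume x: "0 < x"
      show "0 \<le> qf (approx n A B x) v" using approx_psd[OF A(1) B x] v by (simp add: psd_mat_iff)
    qed
  qed
  then have "\<exists>!L. mat_tendsto n (approx n A B) L (at_right 0)"
    using mat_tendsto_unique[of "at_right (0::real)"] by (auto simp: trivial_limit_at_right_real)
  from theI'[OF this] show ?thesis using A(2) by (simp add: op_mean_def)
qed

lemma op_mean_singular_qf:
  assumes A: "psd_mat n A" "\<not> pd_mat n A" and B: "psd_mat n B" and v: "v \<in> carrier_vec n"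
  shows "((\<lambda>\<epsilon>. qf (approx n A B \<epsilon>) v) \<longlongrightarrow> qf (op_mean n f A B) v) (at_right 0)"
  using eventually_approx_herm[OF A(1) B]
  by (intro mat_tendsto_qf[OF _ op_mean_singular[OF A B] v]) (auto elim!: eventually_mono intro: herm_carrier)

lemma op_mean_psd:
  assumes A: "psd_mat n A" and B: "psd_mat n B"
  shows "psd_mat n (op_mean n f A B)"
proof (cases "pd_mat n A")
  case True
  then show ?thesis using op_mean_pd_psd[OF True B] by (simp add: op_mean_def)
next
  case False
  show ?thesis unfolding psd_mat_iff
  proof (intro conjI ballI)
    show "herm n (op_mean n f A B)"
      using mat_tendsto_herm[OF eventually_approx_herm[OF A B] op_mean_singular[OF A False B]]
      by (simp add: trivial_limit_at_right_real)
    fix v :: "complex vec" assume v: "v \<in> carrier_vec n"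
    have "\<forall>\<^sub>F \<epsilon> in at_right 0. 0 \<le> qf (approx n A B \<epsilon>) v"
      using eventually_at_right_less[of "0::real"]
      by eventually_elim (use approx_psd[OF A B] v in \<open>simp add: psd_mat_iff\<close>)
    then show "0 \<le> qf (op_mean n f A B) v"
      using tendsto_lowerbound[OF op_mean_singular_qf[OF A False B v]] by (simp add: trivial_limit_at_right_real)
  qed
qed

lemma op_mean_scale:
  assumes A: "psd_mat n A" and B: "psd_mat n B" "psd_mat n B'" and c: "0 \<le> c" "c \<le> 1"
    and le: "loewner_le n (complex_of_real c \<cdot>\<^sub>m B) B'"
  shows "loewner_le n (complex_of_real c \<cdot>\<^sub>m op_mean n f A B) (op_mean n f A B')"
proof (cases "pd_mat n A")
  case True
  then show ?thesis using op_mean_pd_scale[OF True B(1) c le] by (simp add: op_mean_def)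
next
  case False
  have h: "herm n (op_mean n f A B)" "herm n (op_mean n f A B')" using A B by (auto intro: psd_herm op_mean_psd)
  have Bc: "B \<in> carrier_mat n n" using B by (simp add: herm_carrier psd_herm)
  have ev: "loewner_le n (complex_of_real c \<cdot>\<^sub>m approx n A B \<epsilon>) (approx n A B' \<epsilon>)" if "0 < \<epsilon>" for \<epsilon>
  proof (rule op_mean_pd_scale[OF shift_pd[OF A that] shift_psd[OF B(1) that] c])
    have "complex_of_real c \<cdot>\<^sub>m shift n B \<epsilon> = shift n (complex_of_real c \<cdot>\<^sub>m B) (c * \<epsilon>)"
      using Bc by (intro eq_matI) (auto simp: algebra_simps)
    also have "loewner_le n \<dots> (shift n B' \<epsilon>)"
      using that c by (intro shift_mono le) (auto intro: mult_left_le_one_le)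
    finally show "loewner_le n (complex_of_real c \<cdot>\<^sub>m shift n B \<epsilon>) (shift n B' \<epsilon>)" .
  qed
  show ?thesis unfolding loewner_le_def
  proof (intro conjI ballI herm_smult h)
    fix v :: "complex vec" assume v: "v \<in> carrier_vec n"
    have "c * qf (op_mean n f A B) v \<le> qf (op_mean n f A B') v"
    proof (rule tendsto_le)
      show "((\<lambda>\<epsilon>. qf (approx n A B' \<epsilon>) v) \<longlongrightarrow> qf (op_mean n f A B') v) (at_right 0)"
        by (rule op_mean_singular_qf[OF A False B(2) v])
      show "((\<lambda>\<epsilon>. c * qf (approx n A B \<epsilon>) v) \<longlongrightarrow> c * qf (op_mean n f A B) v) (at_right 0)"
        by (intro tendsto_mult_left op_mean_singular_qf[OF A False B(1) v])
      show "\<forall>\<^sub>F \<epsilon> in at_right 0. c * qf (approx n A B \<epsilon>) v \<le> qf (approx n A B' \<epsilon>) v"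
        using eventually_at_right_less[of "0::real"]
      proof eventually_elim
        case (elim \<epsilon>)
        show ?case using loewner_leD[OF ev[OF elim] v]
          qf_smult[OF herm_carrier[OF psd_herm[OF approx_psd[OF A B(1) elim]]] v, of c] by simp
      qed
    qed (simp add: trivial_limit_at_right_real)
    then show "qf (complex_of_real c \<cdot>\<^sub>m op_mean n f A B) v \<le> qf (op_mean n f A B') v"
      using h v by (simp add: qf_smult[of _ n] herm_carrier)
  qed
qed

text \<open>
  The mean regularizes both arguments at once, whereas the formula for projections needs the second one
  unperturbed. For \<open>\<delta> < \<epsilon>\<close> the regularized mean is at most \<open>(A + \<epsilon>) \<sigma> (B + \<delta>)\<close>. Here the perturbation of \<open>B\<close> enters the
  functional calculus as \<open>\<delta> (A + \<epsilon>)\<^sup>-\<^sup>1 \<le> \<delta>/\<epsilon>\<close>, a scalar shift of the fixed matrix \<open>T\<close>, so that \<open>\<delta> \<rightarrow> 0\<close> becomes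
  a limit of functions of \<open>T\<close>.
\<close>

lemma op_mean_singular_le:
  assumes A: "psd_mat n A" "\<not> pd_mat n A" and B: "psd_mat n B" and \<epsilon>: "0 < \<epsilon>"
  shows "loewner_le n (op_mean n f A B) (op_mean_pd f (shift n A \<epsilon>) B)"
proof -
  let ?A = "shift n A \<epsilon>"
  let ?S = "mat_powr ?A (1/2)" and ?W = "mat_powr ?A (-1/2)"
  have Ae: "pd_mat n ?A" by (rule shift_pd[OF A(1) \<epsilon>])
  have hA: "herm n A" "herm n ?A" using A Ae by (auto simp: psd_herm pd_herm)
  have Sc: "?S \<in> carrier_mat n n" "?W \<in> carrier_mat n n" "B \<in> carrier_mat n n"
    using hA B by (auto simp: mat_powr_carrier herm_carrier psd_herm)
  have hS: "herm n ?S" "herm n ?W" using hA by (auto simp: mat_powr_herm)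
  define T where "T = ?W * B * ?W"
  have T: "psd_mat n T" unfolding T_def by (rule mean_inner_psd[OF Ae B])
  define G where "G \<delta> = ?S * mat_fun (\<lambda>x. f (x + \<delta> / \<epsilon>)) T * ?S" for \<delta>
  have WW: "loewner_le n (?W * ?W) (complex_of_real (1 / \<epsilon>) \<cdot>\<^sub>m 1\<^sub>m n)"
  proof -
    have "?W * ?W = mat_powr ?A (-1)" by (simp add: mat_powr_mult[OF hA(2)])
    then have "?W * ?W = mat_fun (\<lambda>x. (x + \<epsilon>) powr (-1)) A"
      by (simp only: add_smult_one_eq_mat_fun[OF hA(1)] mat_powr_def mat_fun_comp[OF hA(1)])
    moreover have "loewner_le n (mat_fun (\<lambda>x. (x + \<epsilon>) powr (-1)) A) (mat_fun (\<lambda>_. 1 / \<epsilon>) A)"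
      using \<epsilon> by (intro mat_fun_le[OF A(1)]) (auto simp: powr_minus_divide intro!: divide_left_mono)
    ultimately show ?thesis by (simp only: mat_fun_const[OF hA(1)])
  qed
  have le: "loewner_le n (approx n A B \<delta>) (G \<delta>)" if \<delta>: "0 < \<delta>" "\<delta> < \<epsilon>" for \<delta>
  proof -
    have "loewner_le n (approx n A B \<delta>) (op_mean_pd f ?A (shift n B \<delta>))"
      using \<delta> by (intro op_mean_pd_mono_left shift_pd shift_psd shift_mono loewner_le_refl psd_herm A B) auto
    also have "op_mean_pd f ?A (shift n B \<delta>) = ?S * mat_fun f (T + complex_of_real \<delta> \<cdot>\<^sub>m (?W * ?W)) * ?S"
    proof -
      have "?W * shift n B \<delta> * ?W = T + complex_of_real \<delta> \<cdot>\<^sub>m (?W * ?W)"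
        unfolding T_def using Sc mult_sq[OF Sc(2) Sc(3)]
        by (simp add: mult_add_distrib_mat[of _ n n _ n] add_mult_distrib_mat[of _ n n _ _ n]
           mult_smult_distrib[of _ n n _ n] mult_smult_assoc_mat[of _ n n _ n] right_mult_one_mat[of _ n n] del: assoc_mult_mat)
      then show ?thesis by (simp only: op_mean_pd_def)
    qed
    also have "loewner_le n \<dots> (G \<delta>)"
    proof -
      have hWW: "herm n (?W * ?W)" using loewner_le_herm[OF WW] by simp
      have WWp: "psd_mat n (?W * ?W)" using psd_gram[OF Sc(2)] by (simp only: hermD[OF hS(2)])
      have "loewner_le n (complex_of_real \<delta> \<cdot>\<^sub>m (?W * ?W)) (complex_of_real (\<delta> / \<epsilon>) \<cdot>\<^sub>m 1\<^sub>m n)"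
      proof -
        have "complex_of_real \<delta> \<cdot>\<^sub>m (complex_of_real (1 / \<epsilon>) \<cdot>\<^sub>m 1\<^sub>m n) = complex_of_real (\<delta> / \<epsilon>) \<cdot>\<^sub>m 1\<^sub>m n"
          by (intro eq_matI) auto
        then show ?thesis using loewner_le_smult[OF WW, of \<delta>] \<delta> by simp
      qed
      then have "loewner_le n (T + complex_of_real \<delta> \<cdot>\<^sub>m (?W * ?W)) (shift n T (\<delta> / \<epsilon>))"
        by (intro loewner_le_add loewner_le_refl psd_herm T)
      moreover have "psd_mat n (T + complex_of_real \<delta> \<cdot>\<^sub>m (?W * ?W))"
        using \<delta> by (intro psd_add T psd_smult WWp) auto
      ultimately have "loewner_le n (mat_fun f (T + complex_of_real \<delta> \<cdot>\<^sub>m (?W * ?W))) (mat_fun f (shift n T (\<delta> / \<epsilon>)))"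
        using mono by (simp add: operator_monotone_iff)
      then show ?thesis unfolding G_def
        by (intro loewner_le_sandwich hS) (simp only: add_smult_one_eq_mat_fun[OF psd_herm[OF T]] mat_fun_comp[OF psd_herm[OF T]])
    qed
    finally show ?thesis .
  qed
  show ?thesis unfolding loewner_le_def
  proof (intro conjI ballI)
    show "herm n (op_mean n f A B)" by (intro psd_herm op_mean_psd A B)
    show "herm n (op_mean_pd f ?A B)" by (intro psd_herm op_mean_pd_psd Ae B)
    fix v :: "complex vec" assume v: "v \<in> carrier_vec n"
    have Sv: "?S *\<^sub>v v \<in> carrier_vec n" using Sc(1) v by (rule mult_vec_carrier)
    have qfS: "qf (?S * Y * ?S) v = qf Y (?S *\<^sub>v v)" if "Y \<in> carrier_mat n n" for Y
      using qf_congruence[OF Sc(1) that v] by (simp add: hermD[OF hS(1)])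
    show "qf (op_mean n f A B) v \<le> qf (op_mean_pd f ?A B) v"
    proof (rule tendsto_le)
      show "((\<lambda>\<delta>. qf (approx n A B \<delta>) v) \<longlongrightarrow> qf (op_mean n f A B) v) (at_right 0)"
        by (rule op_mean_singular_qf[OF A B v])
      have "((\<lambda>\<delta>. qf (mat_fun (\<lambda>x. f (x + \<delta> / \<epsilon>)) T) (?S *\<^sub>v v)) \<longlongrightarrow> qf (mat_fun f T) (?S *\<^sub>v v)) (at_right 0)"
      proof (rule mat_fun_tendsto[OF T Sv])
        fix x :: real assume x: "0 \<le> x"
        have "((\<lambda>\<delta>. x + \<delta> / \<epsilon>) \<longlongrightarrow> x + 0 / \<epsilon>) (at_right 0)" using \<epsilon> by (intro tendsto_intros) auto
        then have "((\<lambda>\<delta>. f (x + \<delta> / \<epsilon>)) \<longlongrightarrow> f (x + 0 / \<epsilon>)) (at_right 0)"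
          using x \<epsilon> eventually_at_right_less[of "0::real"]
          by (intro continuous_on_tendsto_compose[OF cont]) (auto elim!: eventually_mono)
        then show "((\<lambda>\<delta>. f (x + \<delta> / \<epsilon>)) \<longlongrightarrow> f x) (at_right 0)" by simp
      qed
      then show "((\<lambda>\<delta>. qf (G \<delta>) v) \<longlongrightarrow> qf (op_mean_pd f ?A B) v) (at_right 0)"
        unfolding G_def op_mean_pd_def T_def[symmetric] qfS[OF mat_fun_carrier[OF psd_herm[OF T]]] .
      show "\<forall>\<^sub>F \<delta> in at_right 0. qf (approx n A B \<delta>) v \<le> qf (G \<delta>) v"
        using eventually_at_right_real[OF \<epsilon>] by eventually_elim (use loewner_leD[OF le v] in auto)
    qed (simp add: trivial_limit_at_right_real)
  qed
qed

end

context mean_function_0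
begin

text \<open>
  For singular \<open>A\<close>, bound \<open>A \<sigma> P\<close> by \<open>(A + \<epsilon>) \<sigma> P\<close>, apply the definite case to \<open>A + \<epsilon>\<close>, and enlarge \<open>(A + \<epsilon>)\<^sup>r\<close> to
  \<open>A\<^sup>r + \<epsilon>\<^sup>r\<close> and \<open>P\<close> to \<open>P + \<epsilon>\<^sup>r\<close>. The result is the regularization of \<open>A\<^sup>r \<sigma> P\<close> at \<open>\<epsilon>\<^sup>r\<close>, and \<open>\<epsilon>\<^sup>r\<close> tends to 0 with \<open>\<epsilon>\<close>.
\<close>

lemma op_mean_projection_powr_le:
  assumes A: "psd_mat n A" and P: "herm n P" "P * P = P" and r: "0 < r" "r \<le> 1"
    and fr: "\<And>x. 0 < x \<Longrightarrow> f x powr r \<le> f (x powr r)"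
  shows "loewner_le n (mat_powr (op_mean n f A P) r) (op_mean n f (mat_powr A r) P)"
proof (cases "pd_mat n A")
  case True
  then show ?thesis using op_mean_pd_projection_powr_le[OF True P r fr] mat_powr_pd[OF True, of r] by (simp add: op_mean_def)
next
  case False
  let ?Ar = "mat_powr A r"
  have hA: "herm n A" using A by (rule psd_herm)
  have Pp: "psd_mat n P" by (rule projection_le_one(2)[OF P])
  have Ar: "psd_mat n ?Ar" "\<not> pd_mat n ?Ar" using A False r by (auto simp: mat_powr_psd mat_powr_pd_iff)
  have le: "loewner_le n (mat_powr (op_mean n f A P) r) (approx n ?Ar P (\<epsilon> powr r))" if \<epsilon>: "0 < \<epsilon>" for \<epsilon>
  proof -
    have e: "0 < \<epsilon> powr r" using \<epsilon> by simp
    have Ae: "pd_mat n (shift n A \<epsilon>)" by (rule shift_pd[OF A \<epsilon>])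
    have "loewner_le n (mat_powr (op_mean n f A P) r) (mat_powr (op_mean_pd f (shift n A \<epsilon>) P) r)"
      by (rule loewner_heinz[OF op_mean_psd[OF A Pp] op_mean_singular_le[OF A False Pp \<epsilon>] r])
    also have "loewner_le n \<dots> (op_mean_pd f (mat_powr (shift n A \<epsilon>) r) P)"
      by (rule op_mean_pd_projection_powr_le[OF Ae P r fr])
    also have "loewner_le n \<dots> (op_mean_pd f (shift n ?Ar (\<epsilon> powr r)) P)"
    proof (rule op_mean_pd_mono_left[OF mat_powr_pd[OF Ae] _ Pp])
      have "loewner_le n (mat_fun (\<lambda>x. (x + \<epsilon>) powr r) A) (mat_fun (\<lambda>x. x powr r + \<epsilon> powr r) A)"
        using \<epsilon> r by (intro mat_fun_le[OF A] powr_add_le)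
      then show "loewner_le n (mat_powr (shift n A \<epsilon>) r) (shift n ?Ar (\<epsilon> powr r))"
        by (simp add: add_smult_one_eq_mat_fun[OF hA] add_smult_one_eq_mat_fun[OF mat_fun_herm[OF hA]] mat_powr_def mat_fun_comp[OF hA])
    qed
    also have "loewner_le n \<dots> (approx n ?Ar P (\<epsilon> powr r))"
      by (intro op_mean_pd_mono_right shift_pd Ar Pp e loewner_le_add_psd psd_herm psd_smult_one less_imp_le)
    finally show ?thesis .
  qed
  have lim: "filterlim (\<lambda>\<epsilon>. \<epsilon> powr r) (at_right 0) (at_right 0)"
  proof -
    have "((\<lambda>\<epsilon>. \<epsilon> powr r) \<longlongrightarrow> 0 powr r) (at_right 0)"
      using r eventually_at_right_less[of "0::real"] by (intro tendsto_powr' tendsto_intros) (auto elim!: eventually_mono)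
    then show ?thesis using eventually_at_right_less[of "0::real"]
      by (auto simp: filterlim_at elim!: eventually_mono)
  qed
  show ?thesis
  proof (rule loewner_le_limit_right)
    show "herm n (mat_powr (op_mean n f A P) r)" by (intro mat_powr_herm psd_herm op_mean_psd A Pp)
    show "herm n (op_mean n f ?Ar P)" by (intro psd_herm op_mean_psd Ar Pp)
    show "((\<lambda>\<epsilon>. qf (approx n ?Ar P (\<epsilon> powr r)) v) \<longlongrightarrow> qf (op_mean n f ?Ar P) v) (at_right 0)"
      if "v \<in> carrier_vec n" for v
      by (rule filterlim_compose[OF op_mean_singular_qf[OF Ar Pp that] lim])
    show "\<forall>\<^sub>F \<epsilon> in at_right 0. loewner_le n (mat_powr (op_mean n f A P) r) (approx n ?Ar P (\<epsilon> powr r))"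
      using eventually_at_right_less[of "0::real"] by eventually_elim (rule le)
  qed (simp add: trivial_limit_at_right_real)
qed

end

section \<open>Convergence of the roots of the means\<close>

text \<open>
  Take the range projection for \<open>P\<close>, and for the constants the smallest nonzero eigenvalue and the reciprocal of
  the largest one, both cut off at 1 so that the scaling inequality for means applies.
\<close>

lemma range_projection_bounds:
  assumes B: "psd_mat n B"
  obtains P c C where "herm n P" "P * P = P" "0 < c" "c \<le> 1" "0 < C" "C \<le> 1"
    "loewner_le n (complex_of_real c \<cdot>\<^sub>m P) B" "loewner_le n (complex_of_real C \<cdot>\<^sub>m B) P"
proof -
  obtain U b where U: "U \<in> carrier_mat n n" "unitary_mat U" "B = conj_diag n U b" "\<And>i. i < n \<Longrightarrow> 0 \<le> b i"
    by (rule psdE[OF B], rule that)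
  let ?h = "\<lambda>i. if b i = 0 then 0 else 1 :: real"
  let ?P = "conj_diag n U ?h"
  define c where "c = Min (insert 1 (b ` {i. i < n \<and> b i \<noteq> 0}))"
  define M where "M = Max (insert 1 (b ` {i. i < n}))"
  have c: "0 < c" "c \<le> 1" "\<And>i. i < n \<Longrightarrow> b i \<noteq> 0 \<Longrightarrow> c \<le> b i"
  proof -
    have "0 < b i" if "i < n" "b i \<noteq> 0" for i using U(4)[OF that(1)] that(2) by simp
    then show "0 < c" "c \<le> 1" "\<And>i. i < n \<Longrightarrow> b i \<noteq> 0 \<Longrightarrow> c \<le> b i" unfolding c_def by auto
  qed
  have M: "1 \<le> M" "\<And>i. i < n \<Longrightarrow> b i \<le> M" unfolding M_def by auto
  show ?thesis
  proof (rule that[of ?P c "1 / M"])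
    show "herm n ?P" by (rule conj_diag_herm[OF U(1)])
    show "?P * ?P = ?P" unfolding conj_diag_mult[OF U(1,2)] by (rule conj_diag_cong) simp
    show "loewner_le n (complex_of_real c \<cdot>\<^sub>m ?P) B"
      unfolding U(3) conj_diag_smult[OF U(1,2)] using c by (intro conj_diag_le[OF U(1)]) auto
    show "loewner_le n (complex_of_real (1 / M) \<cdot>\<^sub>m B) ?P"
      unfolding U(3) conj_diag_smult[OF U(1,2)] using M by (intro conj_diag_le[OF U(1)]) (auto simp: divide_simps)
  qed (use c M in auto)
qed

theorem corollary3p4:
  fixes f :: "real \<Rightarrow> real" and n :: nat and A B :: "complex mat"
  assumes "continuous_on {0..} f"
    and "\<And>x. 0 \<le> x \<Longrightarrow> 0 \<le> f x"
    and "operator_monotone f"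
    and "f 1 = 1"
    and "f 0 = 0"
    and "\<And>x r. 0 < x \<Longrightarrow> 0 < r \<Longrightarrow> r < 1 \<Longrightarrow> f (x powr r) \<ge> (f x) powr r"
    and "psd_mat n A" and "psd_mat n B"
  shows "\<exists>L. mat_tendsto n (\<lambda>p::real. mat_powr (op_mean n f (mat_powr A p) B) (1 / p)) L at_top"
proof -
  interpret mean_function_0 f
    by unfold_locales (fact assms)+
  note A = assms(7) and B = assms(8)
  obtain P c C where P: "herm n P" "P * P = P" and c: "0 < c" "c \<le> 1" and C: "0 < C" "C \<le> 1"
    and PB: "loewner_le n (complex_of_real c \<cdot>\<^sub>m P) B" and BP: "loewner_le n (complex_of_real C \<cdot>\<^sub>m B) P"
    using range_projection_bounds[OF B] .
  have Pp: "psd_mat n P" by (rule projection_le_one(2)[OF P])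
  define M where "M D p = op_mean n f (mat_powr A p) D" for D p
  have Mpsd: "psd_mat n (M D p)" if "psd_mat n D" for D p
    unfolding M_def by (intro op_mean_psd mat_powr_psd A that)
  have root_psd: "psd_mat n (mat_powr (M D p) (1 / p))" if "psd_mat n D" for D p
    by (intro mat_powr_psd Mpsd that)
  have decr: "loewner_le n (mat_powr (M P q) (1 / q)) (mat_powr (M P p) (1 / p))" if pq: "1 < p" "p \<le> q" for p q
  proof (cases "p = q")
    case True
    then show ?thesis by (simp add: loewner_le_refl psd_herm root_psd Pp)
  next
    case False
    \<comment> \<open>The exponent that carries \<open>A\<^sup>q\<close> to \<open>A\<^sup>p\<close>, and whose product with \<open>1/p\<close> is \<open>1/q\<close>.\<close>
    define r where "r = p / q"
    have r: "0 < r" "r < 1" "q * r = p" "r * (1 / p) = 1 / q" using pq False by (auto simp: r_def field_simps)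
    have "loewner_le n (mat_powr (M P q) r) (op_mean n f (mat_powr (mat_powr A q) r) P)"
      unfolding M_def using r assms(6) by (intro op_mean_projection_powr_le mat_powr_psd A P) auto
    also have "op_mean n f (mat_powr (mat_powr A q) r) P = M P p"
      by (simp only: M_def mat_powr_powr[OF psd_herm[OF A]] r(3))
    finally have "loewner_le n (mat_powr (mat_powr (M P q) r) (1 / p)) (mat_powr (M P p) (1 / p))"
      using pq by (intro loewner_heinz mat_powr_psd Mpsd Pp) auto
    then show ?thesis by (simp only: mat_powr_powr[OF psd_herm[OF Mpsd[OF Pp]]] r(4))
  qed
  have lim: "\<exists>l. ((\<lambda>p. qf (mat_powr (M B p) (1 / p)) v) \<longlongrightarrow> l) at_top" if v: "v \<in> carrier_vec n" for v
  proof -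
    define x y where "x p = qf (mat_powr (M B p) (1 / p)) v" and "y p = qf (mat_powr (M P p) (1 / p)) v" for p
    have "\<exists>l. (y \<longlongrightarrow> l) at_top"
    proof (rule tendsto_at_top_antimono_bounded[of 1])
      show "y q \<le> y p" if "1 < p" "p \<le> q" for p q unfolding y_def by (rule loewner_leD[OF decr[OF that] v])
      show "0 \<le> y p" for p using root_psd[OF Pp, of p] v by (simp add: y_def psd_mat_iff)
    qed
    then obtain l where l: "(y \<longlongrightarrow> l) at_top" by blast
    have scale: "a powr (1 / p) * qf (mat_powr (M D p) (1 / p)) v \<le> qf (mat_powr (M D' p) (1 / p)) v"
      if p: "1 < p" and a: "0 < a" "a \<le> 1" and D: "psd_mat n D" "psd_mat n D'" "loewner_le n (complex_of_real a \<cdot>\<^sub>m D) D'" for a p D D'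
    proof -
      have "loewner_le n (complex_of_real a \<cdot>\<^sub>m M D p) (M D' p)"
        unfolding M_def using a by (intro op_mean_scale mat_powr_psd A D) auto
      then have "loewner_le n (mat_powr (complex_of_real a \<cdot>\<^sub>m M D p) (1 / p)) (mat_powr (M D' p) (1 / p))"
        using a p by (intro loewner_heinz psd_smult Mpsd D) auto
      then have "loewner_le n (complex_of_real (a powr (1 / p)) \<cdot>\<^sub>m mat_powr (M D p) (1 / p)) (mat_powr (M D' p) (1 / p))"
        using a by (simp add: mat_powr_scale[OF Mpsd[OF D(1)]])
      from loewner_leD[OF this v] show ?thesis
        using qf_smult[OF herm_carrier[OF psd_herm[OF root_psd[OF D(1)]]] v] by simp
    qed
    have lo: "\<forall>\<^sub>F p in at_top. c powr (1 / p) * y p \<le> x p"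
      using eventually_gt_at_top[of 1] unfolding x_def y_def by eventually_elim (rule scale[OF _ c Pp B PB])
    have up: "\<forall>\<^sub>F p in at_top. x p \<le> y p / C powr (1 / p)"
      using eventually_gt_at_top[of 1]
    proof eventually_elim
      case (elim p)
      then show ?case using scale[OF elim C B Pp BP] C by (simp add: x_def y_def pos_le_divide_eq mult.commute)
    qed
    have root: "((\<lambda>p. a powr (1 / p)) \<longlongrightarrow> 1) at_top" if "0 < a" for a :: real
    proof -
      have "((\<lambda>p. a powr (1 / p)) \<longlongrightarrow> a powr 0) at_top"
        using that tendsto_inverse_0_at_top[OF filterlim_ident]
        by (intro tendsto_powr tendsto_const) (auto simp: inverse_eq_divide)
      then show ?thesis using that by simp
    qed
    have "((\<lambda>p. c powr (1 / p) * y p) \<longlongrightarrow> l) at_top" using tendsto_mult[OF root[OF c(1)] l] by simp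
    moreover have "((\<lambda>p. y p / C powr (1 / p)) \<longlongrightarrow> l) at_top" using tendsto_divide[OF l root[OF C(1)]] by simp
    ultimately have "(x \<longlongrightarrow> l) at_top" by (rule tendsto_sandwich[OF lo up])
    then show ?thesis unfolding x_def by blast
  qed
  have "\<exists>L. mat_tendsto n (\<lambda>p. mat_powr (M B p) (1 / p)) L at_top"
  proof (rule mat_tendsto_exists[OF _ lim])
    show "\<forall>\<^sub>F p in at_top. herm n (mat_powr (M B p) (1 / p))"
      by (rule always_eventually) (rule allI, rule psd_herm[OF root_psd[OF B]])
  qed
  then show ?thesis by (simp only: M_def)
qed

end
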